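(* Let $D\ge1$ be an integer and let $\mathcal{G}=(V,E)$ be a finite tree with diameter at most $L$ and vertex degree at most $D+1$, i.e. $\deg(v)\le D+1$ for every $v\in V$. Then the following hold. (i) If $L=2R$ for some positive integer $R$, then $$\lambda_2(\mathcal{G})\ge\frac{1}{\sum_{i=0}^{R-1}D^i}=\frac{D-1}{D^R-1}.$$ Moreover, equality holds if and only if $\mathcal{G}$ contains a subgraph $\mathcal{G}_1=(\mathcal{H}_1(y,x))^2_x$, where $(y,x)$ is an edge of $T_{D+1}$ and $\mathcal{H}_1$ is the branch from $(y,x)$ in the subtree generated by the ball $B_R(x)$ in $T_{D+1}$. (ii) If $L=2R+1$ for some positive integer $R$, then $$\lambda_2(\mathcal{G})\ge\frac{2}{2\sum_{i=0}^{R-1}D^i+D^R}=\frac{2(D-1)}{D^{R+1}+D^R-2}.$$ Moreover, equality holds if and only if $\mathcal{G}=\mathcal{F}$, where $\mathcal{F}$ is the subtree generated by $B_R(z)\cup B_R(w)$ in $T_{D+1}$ for an edge $(z,w)$ of $T_{D+1}$. (The second expressions in the two displays are understood for $D\ge2$.)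
   Context: All trees considered have at least two vertices. For a finite tree $\mathcal{G}=(V,E)$, the boundary $\delta\mathcal{G}$ is the set of vertices of degree one and $\Omega:=V\setminus\delta\mathcal{G}$ is the interior. For $f\in\mathbb{R}^V$, $\Delta f(x)=\sum_{y\sim x}(f(x)-f(y))$, and for $x\in\delta\mathcal{G}$ with its neighbor $y$, $\frac{\partial f}{\partial n}(x)=f(x)-f(y)$. A real $\lambda$ is a Steklov eigenvalue of $\mathcal{G}$ if there is a nonzero $f\in\mathbb{R}^V$ with $\Delta f=0$ on $\Omega$ and $\frac{\partial f}{\partial n}=\lambda f$ on $\delta\mathcal{G}$. Counted with multiplicity these are $0=\lambda_1<\lambda_2\le\dots\le\lambda_{|\delta\mathcal{G}|}$, and $\lambda_2(\mathcal{G})$ denotes the first nonzero one. $T_{D+1}$ is the (infinite) $(D+1)$-regular tree; $B_R(x)$ is the ball of radius $R$ centered at $x$ for the combinatorial metric. For an edge $(y,x)$ of a tree, the branch from $(y,x)$ is the connected component $\mathcal{H}$ containing $y$ after removing the edge between $y$ and $x$; $\mathcal{H}(y,x)$ is the subtree generated by the vertices of $\mathcal{H}$ together with $x$. For a tree $\mathcal{H}$ and a vertex $x$ of it, $(\mathcal{H})^2_x$ denotes the graph obtained from the disjoint union of $\mathcal{H}$ and an isomorphic copy $\mathcal{H}'$ by identifying $x$ with its copy $x'$. "$\mathcal{G}$ contains a subgraph $\mathcal{G}_1$" means there is an injective graph homomorphism from $\mathcal{G}_1$ to $\mathcal{G}$; graphs are not distinguished up to isomorphism. *)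

theory Defs
  imports Complex_Main
begin

section \<open>Simple graphs and trees\<close>

text \<open>Graphs may be infinite, since the regular tree below is. The notion of a tree in the
  library Graph_Theory forbids directed cycles of every length, hence all pairs of opposite arcs,
  and so does not cover undirected trees.\<close>

record 'a sgraph =
  gverts :: "'a set"
  gadj :: "'a \<Rightarrow> 'a \<Rightarrow> bool"

definition simple_graph :: "'a sgraph \<Rightarrow> bool" where
  "simple_graph G \<longleftrightarrow>
     (\<forall>u v. gadj G u v \<longrightarrow> u \<in> gverts G \<and> v \<in> gverts G \<and> u \<noteq> v \<and> gadj G v u)"

definition connected_graph :: "'a sgraph \<Rightarrow> bool" where
  "connected_graph G \<longleftrightarrow>
     gverts G \<noteq> {} \<and> (\<forall>u\<in>gverts G. \<forall>v\<in>gverts G. (gadj G)\<^sup>*\<^sup>* u v)"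

definition graph_cycle :: "'a sgraph \<Rightarrow> 'a list \<Rightarrow> bool" where
  "graph_cycle G p \<longleftrightarrow>
     3 \<le> length p \<and> distinct p \<and> successively (gadj G) p \<and> gadj G (last p) (hd p)"

definition tree_graph :: "'a sgraph \<Rightarrow> bool" where
  "tree_graph G \<longleftrightarrow> simple_graph G \<and> connected_graph G \<and> (\<nexists>p. graph_cycle G p)"

definition graph_degree :: "'a sgraph \<Rightarrow> 'a \<Rightarrow> nat" where
  "graph_degree G v = card {u. gadj G v u}"

text \<open>The distance is a junk value for vertices in different components.\<close>

definition graph_dist :: "'a sgraph \<Rightarrow> 'a \<Rightarrow> 'a \<Rightarrow> nat" where
  "graph_dist G u v = (LEAST n. (gadj G ^^ n) u v)"

definition graph_ball :: "'a sgraph \<Rightarrow> 'a \<Rightarrow> nat \<Rightarrow> 'a set" where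
  "graph_ball G x R = {v \<in> gverts G. graph_dist G x v \<le> R}"

text \<open>Only meaningful for finite nonempty graphs.\<close>

definition graph_diameter :: "'a sgraph \<Rightarrow> nat" where
  "graph_diameter G = Max {graph_dist G u v | u v. u \<in> gverts G \<and> v \<in> gverts G}"

definition generated_subgraph :: "'a sgraph \<Rightarrow> 'a set \<Rightarrow> 'a sgraph" where
  "generated_subgraph G S =
     \<lparr>gverts = gverts G \<inter> S, gadj = (\<lambda>u v. gadj G u v \<and> u \<in> S \<and> v \<in> S)\<rparr>"

definition contains_subgraph :: "'a sgraph \<Rightarrow> 'b sgraph \<Rightarrow> bool" where
  "contains_subgraph G H \<longleftrightarrow>
     (\<exists>\<phi>. inj_on \<phi> (gverts H) \<and> \<phi> ` gverts H \<subseteq> gverts G \<and>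
          (\<forall>u\<in>gverts H. \<forall>v\<in>gverts H. gadj H u v \<longrightarrow> gadj G (\<phi> u) (\<phi> v)))"

definition isomorphic_graphs :: "'a sgraph \<Rightarrow> 'b sgraph \<Rightarrow> bool" where
  "isomorphic_graphs G H \<longleftrightarrow>
     (\<exists>\<phi>. bij_betw \<phi> (gverts G) (gverts H) \<and>
          (\<forall>u\<in>gverts G. \<forall>v\<in>gverts G. gadj G u v \<longleftrightarrow> gadj H (\<phi> u) (\<phi> v)))"

section \<open>Branches and doubling\<close>

definition delete_edge :: "'a sgraph \<Rightarrow> 'a \<Rightarrow> 'a \<Rightarrow> 'a sgraph" where
  "delete_edge G y x =
     \<lparr>gverts = gverts G, gadj = (\<lambda>u v. gadj G u v \<and> {u, v} \<noteq> {y, x})\<rparr>"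

definition branch :: "'a sgraph \<Rightarrow> 'a \<Rightarrow> 'a \<Rightarrow> 'a sgraph" where
  "branch G y x =
     generated_subgraph (delete_edge G y x) {v. (gadj (delete_edge G y x))\<^sup>*\<^sup>* y v}"

text \<open>This is the graph written H(y,x), where H is the branch from (y,x).\<close>

definition rooted_branch :: "'a sgraph \<Rightarrow> 'a \<Rightarrow> 'a \<Rightarrow> 'a sgraph" where
  "rooted_branch G y x = generated_subgraph G (gverts (branch G y x) \<union> {x})"

text \<open>The two copies of H are tagged by a Boolean; \<open>double_proj x\<close> is the quotient map that
  identifies the two copies of \<open>x\<close>.\<close>

definition double_proj :: "'a \<Rightarrow> 'a \<times> bool \<Rightarrow> 'a \<times> bool" where
  "double_proj x p = (if fst p = x then (x, False) else p)"

definition doubled_graph :: "'a sgraph \<Rightarrow> 'a \<Rightarrow> ('a \<times> bool) sgraph" where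
  "doubled_graph H x =
     \<lparr>gverts = double_proj x ` (gverts H \<times> UNIV),
      gadj = (\<lambda>p q. \<exists>u v c. gadj H u v \<and> p = double_proj x (u, c) \<and> q = double_proj x (v, c))\<rparr>"

section \<open>The Steklov problem\<close>

definition steklov_boundary :: "'a sgraph \<Rightarrow> 'a set" where
  "steklov_boundary G = {x \<in> gverts G. graph_degree G x = 1}"

definition steklov_interior :: "'a sgraph \<Rightarrow> 'a set" where
  "steklov_interior G = gverts G - steklov_boundary G"

definition graph_laplacian :: "'a sgraph \<Rightarrow> ('a \<Rightarrow> real) \<Rightarrow> 'a \<Rightarrow> real" where
  "graph_laplacian G f x = (\<Sum>y | gadj G x y. f x - f y)"

text \<open>Only used at boundary vertices, where the neighbour is unique.\<close>

definition normal_derivative :: "'a sgraph \<Rightarrow> ('a \<Rightarrow> real) \<Rightarrow> 'a \<Rightarrow> real" where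
  "normal_derivative G f x = f x - f (THE y. gadj G x y)"

text \<open>Values of \<open>f\<close> outside the vertex set are irrelevant, hence nonzero means nonzero at some
  vertex.\<close>

definition steklov_eigenvalue :: "'a sgraph \<Rightarrow> real \<Rightarrow> bool" where
  "steklov_eigenvalue G l \<longleftrightarrow>
     (\<exists>f. (\<exists>x\<in>gverts G. f x \<noteq> 0) \<and>
          (\<forall>x\<in>steklov_interior G. graph_laplacian G f x = 0) \<and>
          (\<forall>x\<in>steklov_boundary G. normal_derivative G f x = l * f x))"

definition steklov_lambda2 :: "'a sgraph \<Rightarrow> real" where
  "steklov_lambda2 G = Min {l. steklov_eigenvalue G l \<and> l \<noteq> 0}"

section \<open>The infinite regular tree\<close>

text \<open>A vertex of the \<open>k\<close>-regular tree is the list of turns on the way from the root \<open>[]\<close>: the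
  root has \<open>k\<close> children, every other vertex has \<open>k - 1\<close> children and its parent.\<close>

definition regular_tree :: "nat \<Rightarrow> nat list sgraph" where
  "regular_tree k =
     (let V = {xs. xs = [] \<or> hd xs < k \<and> (\<forall>i\<in>set (tl xs). i < k - 1)}
      in \<lparr>gverts = V,
          gadj = (\<lambda>u v. u \<in> V \<and> v \<in> V \<and> (\<exists>i. v = u @ [i] \<or> u = v @ [i]))\<rparr>)"

lemma gverts_regular_tree:
  "gverts (regular_tree k) = {xs. xs = [] \<or> hd xs < k \<and> (\<forall>i\<in>set (tl xs). i < k - 1)}"
  by (simp add: regular_tree_def Let_def)

lemma gadj_regular_tree:
  "gadj (regular_tree k) u v \<longleftrightarrow>
     u \<in> gverts (regular_tree k) \<and> v \<in> gverts (regular_tree k) \<and>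
     (\<exists>i. v = u @ [i] \<or> u = v @ [i])"
  by (simp add: regular_tree_def Let_def)

lemma snoc_in_regular_tree:
  "xs @ [i] \<in> gverts (regular_tree k) \<longleftrightarrow>
     xs \<in> gverts (regular_tree k) \<and> i < (if xs = [] then k else k - 1)"
  by (cases xs) (auto simp: gverts_regular_tree)

lemma simple_graph_regular_tree: "simple_graph (regular_tree k)"
  by (auto simp: simple_graph_def gadj_regular_tree)

lemma connected_graph_regular_tree: "connected_graph (regular_tree k)"
proof -
  let ?T = "regular_tree k"
  have sym: "gadj ?T u v \<Longrightarrow> gadj ?T v u" for u v
    using simple_graph_regular_tree[of k] by (simp add: simple_graph_def)
  have from_root: "xs \<in> gverts ?T \<Longrightarrow> (gadj ?T)\<^sup>*\<^sup>* [] xs" for xs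
  proof (induction xs rule: rev_induct)
    case (snoc i xs)
    then have "xs \<in> gverts ?T" by (simp add: snoc_in_regular_tree)
    moreover from this snoc.prems have "gadj ?T xs (xs @ [i])" by (auto simp: gadj_regular_tree)
    ultimately show ?case using snoc.IH by (meson rtranclp.rtrancl_into_rtrancl)
  qed simp
  have to_root: "xs \<in> gverts ?T \<Longrightarrow> (gadj ?T)\<^sup>*\<^sup>* xs []" for xs
  proof (induction xs rule: rev_induct)
    case (snoc i xs)
    then have "xs \<in> gverts ?T" by (simp add: snoc_in_regular_tree)
    moreover from this snoc.prems have "gadj ?T (xs @ [i]) xs" by (auto simp: gadj_regular_tree)
    ultimately show ?case using snoc.IH by (meson converse_rtranclp_into_rtranclp)
  qed simp
  have "[] \<in> gverts ?T" by (simp add: gverts_regular_tree)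
  then show ?thesis
    using from_root to_root unfolding connected_graph_def by (metis empty_iff rtranclp_trans)
qed

lemma acyclic_regular_tree: "\<not> graph_cycle (regular_tree k) p"
proof
  let ?T = "regular_tree k"
  assume cyc: "graph_cycle ?T p"
  define n where "n = length p"
  have n: "3 \<le> n" and dist: "distinct p" and suc: "successively (gadj ?T) p"
    and cl: "gadj ?T (last p) (hd p)"
    using cyc by (auto simp: graph_cycle_def n_def)
  have ne: "p \<noteq> []" using n by (auto simp: n_def)
  have sym: "gadj ?T u v \<Longrightarrow> gadj ?T v u" for u v
    using simple_graph_regular_tree[of k] by (simp add: simple_graph_def)
  have step: "gadj ?T (p ! i) (p ! (Suc i mod n))" if "i < n" for i
  proof (cases "Suc i = n")
    case True
    then have "i = length p - 1" and "Suc i mod n = 0" by (auto simp: n_def)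
    then show ?thesis using cl ne by (simp add: last_conv_nth hd_conv_nth)
  next
    case False
    then show ?thesis using that suc by (auto simp: successively_conv_nth n_def)
  qed
  have "\<exists>i. i < n \<and> (\<forall>j<n. length (p ! j) \<le> length (p ! i))"
  proof -
    let ?S = "(\<lambda>j. length (p ! j)) ` {..<n}"
    have "Max ?S \<in> ?S" using n by (intro Max_in) (auto simp: lessThan_empty_iff)
    then obtain i where "i < n" "Max ?S = length (p ! i)" by auto
    moreover have "length (p ! j) \<le> Max ?S" if "j < n" for j using that by (intro Max_ge) auto
    ultimately show ?thesis by auto
  qed
  then obtain i where i: "i < n" and mx: "\<And>j. j < n \<Longrightarrow> length (p ! j) \<le> length (p ! i)" by blast
  have parent: "p ! j = butlast (p ! i)" if "j < n" "gadj ?T (p ! i) (p ! j)" for j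
    using that mx[OF that(1)] by (auto simp: gadj_regular_tree)
  define a where "a = Suc i mod n"
  define b where "b = (if i = 0 then n - 1 else i - 1)"
  have ab: "a < n" "b < n" using n i by (auto simp: a_def b_def)
  have "Suc b mod n = i" using n i by (auto simp: b_def)
  then have "gadj ?T (p ! i) (p ! b)" using step[OF ab(2)] sym by simp
  moreover have "gadj ?T (p ! i) (p ! a)" using step[OF i] by (simp add: a_def)
  ultimately have "p ! a = p ! b" using parent ab by metis
  then have "a = b" using dist ab by (simp add: nth_eq_iff_index_eq n_def)
  then show False using n i by (cases "Suc i = n") (auto simp: a_def b_def split: if_splits)
qed

lemma tree_graph_regular_tree: "tree_graph (regular_tree k)"
  by (simp add: tree_graph_def simple_graph_regular_tree connected_graph_regular_tree
      acyclic_regular_tree)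

lemma graph_degree_regular_tree:
  assumes "v \<in> gverts (regular_tree k)"
  shows "graph_degree (regular_tree k) v = k"
proof (cases v rule: rev_cases)
  case Nil
  then have "{u. gadj (regular_tree k) v u} = (\<lambda>i. [i]) ` {..<k}"
    by (auto simp: gadj_regular_tree gverts_regular_tree)
  then show ?thesis by (simp add: graph_degree_def card_image inj_on_def)
next
  case (snoc xs j)
  have "{u. gadj (regular_tree k) v u} = insert xs ((\<lambda>i. v @ [i]) ` {..<k - 1})"
    using assms snoc by (auto simp: gadj_regular_tree snoc_in_regular_tree
        simp del: append_assoc)
  moreover have "xs \<notin> (\<lambda>i. v @ [i]) ` {..<k - 1}" using snoc by auto
  moreover have "0 < k" using assms snoc by (auto simp: snoc_in_regular_tree split: if_splits)
  ultimately show ?thesis by (simp add: graph_degree_def card_image inj_on_def)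
qed

lemma infinite_regular_tree:
  assumes "2 \<le> k"
  shows "infinite (gverts (regular_tree k))"
proof -
  have "replicate n 0 \<in> gverts (regular_tree k)" for n
    using assms by (cases n) (auto simp: gverts_regular_tree)
  then have "range (\<lambda>n. replicate n 0) \<subseteq> gverts (regular_tree k)" by auto
  moreover have "inj (\<lambda>n. replicate n (0::nat))" by (auto intro!: injI)
  ultimately show ?thesis using finite_subset finite_imageD[of _ UNIV] infinite_UNIV_nat by metis
qed

end

theory Submission
  imports Defs "HOL-Analysis.Function_Topology"
begin

text \<open>Root the tree at a centre: a vertex x with all vertices at distance at most R if the diameter is
  at most 2 R, an edge if it is at most 2 R + 1. Give an edge whose lower end v has level k the weight
  D^(R-k), an upper bound for the number of boundary vertices below v. For a boundary vertex l, write f l - f x as the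
  sum of the increments of f along the path from x to l; the Cauchy-Schwarz inequality with these
  weights, whose sum along a path is at most 1 + D + ... + D^(R-1), and summation over l give a Poincare
  inequality for the Dirichlet energy. An eigenfunction has mean zero on the boundary, so
  subtracting f x does not decrease its boundary norm and the bound on the eigenvalue follows. For a
  central edge the value of f at its midpoint replaces f x.

  In case of equality the increments along every path are proportional to the weights, and harmonicity
  of f forces D children at every vertex below one with nonzero increment. Since f changes sign on the
  boundary, there are two full branches at x, or full branches at both ends of the central edge.
  Conversely, on full branches the function with increments plus or minus the weights, extended by
  zero, is an eigenfunction for the extremal value.\<close>

section \<open>Trees rooted at a vertex or at an edge\<close>

text \<open>\<open>steklov_lambda2\<close> is a \<open>Min\<close>, which says nothing until the set
  of nonzero eigenvalues is known to be finite and nonempty. Finiteness comes from orthogonality on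
  the boundary, existence from maximising a quotient of quadratic forms over a compact set of
  functions.

  The weights are tuned to lose nothing on a full tree: after exchanging the sums over boundary
  vertices and path edges, the squared increment at v has as coefficient the number of boundary
  vertices below v divided by D^(R-k), which the degree bound keeps at most 1. The two halves of a
  central edge carry half of the difference each; together they must give back its whole square
  although up to D^R boundary vertices lie below either end, and this fixes the half weight b = D^R
  / 2.

  The equality statements concern every edge of the regular tree, whereas its encoding prefers the
  vertex \<open>[]\<close>. Instead of automorphisms, equality is expressed by full branches inside
  G, and the same rooted-tree notions, stated without finiteness, are applied to the regular tree
  rooted at the given vertex or edge.\<close>

lemma tree_graph_sym: "tree_graph G \<Longrightarrow> gadj G u v \<Longrightarrow> gadj G v u"
  and tree_graph_verts: "tree_graph G \<Longrightarrow> gadj G u v \<Longrightarrow> u \<in> gverts G \<and> v \<in> gverts G"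
  and tree_graph_irrefl: "tree_graph G \<Longrightarrow> gadj G u v \<Longrightarrow> u \<noteq> v"
  by (auto simp: tree_graph_def simple_graph_def)

text \<open>Loops are cut off: when the walk returns to a vertex already visited, the path is
  truncated there. The predicate \<open>P\<close> is carried along so that a whole path can be kept
  away from a vertex.\<close>

lemma rtranclp_imp_simple_path:
  assumes "r\<^sup>*\<^sup>* u w" "P u" "\<And>a b. r a b \<Longrightarrow> P b"
  shows "\<exists>p. p \<noteq> [] \<and> hd p = u \<and> last p = w \<and> distinct p \<and> successively r p \<and> list_all P p"
  using assms(1)
proof induction
  case base
  show ?case by (rule exI[of _ "[u]"]) (simp add: assms(2))
next
  case (step w w')
  then obtain p where p: "p \<noteq> []" "hd p = u" "last p = w" "distinct p" "successively r p"
    "list_all P p" by blast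
  show ?case
  proof (cases "w' \<in> set p")
    case True
    then obtain as bs where "p = as @ w' # bs" by (meson split_list)
    with p have "as @ [w'] \<noteq> []" "hd (as @ [w']) = u" "distinct (as @ [w'])"
      "successively r (as @ [w'])" "list_all P (as @ [w'])"
      by (auto simp: successively_append_iff hd_append split: if_splits)
    then show ?thesis by (metis last_snoc)
  next
    case False
    have "successively r (p @ [w'])" using p step.hyps(2) by (simp add: successively_append_iff)
    moreover have "list_all P (p @ [w'])" using p assms(3)[OF step.hyps(2)] by simp
    ultimately show ?thesis using p False
      by (intro exI[of _ "p @ [w']"]) auto
  qed
qed

text \<open>A path from \<open>u\<close> to \<open>u'\<close> that avoids \<open>v\<close> closes up
  through \<open>v\<close> to a cycle, of length at least three since \<open>u \<noteq> u'\<close>.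
  All uses of acyclicity pass through this lemma.\<close>

lemma tree_neighbours_separated:
  assumes "tree_graph G" "gadj G v u" "gadj G v u'"
    and "(\<lambda>a b. gadj G a b \<and> a \<noteq> v \<and> b \<noteq> v)\<^sup>*\<^sup>* u u'"
  shows "u = u'"
proof (rule ccontr)
  assume ne: "u \<noteq> u'"
  have "u \<noteq> v" using assms tree_graph_irrefl by metis
  then obtain p where p: "p \<noteq> []" "hd p = u" "last p = u'" "distinct p"
    "successively (\<lambda>a b. gadj G a b \<and> a \<noteq> v \<and> b \<noteq> v) p" "list_all (\<lambda>a. a \<noteq> v) p"
    using rtranclp_imp_simple_path[OF assms(4), of "\<lambda>a. a \<noteq> v"] by blast
  have "v \<notin> set p" using p(6) by (auto simp: list_all_iff)
  have suc: "successively (gadj G) p" using p(5) by (rule successively_mono) auto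
  have "length p \<ge> 2"
    using p ne by (cases p; cases "tl p") auto
  moreover have "gadj G u' v" using assms tree_graph_sym by metis
  ultimately have "graph_cycle G (p @ [v])"
    using p suc \<open>v \<notin> set p\<close> assms(2) by (auto simp: graph_cycle_def successively_append_iff)
  then show False using assms(1) by (auto simp: tree_graph_def)
qed

text \<open>In a tree a nonempty clique is a single vertex or the two ends of an edge, so
  \<open>Z\<close> covers both kinds of centre at once. The infinite regular tree is rooted in the
  same way.\<close>

locale rooted_tree =
  fixes G :: "'a sgraph" and Z :: "'a set"
  assumes tree: "tree_graph G"
    and root_verts: "Z \<subseteq> gverts G"
    and root_nonempty: "Z \<noteq> {}"
    and root_clique: "\<And>u v. u \<in> Z \<Longrightarrow> v \<in> Z \<Longrightarrow> u \<noteq> v \<Longrightarrow> gadj G u v"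
begin

lemma adj_sym: "gadj G u v \<Longrightarrow> gadj G v u"
  using tree by (rule tree_graph_sym)

lemma adj_verts: "gadj G u v \<Longrightarrow> u \<in> gverts G" "gadj G u v \<Longrightarrow> v \<in> gverts G"
  using tree_graph_verts[OF tree] by auto

lemma adj_irrefl: "\<not> gadj G u u"
  using tree_graph_irrefl[OF tree] by blast

definition level :: "'a \<Rightarrow> nat" where
  "level v = (LEAST n. \<exists>z\<in>Z. (gadj G ^^ n) z v)"

lemma level_walk:
  assumes "v \<in> gverts G"
  shows "\<exists>z\<in>Z. (gadj G ^^ level v) z v"
proof -
  obtain z where z: "z \<in> Z" using root_nonempty by blast
  then have "(gadj G)\<^sup>*\<^sup>* z v"
    using tree assms root_verts by (auto simp: tree_graph_def connected_graph_def)
  then obtain n where "(gadj G ^^ n) z v" using rtranclp_power[of "gadj G" z v] by auto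
  with z have "\<exists>n. \<exists>z\<in>Z. (gadj G ^^ n) z v" by blast
  then show ?thesis unfolding level_def by (rule LeastI_ex)
qed

lemma level_le: "z \<in> Z \<Longrightarrow> (gadj G ^^ n) z v \<Longrightarrow> level v \<le> n"
  unfolding level_def by (rule Least_le) blast

lemma level_eq_0: "v \<in> gverts G \<Longrightarrow> level v = 0 \<longleftrightarrow> v \<in> Z"
  using level_walk[of v] level_le[of v 0 v] by auto

lemma level_adj: "gadj G u v \<Longrightarrow> level v \<le> Suc (level u)"
  using level_walk[of u] level_le[of _ "Suc (level u)" v] adj_verts(1)[of u v] by auto

section \<open>Lower neighbours and parents\<close>

lemma ex_lower_neighbour:
  assumes "v \<in> gverts G" "v \<notin> Z"
  shows "\<exists>u. gadj G v u \<and> level v = Suc (level u)"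
proof -
  obtain n where n: "level v = Suc n" using level_eq_0[OF assms(1)] assms(2) by (cases "level v") auto
  then obtain z u where "z \<in> Z" "(gadj G ^^ n) z u" "gadj G u v"
    using level_walk[OF assms(1)] by auto
  then show ?thesis using level_le[of z n u] level_adj[of u v] n adj_sym by fastforce
qed

text \<open>Repeatedly passing to a lower neighbour leads from \<open>u\<close> to a root through
  levels strictly below that of \<open>v\<close>, so the walk cannot meet \<open>v\<close>.\<close>

lemma root_path_avoiding:
  assumes "u \<in> gverts G" "u \<noteq> v" "level u \<le> level v" "v \<notin> Z"
  shows "\<exists>z\<in>Z. (\<lambda>a b. gadj G a b \<and> a \<noteq> v \<and> b \<noteq> v)\<^sup>*\<^sup>* u z"
  using assms(1-3)
proof (induction "level u" arbitrary: u rule: less_induct)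
  case less
  show ?case
  proof (cases "u \<in> Z")
    case False
    then obtain w where w: "gadj G u w" "level u = Suc (level w)"
      using ex_lower_neighbour less.prems by blast
    then have "w \<noteq> v" using less.prems by auto
    then obtain z where "z \<in> Z" "(\<lambda>a b. gadj G a b \<and> a \<noteq> v \<and> b \<noteq> v)\<^sup>*\<^sup>* w z"
      using less.hyps[of w] w less.prems adj_verts by auto
    then show ?thesis using w \<open>w \<noteq> v\<close> less.prems
      by (metis (mono_tags, lifting) converse_rtranclp_into_rtranclp)
  qed blast
qed

text \<open>Two such neighbours would be joined through the root set by a walk avoiding
  \<open>v\<close>. Together with the existence of a lower neighbour, the weak inequality also rules
  out neighbours on the level of \<open>v\<close>, so every edge outside \<open>Z\<close> is a
  parent edge.\<close>

lemma lower_neighbour_unique: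
  assumes "v \<notin> Z" "gadj G v u" "gadj G v u'" "level u \<le> level v" "level u' \<le> level v"
  shows "u = u'"
proof -
  let ?r = "\<lambda>a b. gadj G a b \<and> a \<noteq> v \<and> b \<noteq> v"
  have "u \<in> gverts G" "u \<noteq> v" "u' \<in> gverts G" "u' \<noteq> v"
    using assms(2,3) adj_verts adj_irrefl by blast+
  then obtain z z' where z: "z \<in> Z" "?r\<^sup>*\<^sup>* u z" and z': "z' \<in> Z" "?r\<^sup>*\<^sup>* u' z'"
    using root_path_avoiding[of u v] root_path_avoiding[of u' v] assms(1,4,5) by blast
  have "symp ?r" by (rule sympI) (blast dest: adj_sym)
  then have "?r\<^sup>*\<^sup>* z' u'" by (rule sympD[OF symp_rtranclp, OF _ z'(2)])
  moreover have "?r\<^sup>*\<^sup>* z z'"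
    using z(1) z'(1) root_clique[of z z'] assms(1) by (cases "z = z'") auto
  ultimately have "?r\<^sup>*\<^sup>* u u'" using z(2) by (meson rtranclp_trans)
  then show ?thesis using tree_neighbours_separated[OF tree assms(2,3)] by blast
qed

definition parent :: "'a \<Rightarrow> 'a" where
  "parent v = (THE u. gadj G v u \<and> level u \<le> level v)"

lemma parent_eqI:
  assumes "v \<notin> Z" "gadj G v u" "level u \<le> level v"
  shows "parent v = u"
  unfolding parent_def using assms lower_neighbour_unique by (intro the_equality) blast+

lemma
  assumes "v \<in> gverts G" "v \<notin> Z"
  shows adj_parent: "gadj G v (parent v)"
    and level_parent: "level v = Suc (level (parent v))"
    and parent_verts: "parent v \<in> gverts G"
  using ex_lower_neighbour[OF assms] parent_eqI[OF assms(2)] adj_verts by force+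

lemma adj_cases:
  assumes "gadj G u v"
  obtains "u \<in> Z" "v \<in> Z" "u \<noteq> v" | "v \<notin> Z" "parent v = u" | "u \<notin> Z" "parent u = v"
proof (cases "level u \<le> level v")
  case True
  show ?thesis
  proof (cases "v \<in> Z")
    case True
    then show ?thesis
      using \<open>level u \<le> level v\<close> that(1) assms adj_verts level_eq_0 adj_irrefl by (metis le_zero_eq)
  next
    case False
    then show ?thesis using that(2) parent_eqI True adj_sym[OF assms] by blast
  qed
next
  case False
  then have "u \<notin> Z" using level_eq_0[of u] assms adj_verts by fastforce
  then show ?thesis using that(3) parent_eqI False assms by simp
qed

lemma level_induct [consumes 1, case_names root step]:
  assumes "v \<in> gverts G"
    and "\<And>v. v \<in> Z \<Longrightarrow> P v"
    and "\<And>v. v \<in> gverts G \<Longrightarrow> v \<notin> Z \<Longrightarrow> P (parent v) \<Longrightarrow> P v"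
  shows "P v"
  using assms(1)
proof (induction "level v" arbitrary: v)
  case 0
  then show ?case using assms(2) level_eq_0[of v] by auto
next
  case (Suc n)
  then have "v \<notin> Z" using level_eq_0[of v] by auto
  then show ?case using Suc assms(3) level_parent parent_verts by (metis nat.inject)
qed

section \<open>Children, ancestors and generations\<close>

definition children :: "'a \<Rightarrow> 'a set" where
  "children v = {u. gadj G v u \<and> u \<notin> Z \<and> parent u = v}"

lemma children_iff:
  "u \<in> children v \<longleftrightarrow> u \<in> gverts G \<and> u \<notin> Z \<and> parent u = v"
  unfolding children_def using adj_parent adj_sym adj_verts by blast

lemma level_children: "u \<in> children v \<Longrightarrow> level u = Suc (level v)"
  using level_parent by (auto simp: children_iff)

lemma neighbours_nonroot:
  assumes "v \<in> gverts G" "v \<notin> Z"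
  shows "{u. gadj G v u} = insert (parent v) (children v)" "parent v \<notin> children v"
proof -
  show "{u. gadj G v u} = insert (parent v) (children v)"
    using assms adj_parent[OF assms] by (auto simp: children_def elim: adj_cases)
  show "parent v \<notin> children v"
    using level_children[of "parent v" v] level_parent[OF assms] by auto
qed

lemma neighbours_root:
  assumes "v \<in> Z"
  shows "{u. gadj G v u} = (Z - {v}) \<union> children v" "Z \<inter> children v = {}"
  using assms root_clique[of v] by (auto simp: children_def elim: adj_cases)

text \<open>The bound \<open>k \<le> level v\<close> stops at the root, where \<open>parent\<close>
  has no meaning. The set contains \<open>v\<close> and represents the path from the root to
  \<open>v\<close>, each edge being named by its lower end; with two roots, the root in it names
  half of the central edge.\<close>

definition ancestors :: "'a \<Rightarrow> 'a set" where
  "ancestors v = {(parent ^^ k) v | k. k \<le> level v}"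

lemma ancestors_root: "v \<in> Z \<Longrightarrow> ancestors v = {v}"
  using root_verts level_eq_0[of v] by (auto simp: ancestors_def)

lemma ancestors_step:
  assumes "v \<in> gverts G" "v \<notin> Z"
  shows "ancestors v = insert v (ancestors (parent v))"
proof -
  have image: "ancestors u = (\<lambda>k. (parent ^^ k) u) ` {..level u}" for u
    unfolding ancestors_def setcompr_eq_image atMost_def ..
  show ?thesis
    unfolding image level_parent[OF assms] atMost_Suc_eq_insert_0
    by (simp add: image_image funpow_swap1)
qed

lemma self_in_ancestors: "v \<in> ancestors v"
  by (auto simp: ancestors_def intro: exI[of _ 0])

lemma ancestors_verts:
  assumes "v \<in> gverts G" "u \<in> ancestors v"
  shows "u \<in> gverts G \<and> level u \<le> level v \<and> (level u = level v \<longrightarrow> u = v)"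
  using assms
proof (induction rule: level_induct)
  case (root v)
  then show ?case using root_verts by (auto simp: ancestors_root)
next
  case (step v)
  then show ?case using level_parent[of v] by (auto simp: ancestors_step)
qed

lemma finite_ancestors: "v \<in> gverts G \<Longrightarrow> finite (ancestors v)"
  by (induction rule: level_induct) (auto simp: ancestors_root ancestors_step)

lemma not_ancestor_of_parent:
  "v \<in> gverts G \<Longrightarrow> v \<notin> Z \<Longrightarrow> v \<notin> ancestors (parent v)"
  using ancestors_verts[of "parent v" v] level_parent[of v] parent_verts[of v] by auto

lemma ancestors_trans:
  assumes "w \<in> gverts G" "v \<in> ancestors w" "u \<in> ancestors v"
  shows "u \<in> ancestors w"
  using assms by (induction rule: level_induct) (auto simp: ancestors_root ancestors_step)

lemma ancestors_level_inj:
  assumes "v \<in> gverts G" "u \<in> ancestors v" "u' \<in> ancestors v" "level u = level u'"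
  shows "u = u'"
  using assms
proof (induction rule: level_induct)
  case (root v)
  then show ?case by (simp add: ancestors_root)
next
  case (step v)
  show ?case
  proof (cases "level u = level v")
    case True
    then show ?thesis using step.prems ancestors_verts[of v] step.hyps by auto
  next
    case False
    then have "u \<in> ancestors (parent v)" "u' \<in> ancestors (parent v)"
      using step.prems step.hyps by (auto simp: ancestors_step)
    then show ?thesis using step.IH step.prems by blast
  qed
qed

lemma ex_ancestor_level:
  assumes "v \<in> gverts G" "j \<le> level v"
  shows "\<exists>u\<in>ancestors v. level u = j"
  using assms
proof (induction rule: level_induct)
  case (root v)
  then show ?case using root_verts level_eq_0[of v] by (auto simp: ancestors_root)
next
  case (step v)
  then show ?case using level_parent[of v] by (cases "j = level v") (auto simp: ancestors_step)
qed

definition descendants :: "'a \<Rightarrow> nat \<Rightarrow> 'a set" where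
  "descendants v k = {u \<in> gverts G. v \<in> ancestors u \<and> level u = level v + k}"

lemma descendants_0:
  assumes "v \<in> gverts G"
  shows "descendants v 0 = {v}"
proof -
  have "u = v" if "u \<in> gverts G" "v \<in> ancestors u" "level u = level v" for u
    using ancestors_verts[OF that(1,2)] that(3) by simp
  then show ?thesis using assms self_in_ancestors[of v] by (auto simp: descendants_def)
qed

lemma descendants_Suc: "descendants v (Suc k) = {u \<in> gverts G. u \<notin> Z \<and> parent u \<in> descendants v k}"
  (is "?A = ?B")
proof (intro set_eqI iffI)
  fix u assume u: "u \<in> ?A"
  then have "u \<in> gverts G" "level u = Suc (level v + k)" by (simp_all add: descendants_def)
  moreover from this have "u \<notin> Z" using level_eq_0[of u] by auto
  ultimately show "u \<in> ?B"
    using u level_parent[of u] parent_verts[of u] ancestors_step[of u]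
    by (auto simp: descendants_def)
next
  fix u assume "u \<in> ?B"
  then show "u \<in> ?A" using level_parent[of u] ancestors_step[of u] by (auto simp: descendants_def)
qed

lemma descendants_Suc_children: "descendants v (Suc k) = (\<Union>u\<in>descendants v k. children u)"
  by (auto simp: descendants_Suc children_iff)

lemma ancestors_imp_descendants:
  "v \<in> gverts G \<Longrightarrow> u \<in> ancestors v \<Longrightarrow> v \<in> descendants u (level v - level u)"
  using ancestors_verts[of v u] by (auto simp: descendants_def)

end

lemma rooted_tree_vertex: "tree_graph G \<Longrightarrow> x \<in> gverts G \<Longrightarrow> rooted_tree G {x}"
  by unfold_locales auto

lemma rooted_tree_edge:
  assumes "tree_graph G" "gadj G z w"
  shows "rooted_tree G {z, w}"
  by unfold_locales
     (use assms tree_graph_verts[OF assms] tree_graph_sym[OF assms] in auto)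

section \<open>Energy and Steklov eigenfunctions\<close>

definition arcs :: "'a sgraph \<Rightarrow> ('a \<times> 'a) set" where
  "arcs G = {(x, y). gadj G x y}"

text \<open>The halving compensates that \<open>arcs\<close> contains every edge in both
  orientations. The set of pairs is a parameter because the variance on the boundary will be treated
  as the energy of the pairs in \<open>bd \<times> bd\<close>.\<close>

definition energy :: "('a \<times> 'a) set \<Rightarrow> ('a \<Rightarrow> real) \<Rightarrow> ('a \<Rightarrow> real) \<Rightarrow> real" where
  "energy P f g = (\<Sum>(x, y)\<in>P. (f x - f y) * (g x - g y)) / 2"

lemma energy_commute: "energy P f g = energy P g f"
  by (simp add: energy_def mult.commute)

lemma energy_add:
  "energy P (\<lambda>x. f x + t * g x) (\<lambda>x. f x + t * g x)
     = energy P f f + 2 * t * energy P f g + t\<^sup>2 * energy P g g"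
proof -
  have "energy P f f + 2 * t * energy P f g + t\<^sup>2 * energy P g g
      = (\<Sum>p\<in>P. (f (fst p) - f (snd p)) * (f (fst p) - f (snd p))
          + 2 * t * ((f (fst p) - f (snd p)) * (g (fst p) - g (snd p)))
          + t\<^sup>2 * ((g (fst p) - g (snd p)) * (g (fst p) - g (snd p)))) / 2"
    by (simp add: energy_def sum.distrib sum_distrib_left case_prod_beta add_divide_distrib)
  then show ?thesis
    by (simp add: energy_def case_prod_beta power2_eq_square algebra_simps)
qed

lemma energy_affine:
  assumes "\<And>x y. (x, y) \<in> P \<Longrightarrow> h x - h y = t * (g x - g y)"
  shows "energy P h h = t\<^sup>2 * energy P g g"
proof -
  have "(\<Sum>(x, y)\<in>P. (h x - h y) * (h x - h y)) = (\<Sum>(x, y)\<in>P. t\<^sup>2 * ((g x - g y) * (g x - g y)))"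
    by (rule sum.cong) (auto simp: assms power2_eq_square)
  then show ?thesis by (simp add: energy_def sum_distrib_left case_prod_beta)
qed

lemma energy_nonneg: "0 \<le> energy P f f"
  by (simp add: energy_def case_prod_beta sum_nonneg)

lemma energy_eq_0D: "finite P \<Longrightarrow> energy P f f = 0 \<Longrightarrow> (x, y) \<in> P \<Longrightarrow> f x = f y"
  by (simp add: energy_def case_prod_beta sum_nonneg_eq_0_iff) fastforce

lemma energy_ge_arc:
  assumes "finite P" "(x, y) \<in> P" "(y, x) \<in> P"
  shows "(f x - f y)\<^sup>2 \<le> energy P f f"
proof (cases "x = y")
  case False
  have "(\<Sum>(x, y)\<in>{(x, y), (y, x)}. (f x - f y) * (f x - f y)) \<le> (\<Sum>(x, y)\<in>P. (f x - f y) * (f x - f y))"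
    by (rule sum_mono2) (use assms in auto)
  then show ?thesis using False by (simp add: energy_def power2_eq_square algebra_simps)
qed (simp add: energy_nonneg)

text \<open>Swapping the ends of arcs turns one half of the product
  \<open>(f x - f y) * (g x - g y)\<close> into the other, so the energy is the sum of
  \<open>g x * (f x - f y)\<close> over all arcs.\<close>

lemma energy_green:
  assumes "finite (gverts G)" "simple_graph G"
  shows "energy (arcs G) f g = (\<Sum>x\<in>gverts G. g x * graph_laplacian G f x)"
proof -
  have fin: "finite {y. gadj G x y}" for x
    by (rule finite_subset[OF _ assms(1)]) (use assms(2) in \<open>auto simp: simple_graph_def\<close>)
  have arcs: "arcs G = Sigma (gverts G) (\<lambda>x. {y. gadj G x y})"
    using assms(2) by (auto simp: arcs_def simple_graph_def)
  have "(\<Sum>x\<in>gverts G. g x * graph_laplacian G f x) = (\<Sum>(x, y)\<in>arcs G. g x * (f x - f y))"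
    unfolding arcs graph_laplacian_def sum_distrib_left
    by (rule sum.Sigma) (use assms fin in auto)
  moreover have "(\<Sum>(x, y)\<in>arcs G. g x * (f x - f y)) = (\<Sum>(x, y)\<in>arcs G. g y * (f y - f x))"
    by (rule sum.reindex_bij_witness[of _ prod.swap prod.swap])
       (use assms(2) in \<open>auto simp: arcs_def simple_graph_def\<close>)
  moreover have "(\<Sum>(x, y)\<in>arcs G. (f x - f y) * (g x - g y))
      = (\<Sum>(x, y)\<in>arcs G. g x * (f x - f y)) + (\<Sum>(x, y)\<in>arcs G. g y * (f y - f x))"
    by (simp add: sum.distrib[symmetric] case_prod_beta algebra_simps)
  ultimately show ?thesis by (simp add: energy_def)
qed

text \<open>One equation on all vertices, possible because at a vertex of degree one the normal
  derivative is the Laplacian. In this form Green's formula pairs it with any test function.\<close>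

definition steklov_eigenfunction :: "'a sgraph \<Rightarrow> real \<Rightarrow> ('a \<Rightarrow> real) \<Rightarrow> bool" where
  "steklov_eigenfunction G l f \<longleftrightarrow> (\<exists>x\<in>gverts G. f x \<noteq> 0) \<and>
     (\<forall>x\<in>gverts G. graph_laplacian G f x = (if x \<in> steklov_boundary G then l * f x else 0))"

lemma normal_derivative_eq_laplacian:
  assumes "x \<in> steklov_boundary G"
  shows "normal_derivative G f x = graph_laplacian G f x"
proof -
  have "card {y. gadj G x y} = 1"
    using assms by (simp add: steklov_boundary_def graph_degree_def)
  then obtain y where y: "{y. gadj G x y} = {y}" by (auto simp: card_1_singleton_iff)
  then have "(THE y. gadj G x y) = y" by blast
  with y show ?thesis by (simp add: normal_derivative_def graph_laplacian_def)
qed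

lemma steklov_eigenvalue_iff: "steklov_eigenvalue G l \<longleftrightarrow> (\<exists>f. steklov_eigenfunction G l f)"
proof -
  have "(\<forall>x\<in>steklov_interior G. graph_laplacian G f x = 0) \<and>
        (\<forall>x\<in>steklov_boundary G. normal_derivative G f x = l * f x) \<longleftrightarrow>
        (\<forall>x\<in>gverts G. graph_laplacian G f x = (if x \<in> steklov_boundary G then l * f x else 0))" for f
    by (auto simp: normal_derivative_eq_laplacian steklov_interior_def steklov_boundary_def)
  then show ?thesis by (simp add: steklov_eigenvalue_def steklov_eigenfunction_def)
qed

locale finite_tree =
  fixes G :: "'a sgraph"
  assumes tree_G: "tree_graph G" and finite_verts: "finite (gverts G)"
    and two_verts: "2 \<le> card (gverts G)"
begin

abbreviation "V \<equiv> gverts G"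
abbreviation "bd \<equiv> steklov_boundary G"

lemma finite_bd: "finite bd" and bd_verts: "bd \<subseteq> V"
  using finite_verts by (auto simp: steklov_boundary_def)

lemma finite_arcs: "finite (arcs G)"
  by (rule finite_subset[of _ "V \<times> V"])
     (use tree_graph_verts[OF tree_G] finite_verts in \<open>auto simp: arcs_def\<close>)

lemma finite_neighbours: "finite {u. gadj G v u}"
  by (rule finite_subset[of _ V]) (use tree_graph_verts[OF tree_G] finite_verts in auto)

lemma green: "energy (arcs G) f g = (\<Sum>x\<in>V. g x * graph_laplacian G f x)"
  using energy_green finite_verts tree_G by (auto simp: tree_graph_def)

lemma energy_0_const:
  assumes "energy (arcs G) f f = 0" "x \<in> V" "y \<in> V"
  shows "f x = f y"
proof -
  have "(gadj G)\<^sup>*\<^sup>* x y" using assms tree_G by (auto simp: tree_graph_def connected_graph_def)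
  then show ?thesis
    by induction (use energy_eq_0D[OF finite_arcs assms(1)] in \<open>auto simp: arcs_def\<close>)
qed

lemma ex_other_vertex: "\<exists>y\<in>V. y \<noteq> x"
proof (rule ccontr)
  assume "\<not> ?thesis"
  then have "V \<subseteq> {x}" by auto
  then have "card V \<le> 1" using card_mono[of "{x}" V] by simp
  then show False using two_verts by simp
qed

lemma ex_neighbour:
  assumes "x \<in> V"
  shows "\<exists>y. gadj G x y"
proof -
  obtain y where "y \<in> V" "y \<noteq> x" using ex_other_vertex by blast
  moreover from this have "(gadj G)\<^sup>*\<^sup>* x y"
    using assms tree_G by (auto simp: tree_graph_def connected_graph_def)
  ultimately show ?thesis by (metis converse_rtranclpE)
qed

end

text \<open>Cauchy-Schwarz with its exact defect, so that the inequality and its equality case come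
  from one computation. An index with \<open>w i = 0\<close> has \<open>a i = 0\<close> and adds 0
  on both sides, in accordance with \<open>x / 0 = 0\<close>.\<close>

lemma weighted_Cauchy_identity:
  fixes a w :: "'i \<Rightarrow> real"
  assumes "finite I" "\<And>i. i \<in> I \<Longrightarrow> w i = 0 \<Longrightarrow> a i = 0" "sum w I \<noteq> 0"
  shows "(\<Sum>i\<in>I. (a i - sum a I / sum w I * w i)\<^sup>2 / w i)
     = (\<Sum>i\<in>I. (a i)\<^sup>2 / w i) - (sum a I)\<^sup>2 / sum w I"
proof -
  define t where "t = sum a I / sum w I"
  have "(a i - t * w i)\<^sup>2 / w i = (a i)\<^sup>2 / w i - 2 * t * a i + t\<^sup>2 * w i" if "i \<in> I" for i
    using assms(2)[OF that] by (cases "w i = 0") (auto simp: field_simps power2_eq_square)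
  then have "(\<Sum>i\<in>I. (a i - t * w i)\<^sup>2 / w i)
      = (\<Sum>i\<in>I. (a i)\<^sup>2 / w i - 2 * t * a i + t\<^sup>2 * w i)" by (rule sum.cong[OF refl])
  also have "\<dots> = (\<Sum>i\<in>I. (a i)\<^sup>2 / w i) - 2 * t * sum a I + t\<^sup>2 * sum w I"
    by (simp add: sum.distrib sum_subtractf sum_distrib_left)
  also have "\<dots> = (\<Sum>i\<in>I. (a i)\<^sup>2 / w i) - (sum a I)\<^sup>2 / sum w I"
    using assms(3) by (simp add: t_def field_simps power2_eq_square)
  finally show ?thesis by (simp add: t_def)
qed

lemma weighted_Cauchy:
  fixes a w :: "'i \<Rightarrow> real"
  assumes "finite I" "\<And>i. i \<in> I \<Longrightarrow> 0 \<le> w i" "\<And>i. i \<in> I \<Longrightarrow> w i = 0 \<Longrightarrow> a i = 0" "sum w I \<le> M"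
  shows "(sum a I)\<^sup>2 \<le> M * (\<Sum>i\<in>I. (a i)\<^sup>2 / w i)"
proof -
  have Q: "0 \<le> (\<Sum>i\<in>I. (a i)\<^sup>2 / w i)" using assms(2) by (simp add: sum_nonneg)
  show ?thesis
  proof (cases "sum w I = 0")
    case True
    then have "a i = 0" if "i \<in> I" for i
      using that assms(1-3) sum_nonneg_eq_0_iff[of I w] by auto
    then show ?thesis using Q assms(4) True by simp
  next
    case False
    then have W: "0 < sum w I" using sum_nonneg[of I w] assms(2) by force
    have "0 \<le> (\<Sum>i\<in>I. (a i)\<^sup>2 / w i) - (sum a I)\<^sup>2 / sum w I"
      by (subst weighted_Cauchy_identity[symmetric]) (use assms False in \<open>auto intro!: sum_nonneg\<close>)
    then have "(sum a I)\<^sup>2 \<le> sum w I * (\<Sum>i\<in>I. (a i)\<^sup>2 / w i)"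
      using W by (simp add: field_simps)
    also have "\<dots> \<le> M * (\<Sum>i\<in>I. (a i)\<^sup>2 / w i)" using assms(4) Q by (rule mult_right_mono)
    finally show ?thesis .
  qed
qed

text \<open>Equality makes the defect, a sum of nonnegative terms, vanish termwise. If the sum of
  \<open>a\<close> is nonzero, the slack between \<open>sum w I\<close> and \<open>M\<close>
  vanishes as well; this later fixes the level of a boundary vertex.\<close>

lemma weighted_Cauchy_equality:
  fixes a w :: "'i \<Rightarrow> real"
  assumes "finite I" "\<And>i. i \<in> I \<Longrightarrow> 0 \<le> w i" "\<And>i. i \<in> I \<Longrightarrow> w i = 0 \<Longrightarrow> a i = 0" "sum w I \<le> M"
    and M: "0 < M" and eq: "(sum a I)\<^sup>2 = M * (\<Sum>i\<in>I. (a i)\<^sup>2 / w i)"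
  shows "\<And>i. i \<in> I \<Longrightarrow> a i = sum a I / M * w i" "sum a I \<noteq> 0 \<Longrightarrow> sum w I = M"
proof -
  let ?Q = "\<Sum>i\<in>I. (a i)\<^sup>2 / w i"
  have wM: "sum a I \<noteq> 0 \<longrightarrow> sum w I = M"
  proof
    assume "sum a I \<noteq> 0"
    then have "0 < M * ?Q" using eq by (metis zero_less_power2)
    then have "0 < ?Q" using M by (simp add: zero_less_mult_iff)
    moreover have "M * ?Q \<le> sum w I * ?Q"
      unfolding eq[symmetric] by (rule weighted_Cauchy) (use assms in auto)
    ultimately have "M \<le> sum w I" by (rule mult_right_le_imp_le[rotated])
    then show "sum w I = M" using assms(4) by simp
  qed
  then show "sum a I \<noteq> 0 \<Longrightarrow> sum w I = M" by blast
  show "a i = sum a I / M * w i" if i: "i \<in> I" for i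
  proof (cases "sum a I = 0")
    case True
    then have "?Q = 0" using eq M by simp
    then have "(a i)\<^sup>2 / w i = 0"
      using i assms(1,2) sum_nonneg_eq_0_iff[of I "\<lambda>i. (a i)\<^sup>2 / w i"] by simp
    then show ?thesis using True assms(3)[OF i] by auto
  next
    case False
    then have W: "sum w I = M" using wM by blast
    have "(\<Sum>i\<in>I. (a i - sum a I / M * w i)\<^sup>2 / w i) = ?Q - (sum a I)\<^sup>2 / M"
      unfolding W[symmetric] by (rule weighted_Cauchy_identity) (use assms W in auto)
    then have "(\<Sum>i\<in>I. (a i - sum a I / M * w i)\<^sup>2 / w i) = 0"
      unfolding eq using M by simp
    then have "(a i - sum a I / M * w i)\<^sup>2 / w i = 0"
      using i assms(1,2) sum_nonneg_eq_0_iff[of I "\<lambda>i. (a i - sum a I / M * w i)\<^sup>2 / w i"] by simp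
    then show ?thesis using assms(3)[OF i] by auto
  qed
qed

section \<open>The Steklov spectrum of a finite tree\<close>

context finite_tree
begin

lemma eigenfunction_green:
  assumes "steklov_eigenfunction G l f"
  shows "energy (arcs G) f g = l * (\<Sum>x\<in>bd. f x * g x)"
proof -
  have "energy (arcs G) f g = (\<Sum>x\<in>V. if x \<in> bd then l * f x * g x else 0)"
    unfolding green using assms by (intro sum.cong) (auto simp: steklov_eigenfunction_def)
  also have "\<dots> = (\<Sum>x\<in>bd. l * f x * g x)"
    using finite_verts bd_verts by (simp add: sum.If_cases Int_absorb1)
  finally show ?thesis by (simp add: sum_distrib_left mult.assoc)
qed

text \<open>Green's formula tested with the constant 1.\<close>

lemma eigenfunction_boundary_sum:
  assumes "steklov_eigenfunction G l f" "l \<noteq> 0"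
  shows "(\<Sum>x\<in>bd. f x) = 0"
  using eigenfunction_green[OF assms(1), of "\<lambda>_. 1"] assms(2) by (simp add: energy_def)

lemma boundary_iff:
  assumes "v \<in> V" "gadj G v u"
  shows "v \<in> bd \<longleftrightarrow> {u. gadj G v u} = {u}"
proof -
  have "v \<in> bd \<longleftrightarrow> card {u. gadj G v u} = 1"
    using assms by (simp add: steklov_boundary_def graph_degree_def)
  also have "\<dots> \<longleftrightarrow> {u. gadj G v u} = {u}"
  proof
    assume "card {u. gadj G v u} = 1"
    then obtain x where x: "{u. gadj G v u} = {x}" by (rule card_1_singletonE)
    have "u \<in> {u. gadj G v u}" using assms(2) by simp
    then show "{u. gadj G v u} = {u}" unfolding x by simp
  qed simp
  finally show ?thesis .
qed

lemma rooted: "x \<in> V \<Longrightarrow> rooted_tree G {x}"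
  using tree_G by (rule rooted_tree_vertex)

end

locale finite_rooted_tree = rooted_tree G Z + finite_tree G for G :: "'a sgraph" and Z
begin

lemma finite_children: "finite (children v)"
  by (rule finite_subset[OF _ finite_neighbours[of v]]) (auto simp: children_def)

lemma childless_boundary: "v \<in> V \<Longrightarrow> v \<notin> Z \<Longrightarrow> children v = {} \<Longrightarrow> v \<in> bd"
  using boundary_iff[of v "parent v"] neighbours_nonroot[of v] adj_parent[of v] by simp

text \<open>A deepest vertex below \<open>v\<close> has no children. The conclusion speaks of
  children rather than of degree, because whether a childless root is a boundary vertex depends on
  \<open>Z\<close>.\<close>

lemma ex_boundary_descendant:
  assumes "v \<in> V"
  shows "\<exists>l\<in>V. v \<in> ancestors l \<and> children l = {}"
proof -
  let ?S = "{u \<in> V. v \<in> ancestors u}"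
  have "finite ?S" "?S \<noteq> {}" using finite_verts assms self_in_ancestors by auto
  then have "Max (level ` ?S) \<in> level ` ?S" by (intro Max_in) auto
  then obtain l where l: "l \<in> ?S" "level l = Max (level ` ?S)" by auto
  have max: "level u \<le> level l" if "u \<in> ?S" for u
    unfolding l(2) using \<open>finite ?S\<close> that by (intro Max_ge) auto
  have "children l = {}"
  proof (rule ccontr)
    assume "children l \<noteq> {}"
    then obtain c where c: "c \<in> children l" by blast
    then have "c \<in> ?S" using l(1) ancestors_step[of c] by (auto simp: children_iff)
    then show False using max[of c] level_children[OF c] by simp
  qed
  then show ?thesis using l by blast
qed

end

section \<open>Orthogonality on the boundary and finiteness of the spectrum\<close>

context finite_tree
begin

lemma ex_boundary_ne: 
  assumes "x \<in> V"
  shows "\<exists>l\<in>bd. l \<noteq> x"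
proof -
  interpret finite_rooted_tree G "{x}"
    using rooted[OF assms] finite_tree_axioms by (simp add: finite_rooted_tree_def)
  obtain y where y: "gadj G x y" using ex_neighbour[OF assms] by blast
  then have "y \<in> V" "y \<noteq> x" using adj_verts adj_irrefl by auto
  then obtain l where l: "l \<in> V" "y \<in> ancestors l" "children l = {}"
    using ex_boundary_descendant by blast
  moreover have "l \<noteq> x" using l \<open>y \<noteq> x\<close> by (auto simp: ancestors_root)
  ultimately show ?thesis using childless_boundary[of l] by auto
qed

lemma ex_two_boundary: "\<exists>u\<in>bd. \<exists>v\<in>bd. u \<noteq> v"
  using ex_boundary_ne ex_other_vertex bd_verts by (metis subsetD)

text \<open>An eigenfunction vanishing on the boundary has energy 0 by Green's formula, so it is
  constant and therefore 0.\<close>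

lemma eigenfunction_boundary_norm:
  assumes "steklov_eigenfunction G l f"
  shows "0 < (\<Sum>x\<in>bd. (f x)\<^sup>2)"
proof (rule ccontr)
  assume "\<not> ?thesis"
  then have "(\<Sum>x\<in>bd. (f x)\<^sup>2) = 0" by (meson linorder_not_le order_antisym sum_nonneg zero_le_power2)
  then have 0: "\<forall>x\<in>bd. f x = 0" using finite_bd by (simp add: sum_nonneg_eq_0_iff)
  then have "energy (arcs G) f f = 0" using eigenfunction_green[OF assms] by simp
  moreover obtain u where "u \<in> bd" using ex_two_boundary by blast
  ultimately have "\<forall>x\<in>V. f x = 0" using energy_0_const[of f] 0 bd_verts by (metis subsetD)
  then show False using assms by (auto simp: steklov_eigenfunction_def)
qed

lemma eigenfunctions_orthogonal:
  assumes "steklov_eigenfunction G l f" "steklov_eigenfunction G m g" "l \<noteq> m"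
  shows "(\<Sum>x\<in>bd. f x * g x) = 0"
proof -
  have "energy (arcs G) g f = m * (\<Sum>x\<in>bd. f x * g x)"
    using eigenfunction_green[OF assms(2), of f] by (simp add: mult.commute)
  then have "l * (\<Sum>x\<in>bd. f x * g x) = m * (\<Sum>x\<in>bd. f x * g x)"
    using eigenfunction_green[OF assms(1), of g] energy_commute[of "arcs G" f g] by metis
  then show ?thesis using assms(3) by simp
qed

text \<open>Bessel's inequality for the indicator functions of the boundary vertices, summed over all of
  them, bounds the size of an orthonormal family on the boundary.\<close>

lemma card_orthonormal_le:
  fixes e :: "real \<Rightarrow> 'a \<Rightarrow> real"
  assumes "finite A"
    and "\<And>l m. l \<in> A \<Longrightarrow> m \<in> A \<Longrightarrow> (\<Sum>x\<in>bd. e l x * e m x) = (if l = m then 1 else 0)"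
  shows "card A \<le> card bd"
proof -
  have bessel: "(\<Sum>l\<in>A. (e l v)\<^sup>2) \<le> 1" if v: "v \<in> bd" for v
  proof -
    \<comment> \<open>\<open>p\<close> is the orthogonal projection of the indicator function of
      \<open>v\<close> to the span of the family. Its product with the indicator equals its squared
      norm, and the nonnegative norm of the difference gives Bessel's inequality.\<close>
    define p where "p x = (\<Sum>l\<in>A. e l v * e l x)" for x
    have 1: "(\<Sum>x\<in>bd. (if x = v then 1 else 0) * p x) = (\<Sum>l\<in>A. (e l v)\<^sup>2)"
      using v finite_bd by (simp add: p_def if_distrib[of "\<lambda>y. y * _"] power2_eq_square cong: if_cong)
    have "(\<Sum>x\<in>bd. p x * p x) = (\<Sum>x\<in>bd. \<Sum>l\<in>A. \<Sum>m\<in>A. e l v * e m v * (e l x * e m x))"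
      by (simp add: p_def sum_product algebra_simps)
    also have "\<dots> = (\<Sum>l\<in>A. \<Sum>m\<in>A. \<Sum>x\<in>bd. e l v * e m v * (e l x * e m x))"
      by (subst sum.swap, rule sum.cong[OF refl], rule sum.swap)
    also have "\<dots> = (\<Sum>l\<in>A. \<Sum>m\<in>A. e l v * e m v * (if l = m then 1 else 0))"
      by (intro sum.cong refl) (simp add: assms(2) sum_distrib_left[symmetric])
    also have "\<dots> = (\<Sum>l\<in>A. (e l v)\<^sup>2)"
      using assms(1) by (simp add: if_distrib power2_eq_square cong: if_cong)
    finally have 2: "(\<Sum>x\<in>bd. p x * p x) = (\<Sum>l\<in>A. (e l v)\<^sup>2)" .
    have "0 \<le> (\<Sum>x\<in>bd. ((if x = v then 1 else 0) - p x)\<^sup>2)" by (simp add: sum_nonneg)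
    also have "\<dots> = (\<Sum>x\<in>bd. if x = v then 1 else 0) - 2 * (\<Sum>x\<in>bd. (if x = v then 1 else 0) * p x)
        + (\<Sum>x\<in>bd. p x * p x)"
      unfolding sum_distrib_left sum_subtractf[symmetric] sum.distrib[symmetric]
      by (intro sum.cong refl) (simp add: power2_eq_square algebra_simps)
    finally show ?thesis using 1 2 v finite_bd by simp
  qed
  have "real (card A) = (\<Sum>l\<in>A. \<Sum>v\<in>bd. (e l v)\<^sup>2)"
    using assms(2) by (simp add: power2_eq_square)
  also have "\<dots> = (\<Sum>v\<in>bd. \<Sum>l\<in>A. (e l v)\<^sup>2)" by (rule sum.swap)
  also have "\<dots> \<le> (\<Sum>v\<in>bd. 1)" by (intro sum_mono bessel)
  finally show ?thesis by simp
qed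

text \<open>Eigenfunctions for different eigenvalues are orthogonal on the boundary and nonzero
  there, so normalising one for each eigenvalue gives an orthonormal family.\<close>

lemma finite_steklov_spectrum: "finite {l. steklov_eigenvalue G l}"
proof (rule ccontr)
  assume "infinite {l. steklov_eigenvalue G l}"
  then obtain A where A: "finite A" "card A = Suc (card bd)" "A \<subseteq> {l. steklov_eigenvalue G l}"
    using infinite_arbitrarily_large by blast
  then have "\<forall>l\<in>A. \<exists>f. steklov_eigenfunction G l f" by (auto simp: steklov_eigenvalue_iff)
  then obtain f where f: "\<And>l. l \<in> A \<Longrightarrow> steklov_eigenfunction G l (f l)" by metis
  define r where "r l = sqrt (\<Sum>x\<in>bd. (f l x)\<^sup>2)" for l
  have "(\<Sum>x\<in>bd. f l x / r l * (f m x / r m)) = (if l = m then 1 else 0)"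
    if "l \<in> A" "m \<in> A" for l m
  proof -
    have "(\<Sum>x\<in>bd. f l x / r l * (f m x / r m)) = (\<Sum>x\<in>bd. f l x * f m x) / (r l * r m)"
      by (simp add: sum_divide_distrib)
    moreover have "(\<Sum>x\<in>bd. f l x * f l x) = r l * r l" "r l \<noteq> 0"
      using eigenfunction_boundary_norm[OF f[OF \<open>l \<in> A\<close>]]
      by (simp_all add: r_def sum_nonneg power2_eq_square)
    ultimately show ?thesis
      using eigenfunctions_orthogonal[OF f[OF that(1)] f[OF that(2)]] by auto
  qed
  then have "card A \<le> card bd" using card_orthonormal_le[OF A(1), of "\<lambda>l x. f l x / r l"] by blast
  then show False using A(2) by simp
qed

end

section \<open>Existence of a nonzero Steklov eigenvalue\<close>

lemma nonneg_quadratic_linear_0: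
  fixes b c :: real
  assumes "\<And>t. 0 \<le> 2 * t * b + t\<^sup>2 * c"
  shows "b = 0"
proof -
  have "0 \<le> c" using assms[of 1] assms[of "-1"] by simp
  \<comment> \<open>The quadratic is least at \<open>- b / c\<close>; the denominator
    \<open>c + 1\<close> stays positive when \<open>c = 0\<close> and still gives a negative value
    unless \<open>b = 0\<close>.\<close>
  define s where "s = c + 1"
  have s: "s \<noteq> 0" using \<open>0 \<le> c\<close> by (simp add: s_def)
  have "0 \<le> 2 * (- b / s) * b + (- b / s)\<^sup>2 * c" by (rule assms)
  also have "\<dots> = - (b\<^sup>2 * (2 * s - c) / s\<^sup>2)"
    using s by (simp add: field_simps power2_eq_square)
  finally have "b\<^sup>2 * (c + 2) / s\<^sup>2 \<le> 0" by (simp add: s_def)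
  then show ?thesis using \<open>0 \<le> c\<close> s by (auto simp: divide_le_0_iff mult_le_0_iff)
qed

lemma continuous_on_energy:
  "continuous_on S (\<lambda>f::'a \<Rightarrow> real. energy P f f)"
  unfolding energy_def case_prod_beta
  by (intro continuous_intros continuous_on_subset[OF continuous_on_product_coordinates]) auto

text \<open>Tychonoff's theorem in the product topology. All points of the type count as
  coordinates, which is why functions are later set to 0 off the vertex set.\<close>

lemma compact_box: "compact {f :: 'a \<Rightarrow> real. \<forall>v. f v \<in> {-B..B}}"
proof -
  have "compactin (product_topology (\<lambda>_. euclidean) (UNIV :: 'a set)) (PiE UNIV (\<lambda>_. {-B..B::real}))"
    by (simp add: compactin_PiE)
  then show ?thesis by (simp add: euclidean_product_topology PiE_UNIV_domain Pi_def)
qed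

context finite_tree
begin

text \<open>Energy at most 1 bounds the difference along every edge by 1, so
  \<open>\<bar>f v\<bar>\<close> is at most the distance from \<open>x\<close>; the sum of all
  levels is a crude bound valid for every \<open>v\<close>.\<close>

lemma oscillation_bound: "\<exists>B. \<forall>f v. energy (arcs G) f f \<le> 1 \<longrightarrow> v \<in> V \<longrightarrow> f x = 0 \<longrightarrow> x \<in> V \<longrightarrow> \<bar>f v\<bar> \<le> B"
proof (cases "x \<in> V")
  case True
  interpret finite_rooted_tree G "{x}"
    using rooted[OF True] finite_tree_axioms by (simp add: finite_rooted_tree_def)
  have "\<bar>f v\<bar> \<le> real (\<Sum>v\<in>V. level v)" if f: "energy (arcs G) f f \<le> 1" "f x = 0" and v: "v \<in> V" for f v
  proof -
    have "\<bar>f v\<bar> \<le> real (level v)" using v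
    proof (induction rule: level_induct)
      case (step v)
      have "(f v - f (parent v))\<^sup>2 \<le> 1"
        using energy_ge_arc[OF finite_arcs, of v "parent v" f] adj_parent[OF step.hyps] adj_sym f(1)
        by (fastforce simp: arcs_def)
      then have "\<bar>f v - f (parent v)\<bar> \<le> 1" by (simp add: abs_square_le_1)
      then show ?case using step.IH level_parent[OF step.hyps] by simp
    qed (use f in simp)
    also have "level v \<le> (\<Sum>v\<in>V. level v)" using v finite_verts by (simp add: member_le_sum)
    finally show ?thesis by simp
  qed
  then show ?thesis by blast
qed blast

text \<open>Extremal functions of the quotient of the two energies satisfy the Steklov equation by first
  variation. The energy of the complete graph on the boundary is the number of boundary
  vertices times the variance there.\<close>

lemma ex_extremal_function:
  "\<exists>M>0. \<exists>f. energy (bd \<times> bd) f f > 0 \<and> energy (bd \<times> bd) f f = M * energy (arcs G) f f \<and>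
     (\<forall>g. energy (bd \<times> bd) g g \<le> M * energy (arcs G) g g)"
proof -
  let ?E = "\<lambda>f. energy (arcs G) f f" and ?N = "\<lambda>f. energy (bd \<times> bd) f f"
  obtain x where x: "x \<in> V" using ex_other_vertex by blast
  obtain B where B: "\<And>f v. ?E f \<le> 1 \<Longrightarrow> v \<in> V \<Longrightarrow> f x = 0 \<Longrightarrow> \<bar>f v\<bar> \<le> B"
    using oscillation_bound x by metis
  \<comment> \<open>Neither form changes when a constant is added, and both scale alike, so fixing
    \<open>f x = 0\<close> and energy at most 1 loses no quotient.\<close>
  define K where "K = {f. \<forall>v. f v \<in> {-B..B}} \<inter> ({f. ?E f \<le> 1} \<inter> {f. f x = 0})"
  have "closed {f. ?E f \<le> 1}"
    by (intro closed_Collect_le continuous_on_energy continuous_on_const)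
  moreover have "closed {f :: 'a \<Rightarrow> real. f x = 0}"
    by (intro closed_Collect_eq continuous_on_product_coordinates continuous_on_const)
  ultimately have "compact K" unfolding K_def by (intro compact_Int_closed compact_box closed_Int)
  have normal: "\<exists>h\<in>K. ?N h = ?N g / ?E g" if "?E g > 0" for g
  proof -
    define h where "h v = (if v \<in> V then 1 / sqrt (?E g) * (g v - g x) else 0)" for v
    have "h u - h v = 1 / sqrt (?E g) * (g u - g v)" if "u \<in> V" "v \<in> V" for u v
      using that by (simp add: h_def diff_divide_distrib)
    then have "?E h = (1 / sqrt (?E g))\<^sup>2 * ?E g" "?N h = (1 / sqrt (?E g))\<^sup>2 * ?N g"
      using tree_graph_verts[OF tree_G] subsetD[OF bd_verts]
      by (intro energy_affine; auto simp: arcs_def)+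
    then have h: "?E h = 1" "?N h = ?N g / ?E g" using that by (simp_all add: power_divide)
    have "h x = 0" using x by (simp add: h_def)
    then have "\<bar>h v\<bar> \<le> B" for v
      using B[of h v] B[of h x] h x by (cases "v \<in> V") (auto simp: h_def)
    then have "h \<in> K" using h \<open>h x = 0\<close> by (auto simp: K_def abs_le_iff minus_le_iff)
    then show ?thesis using h by blast
  qed
  obtain u v where uv: "u \<in> bd" "v \<in> bd" "u \<noteq> v" using ex_two_boundary by blast
  define g0 where "g0 = (\<lambda>x. if x = u then 1 else 0 :: real)"
  have pos: "0 < ?N g0"
    using energy_ge_arc[of "bd \<times> bd" u v g0] finite_bd uv by (simp add: g0_def)
  then have "?N g0 \<noteq> 0" by simp
  have zero: "?N g = 0" if "?E g = 0" for g
  proof -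
    have "?N g = 0\<^sup>2 * ?N g"
      by (rule energy_affine) (use energy_0_const[OF that] bd_verts in auto)
    then show ?thesis by simp
  qed
  then have "?E g0 > 0" using energy_nonneg[of "arcs G" g0] pos by (metis less_eq_real_def)
  then obtain h0 where h0: "h0 \<in> K" "?N h0 = ?N g0 / ?E g0" using normal by blast
  obtain f where f: "f \<in> K" "\<And>h. h \<in> K \<Longrightarrow> ?N h \<le> ?N f"
    using continuous_attains_sup[OF \<open>compact K\<close> _ continuous_on_energy] h0(1) by blast
  have M: "0 < ?N f" using f(2)[OF h0(1)] h0(2) pos \<open>?E g0 > 0\<close> by (smt (verit) divide_pos_pos)
  have le: "?N g \<le> ?N f * ?E g" for g
  proof (cases "?E g = 0")
    case False
    then have pos: "?E g > 0" using energy_nonneg[of "arcs G" g] by simp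
    then obtain h where "h \<in> K" "?N h = ?N g / ?E g" using normal by blast
    then have "?N g / ?E g \<le> ?N f" using f(2) by metis
    then show ?thesis using pos by (simp add: pos_divide_le_eq)
  qed (simp add: zero)
  \<comment> \<open>The maximiser has energy at most 1, while \<open>le\<close> gives the reverse
    comparison for \<open>f\<close>; hence \<open>f\<close> attains the quotient
    \<open>?N f\<close>.\<close>
  have "?E f \<le> 1" using f(1) by (simp add: K_def)
  then have "?N f * ?E f \<le> ?N f" using M by simp
  then have "?N f = ?N f * ?E f" using le[of f] by simp
  then show ?thesis using M le by blast
qed

text \<open>Maximising the variance instead of the boundary norm excludes constants without a side
  condition, so the first variation has no multiplier. Tested with indicator functions it says that
  \<open>M\<close> times the Laplacian is \<open>n * (f x - c)\<close> on the boundary and 0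
  elsewhere, where \<open>c\<close> is the boundary mean; thus \<open>f - c\<close> is an
  eigenfunction for \<open>n / M\<close>.\<close>

lemma ex_nonzero_steklov_eigenvalue: "\<exists>l. steklov_eigenvalue G l \<and> l \<noteq> 0"
proof -
  obtain M f where M: "M > 0" and f: "energy (bd \<times> bd) f f > 0"
    "energy (bd \<times> bd) f f = M * energy (arcs G) f f"
    and le: "\<And>g. energy (bd \<times> bd) g g \<le> M * energy (arcs G) g g"
    using ex_extremal_function by blast
  have var: "M * energy (arcs G) f g = energy (bd \<times> bd) f g" for g
  proof -
    have "0 \<le> 2 * t * (M * energy (arcs G) f g - energy (bd \<times> bd) f g)
        + t\<^sup>2 * (M * energy (arcs G) g g - energy (bd \<times> bd) g g)" for t
      using le[of "\<lambda>x. f x + t * g x"] f(2) unfolding energy_add by (simp add: algebra_simps)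
    from nonneg_quadratic_linear_0[OF this] show ?thesis by simp
  qed
  define n where "n = real (card bd)"
  define c where "c = (\<Sum>y\<in>bd. f y) / n"
  have n: "n > 0" using ex_two_boundary finite_bd by (auto simp: n_def card_gt_0_iff)
  have lap: "M * graph_laplacian G f x = (if x \<in> bd then n * (f x - c) else 0)" if x: "x \<in> V" for x
  proof -
    define g where "g = (\<lambda>y. if y = x then 1 else 0 :: real)"
    have "energy (arcs G) f g = graph_laplacian G f x"
      unfolding green using x finite_verts by (simp add: g_def if_distrib[of "\<lambda>y. y * _"] cong: if_cong)
    moreover have "energy (bd \<times> bd) f g = (if x \<in> bd then n * (f x - c) else 0)"
    proof -
      have "(\<Sum>(u, v)\<in>bd \<times> bd. (f u - f v) * (g u - g v))
          = (\<Sum>u\<in>bd. \<Sum>v\<in>bd. g u * (f u - f v)) + (\<Sum>u\<in>bd. \<Sum>v\<in>bd. g v * (f v - f u))"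
        by (simp add: sum.cartesian_product[symmetric] sum.distrib[symmetric] algebra_simps)
      also have "(\<Sum>u\<in>bd. \<Sum>v\<in>bd. g v * (f v - f u)) = (\<Sum>u\<in>bd. \<Sum>v\<in>bd. g u * (f u - f v))"
        by (rule sum.swap)
      also have "(\<Sum>u\<in>bd. \<Sum>v\<in>bd. g u * (f u - f v)) = (\<Sum>u\<in>bd. g u * (n * (f u - c)))"
      proof (rule sum.cong[OF refl])
        fix u
        have "(\<Sum>v\<in>bd. f u - f v) = n * (f u - c)"
          using n by (simp add: sum_subtractf c_def right_diff_distrib) (simp add: n_def)
        then show "(\<Sum>v\<in>bd. g u * (f u - f v)) = g u * (n * (f u - c))"
          by (simp add: sum_distrib_left[symmetric])
      qed
      also have "\<dots> = (if x \<in> bd then n * (f x - c) else 0)"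
        using finite_bd by (simp add: g_def if_distrib[of "\<lambda>y. y * _"] cong: if_cong)
      finally show ?thesis by (simp add: energy_def)
    qed
    ultimately show ?thesis using var[of g] by simp
  qed
  have "graph_laplacian G (\<lambda>y. f y - c) x = graph_laplacian G f x" for x
    by (simp add: graph_laplacian_def)
  moreover have "graph_laplacian G f x = (if x \<in> bd then n / M * (f x - c) else 0)" if "x \<in> V" for x
    using lap[OF that] M by (auto simp: field_simps split: if_splits)
  moreover have "\<exists>x\<in>V. f x - c \<noteq> 0"
  proof (rule ccontr)
    assume "\<not> ?thesis"
    then have "energy (bd \<times> bd) f f = 0\<^sup>2 * energy (bd \<times> bd) f f"
      using subsetD[OF bd_verts] by (intro energy_affine) auto
    then show False using f(1) by simp
  qed
  ultimately have "steklov_eigenfunction G (n / M) (\<lambda>y. f y - c)"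
    by (simp add: steklov_eigenfunction_def)
  then show ?thesis using M n by (metis divide_eq_0_iff less_irrefl steklov_eigenvalue_iff)
qed

lemma steklov_lambda2_eigenvalue: "steklov_eigenvalue G (steklov_lambda2 G)" "steklov_lambda2 G \<noteq> 0"
  and steklov_lambda2_le: "steklov_eigenvalue G l \<Longrightarrow> l \<noteq> 0 \<Longrightarrow> steklov_lambda2 G \<le> l"
proof -
  let ?S = "{l. steklov_eigenvalue G l \<and> l \<noteq> 0}"
  have fin: "finite ?S" by (rule finite_subset[OF _ finite_steklov_spectrum]) auto
  have "?S \<noteq> {}" using ex_nonzero_steklov_eigenvalue by blast
  then have "steklov_lambda2 G \<in> ?S" unfolding steklov_lambda2_def using fin by (rule Min_in[rotated])
  then show "steklov_eigenvalue G (steklov_lambda2 G)" "steklov_lambda2 G \<noteq> 0" by auto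
  show "steklov_eigenvalue G l \<Longrightarrow> l \<noteq> 0 \<Longrightarrow> steklov_lambda2 G \<le> l"
    unfolding steklov_lambda2_def using fin by (intro Min_le) auto
qed

end

section \<open>A Poincare inequality with weights on the edges\<close>

context rooted_tree
begin

text \<open>The complete \<open>D\<close>-ary tree of height \<open>n\<close> below
  \<open>v\<close>. In a finite tree the value 0 in generation \<open>n\<close> forbids deeper
  vertices, so the shape is exact.\<close>

definition full_branch :: "nat \<Rightarrow> 'a \<Rightarrow> nat \<Rightarrow> bool" where
  "full_branch D v n \<longleftrightarrow>
     (\<forall>k\<le>n. \<forall>u\<in>descendants v k. card (children u) = (if k < n then D else 0))"

lemma ex_child_ancestor:
  assumes "l \<in> gverts G" "v \<in> ancestors l" "l \<noteq> v"
  shows "\<exists>c\<in>children v. c \<in> ancestors l"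
  using assms
proof (induction rule: level_induct)
  case (root l)
  then show ?case by (simp add: ancestors_root)
next
  case (step l)
  then have anc: "v \<in> ancestors (parent l)" "ancestors l = insert l (ancestors (parent l))"
    by (auto simp: ancestors_step)
  show ?case
  proof (cases "parent l = v")
    case True
    then have "l \<in> children v" using step.hyps by (simp add: children_iff)
    then show ?thesis using self_in_ancestors by blast
  next
    case False
    then show ?thesis using step.IH anc by blast
  qed
qed

lemma neighbours_card2:
  assumes "card Z = 2" "v \<in> Z"
  obtains w where "w \<in> Z" "w \<noteq> v" "Z = {v, w}" "{u. gadj G v u} = insert w (children v)"
    "w \<notin> children v"
proof -
  obtain a b where "Z = {a, b}" "a \<noteq> b" using assms(1) by (auto simp: card_2_iff)
  then obtain w where w: "Z = {v, w}" "w \<noteq> v" using assms(2) by blast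
  then have "{u. gadj G v u} = insert w (children v)" "w \<notin> children v"
    using neighbours_root[OF assms(2)] by auto
  then show ?thesis using w that by blast
qed

text \<open>In the rooting at an edge the other root takes the place of the parent. The condition
  \<open>v \<notin> Z \<or> card Z = 2\<close> recurs below with this meaning: exactly one neighbour
  of \<open>v\<close> is not a child.\<close>

lemma neighbours_upward:
  assumes "v \<in> gverts G" "v \<notin> Z \<or> card Z = 2"
  obtains u where "{u. gadj G v u} = insert u (children v)" "u \<notin> children v"
  using assms neighbours_nonroot[of v] neighbours_card2[of v] by metis

text \<open>\<open>c\<close> is a virtual value just above the roots, the value at the midpoint of
  the central edge in the case of two roots. With it the increments along a path telescope to
  \<open>f v - c\<close>.\<close>

definition increment :: "('a \<Rightarrow> real) \<Rightarrow> real \<Rightarrow> 'a \<Rightarrow> real" where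
  "increment f c v = (if v \<in> Z then f v - c else f v - f (parent v))"

lemma sum_increment:
  "v \<in> gverts G \<Longrightarrow> (\<Sum>u\<in>ancestors v. increment f c u) = f v - c"
proof (induction rule: level_induct)
  case (root v)
  then show ?case by (simp add: ancestors_root increment_def)
next
  case (step v)
  then show ?case
    using finite_ancestors[OF parent_verts] not_ancestor_of_parent
    by (simp add: ancestors_step increment_def)
qed

end

section \<open>Double counting and truncated geometric sums\<close>

lemma sum_sum_swap_card:
  fixes q :: "'a \<Rightarrow> real"
  assumes "finite B" "finite V" "\<And>l. l \<in> B \<Longrightarrow> anc l \<subseteq> V"
  shows "(\<Sum>l\<in>B. \<Sum>v\<in>anc l. q v) = (\<Sum>v\<in>V. real (card {l \<in> B. v \<in> anc l}) * q v)"
proof -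
  have "(\<Sum>l\<in>B. \<Sum>v\<in>anc l. q v) = (\<Sum>l\<in>B. \<Sum>v\<in>V. if v \<in> anc l then q v else 0)"
    using assms by (intro sum.cong[OF refl]) (simp add: Int_absorb1 flip: sum.inter_restrict)
  also have "\<dots> = (\<Sum>v\<in>V. \<Sum>l\<in>B. if v \<in> anc l then q v else 0)" by (rule sum.swap)
  also have "\<dots> = (\<Sum>v\<in>V. real (card {l \<in> B. v \<in> anc l}) * q v)"
    using assms(1) by (simp add: sum.If_cases Int_def)
  finally show ?thesis .
qed

lemma sum_powers_reverse: "(\<Sum>j<R. real D ^ (R - Suc j)) = (\<Sum>j<R. real D ^ j)"
  by (rule sum.nat_diff_reindex)

lemma sum_powers_truncated_le:
  assumes "n \<le> R"
  shows "(\<Sum>j<n. real D ^ (R - Suc j)) \<le> (\<Sum>j<R. real D ^ j)"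
  unfolding sum_powers_reverse[symmetric] by (rule sum_mono2) (use assms in auto)

lemma sum_powers_truncated_less:
  assumes "n < R" "1 \<le> D"
  shows "(\<Sum>j<n. real D ^ (R - Suc j)) < (\<Sum>j<R. real D ^ j)"
proof -
  have "(\<Sum>j<n. real D ^ (R - Suc j)) < (\<Sum>j<Suc n. real D ^ (R - Suc j))" using assms by simp
  also have "\<dots> \<le> (\<Sum>j<R. real D ^ j)" using assms by (intro sum_powers_truncated_le) simp
  finally show ?thesis .
qed

context finite_rooted_tree
begin

lemma degree_upward:
  assumes "v \<in> V" "v \<notin> Z \<or> card Z = 2"
  shows "graph_degree G v = Suc (card (children v))"
proof -
  obtain u where "{u. gadj G v u} = insert u (children v)" "u \<notin> children v"
    using neighbours_upward[OF assms] .
  then show ?thesis by (simp add: graph_degree_def finite_children)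
qed

lemma boundary_upward:
  assumes "v \<in> V" "v \<notin> Z \<or> card Z = 2"
  shows "v \<in> bd \<longleftrightarrow> children v = {}"
  using degree_upward[OF assms] assms(1) finite_children by (simp add: steklov_boundary_def)

lemma laplacian_nonroot:
  assumes "v \<in> V" "v \<notin> Z"
  shows "graph_laplacian G f v = f v - f (parent v) - (\<Sum>c\<in>children v. f c - f v)"
  unfolding graph_laplacian_def neighbours_nonroot(1)[OF assms]
  using neighbours_nonroot(2)[OF assms] finite_children
  by (simp add: sum_subtractf algebra_simps)

lemma laplacian_card2:
  assumes "card Z = 2" "v \<in> Z" "w \<in> Z" "w \<noteq> v"
  shows "graph_laplacian G f v = f v - f w - (\<Sum>c\<in>children v. f c - f v)"
proof -
  obtain w' where w': "Z = {v, w'}" "{u. gadj G v u} = insert w' (children v)" "w' \<notin> children v"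
    using neighbours_card2[OF assms(1,2)] by metis
  then have "w' = w" using assms by auto
  then show ?thesis
    unfolding graph_laplacian_def w'(2) using w'(3) finite_children
    by (simp add: sum_subtractf algebra_simps)
qed

text \<open>The arcs towards parents, the reversed ones and the arcs inside \<open>Z\<close> are
  disjoint. Only the last sum is halved, since it already contains both orientations of the central
  edge.\<close>

lemma energy_ge_rooted:
  shows "(\<Sum>v\<in>V - Z. (f v - f (parent v))\<^sup>2) + (\<Sum>(u, v)\<in>{(u, v). u \<in> Z \<and> v \<in> Z \<and> u \<noteq> v}. (f u - f v)\<^sup>2) / 2
     \<le> energy (arcs G) f f"
proof -
  let ?A = "(\<lambda>v. (v, parent v)) ` (V - Z)" and ?B = "(\<lambda>v. (parent v, v)) ` (V - Z)"
    and ?C = "{(u, v). u \<in> Z \<and> v \<in> Z \<and> u \<noteq> v}"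
  let ?q = "\<lambda>(u, v). (f u - f v)\<^sup>2"
  have fin: "finite ?A" "finite ?B" using finite_verts by auto
  have C: "?C \<subseteq> arcs G" by (auto simp: arcs_def intro: root_clique)
  then have finC: "finite ?C" using finite_arcs finite_subset by blast
  have sub: "?A \<union> ?B \<subseteq> arcs G" using adj_parent adj_sym by (auto simp: arcs_def)
  have d1: "?A \<inter> ?B = {}"
  proof -
    have False if "v \<in> V - Z" "u \<in> V - Z" "v = parent u" "parent v = u" for u v
      using level_parent[of v] level_parent[of u] that by auto
    then show ?thesis by auto
  qed
  have d2: "(?A \<union> ?B) \<inter> ?C = {}" by auto
  have "sum ?q ?A = (\<Sum>v\<in>V - Z. (f v - f (parent v))\<^sup>2)" "sum ?q ?B = (\<Sum>v\<in>V - Z. (f v - f (parent v))\<^sup>2)"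
    by (subst sum.reindex; auto simp: inj_on_def power2_commute intro!: sum.cong)+
  then have "2 * (\<Sum>v\<in>V - Z. (f v - f (parent v))\<^sup>2) + sum ?q ?C = sum ?q (?A \<union> ?B \<union> ?C)"
    using fin finC d1 d2 by (simp add: sum.union_disjoint)
  also have "\<dots> \<le> sum ?q (arcs G)"
    by (rule sum_mono2) (use finite_arcs C sub in auto)
  also have "\<dots> = 2 * energy (arcs G) f f"
    by (simp add: energy_def case_prod_beta power2_eq_square)
  finally show ?thesis by simp
qed

end

text \<open>If the tree is rooted at an edge, this edge is cut at its midpoint and each half belongs to one
  root, with weight b. If it is rooted at a vertex there is no such half: then b = 0, and the root
  contributes 0 to all quotients by weights below, since x / 0 = 0.\<close>

locale balanced_tree = finite_rooted_tree G Z for G :: "'a sgraph" and Z +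
  fixes D R :: nat and b :: real
  assumes D_pos: "1 \<le> D" and R_pos: "0 < R"
    and degree_le: "\<And>v. v \<in> V \<Longrightarrow> graph_degree G v \<le> D + 1"
    and height_le: "\<And>v. v \<in> V \<Longrightarrow> level v \<le> R"
    and root_weight: "card Z = 1 \<and> b = 0 \<or> card Z = 2 \<and> 2 * b = real D ^ R"
begin

definition weight :: "'a \<Rightarrow> real" where
  "weight v = (if v \<in> Z then b else real D ^ (R - level v))"

text \<open>The weight of a path that reaches level \<open>R\<close>, the largest possible one;
  \<open>1 / M\<close> is the bound of the theorem in both cases.\<close>

definition M :: real where
  "M = b + (\<Sum>j<R. real D ^ j)"

lemma b_nonneg: "0 \<le> b"
proof -
  have "0 \<le> real D ^ R" by simp
  then show ?thesis using root_weight by linarith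
qed

lemma M_pos: "0 < M"
proof -
  have "0 < (\<Sum>j<R. real D ^ j)" by (rule sum_pos) (use D_pos R_pos in \<open>auto simp: lessThan_empty_iff\<close>)
  then show ?thesis using b_nonneg by (simp add: M_def)
qed

lemma weight_nonneg: "0 \<le> weight v"
  using b_nonneg by (simp add: weight_def)

lemma sum_weight:
  "v \<in> V \<Longrightarrow> (\<Sum>u\<in>ancestors v. weight u) = b + (\<Sum>j<level v. real D ^ (R - Suc j))"
proof (induction rule: level_induct)
  case (root v)
  then show ?case using root_verts level_eq_0[of v] by (auto simp: ancestors_root weight_def)
next
  case (step v)
  then show ?case
    using finite_ancestors[OF parent_verts] not_ancestor_of_parent level_parent[of v]
    by (simp add: ancestors_step weight_def)
qed

lemma sum_weight_le: "v \<in> V \<Longrightarrow> (\<Sum>u\<in>ancestors v. weight u) \<le> M"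
  using sum_powers_truncated_le[OF height_le] by (simp add: sum_weight M_def)

lemma sum_weight_eqD: "v \<in> V \<Longrightarrow> (\<Sum>u\<in>ancestors v. weight u) = M \<Longrightarrow> level v = R"
  using sum_powers_truncated_less[of "level v" R D] height_le[of v] D_pos
  by (cases "level v < R") (auto simp: sum_weight M_def)

definition root_mean :: "('a \<Rightarrow> real) \<Rightarrow> real" where
  "root_mean f = (\<Sum>z\<in>Z. f z) / real (card Z)"

abbreviation "incr f \<equiv> increment f (root_mean f)"

lemma increment_root_1: "card Z = 1 \<Longrightarrow> v \<in> Z \<Longrightarrow> incr f v = 0"
  by (auto simp: card_1_singleton_iff increment_def root_mean_def)

lemma increment_root_2:
  "card Z = 2 \<Longrightarrow> v \<in> Z \<Longrightarrow> w \<in> Z \<Longrightarrow> w \<noteq> v \<Longrightarrow> incr f v = (f v - f w) / 2"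
  by (auto simp: card_2_iff increment_def root_mean_def field_simps)

lemma weight_eq_0D: "weight v = 0 \<Longrightarrow> incr f v = 0"
  using root_weight D_pos increment_root_1[of v f] by (auto simp: weight_def split: if_splits)

definition path_energy :: "('a \<Rightarrow> real) \<Rightarrow> 'a \<Rightarrow> real" where
  "path_energy f l = (\<Sum>v\<in>ancestors l. (incr f v)\<^sup>2 / weight v)"

lemma deviation_le: "l \<in> V \<Longrightarrow> (f l - root_mean f)\<^sup>2 \<le> M * path_energy f l"
  unfolding path_energy_def sum_increment[symmetric]
  by (intro weighted_Cauchy) (simp_all add: finite_ancestors weight_nonneg weight_eq_0D sum_weight_le)

text \<open>By the degree bound a vertex with one upward neighbour has at most \<open>D\<close>
  children, and if it has children it is not itself a boundary vertex; the induction runs upward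
  from the deepest level. A single root is excluded because it may have \<open>D + 1\<close>
  children.\<close>

lemma card_boundary_below_le:
  assumes "v \<in> V" "v \<notin> Z \<or> card Z = 2"
  shows "card {l \<in> bd. v \<in> ancestors l} \<le> D ^ (R - level v)"
  using assms
proof (induction "R - level v" arbitrary: v rule: less_induct)
  case less
  let ?below = "\<lambda>v. {l \<in> bd. v \<in> ancestors l}"
  have below: "l = v \<or> (\<exists>c\<in>children v. l \<in> ?below c)" if "l \<in> ?below v" for l
    using ex_child_ancestor[of l v] that bd_verts by blast
  show ?case
  proof (cases "children v = {}")
    case True
    then have "?below v \<subseteq> {v}" using below by blast
    then have "card (?below v) \<le> 1" using card_mono[of "{v}" "?below v"] by simp
    also have "1 \<le> D ^ (R - level v)" using D_pos by simp
    finally show ?thesis .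
  next
    case False
    then obtain c0 where "c0 \<in> children v" by blast
    then have lv: "level v < R" using level_children[of c0 v] height_le[of c0] by (auto simp: children_iff)
    have "v \<notin> ?below v" using boundary_upward[OF less.prems] False by blast
    then have "?below v \<subseteq> (\<Union>c\<in>children v. ?below c)" using below by blast
    then have "card (?below v) \<le> card (\<Union>c\<in>children v. ?below c)"
      using finite_children finite_bd by (intro card_mono) auto
    also have "\<dots> \<le> (\<Sum>c\<in>children v. card (?below c))" by (rule card_UN_le[OF finite_children])
    also have "\<dots> \<le> (\<Sum>c\<in>children v. D ^ (R - Suc (level v)))"
    proof (rule sum_mono)
      fix c assume c: "c \<in> children v"
      then have "level c = Suc (level v)" "c \<in> V" "c \<notin> Z"
        using level_children by (auto simp: children_iff)
      then show "card (?below c) \<le> D ^ (R - Suc (level v))" using less.hyps[of c] lv by simp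
    qed
    also have "\<dots> \<le> D * D ^ (R - Suc (level v))"
      using degree_upward[OF less.prems] degree_le[OF less.prems(1)] by simp
    also have "\<dots> = D ^ (R - level v)" using lv by (simp flip: power_Suc add: Suc_diff_Suc)
    finally show ?thesis .
  qed
qed

text \<open>After exchanging the sums, the squared increment at \<open>v\<close> has as coefficient
  the number of boundary vertices below \<open>v\<close> divided by \<open>weight v\<close>, at most
  1 if \<open>v\<close> is no root. At either of two roots it is at most
  \<open>D ^ R / b = 2\<close>, and twice the square of \<open>(f z - f w) / 2\<close>, once for
  each root, adds up to \<open>(f z - f w)\<^sup>2\<close>.\<close>

lemma sum_path_energy_le: "(\<Sum>l\<in>bd. path_energy f l) \<le> energy (arcs G) f f"
proof -
  have "(\<Sum>l\<in>bd. path_energy f l)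
      = (\<Sum>v\<in>V. real (card {l \<in> bd. v \<in> ancestors l}) * ((incr f v)\<^sup>2 / weight v))"
    unfolding path_energy_def using finite_bd finite_verts ancestors_verts bd_verts
    by (intro sum_sum_swap_card) blast+
  also have "\<dots> \<le> (\<Sum>v\<in>V. if v \<in> Z then 2 * (incr f v)\<^sup>2 else (f v - f (parent v))\<^sup>2)"
  proof (rule sum_mono)
    fix v assume v: "v \<in> V"
    let ?n = "real (card {l \<in> bd. v \<in> ancestors l})"
    have le: "?n \<le> real D ^ (R - level v)" if "v \<notin> Z \<or> card Z = 2"
      using card_boundary_below_le[OF v that] by (simp flip: of_nat_power)
    have pos: "real D ^ k > 0" for k using D_pos by simp
    show "?n * ((incr f v)\<^sup>2 / weight v) \<le> (if v \<in> Z then 2 * (incr f v)\<^sup>2 else (f v - f (parent v))\<^sup>2)"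
    proof (cases "v \<in> Z")
      case False
      have "?n * ((incr f v)\<^sup>2 / weight v) \<le> real D ^ (R - level v) * ((incr f v)\<^sup>2 / weight v)"
        using le False weight_nonneg by (intro mult_right_mono) simp_all
      then show ?thesis using False D_pos by (simp add: weight_def increment_def)
    next
      case True
      show ?thesis
      proof (cases "card Z = 1")
        case False
        then have 2: "card Z = 2" "2 * b = real D ^ R" using root_weight by auto
        then have "b > 0" using pos[of R] by linarith
        have "level v = 0" using True v level_eq_0 by simp
        then have "?n * ((incr f v)\<^sup>2 / weight v) \<le> 2 * b * ((incr f v)\<^sup>2 / weight v)"
          using le 2 weight_nonneg by (intro mult_right_mono) simp_all
        then show ?thesis using True \<open>b > 0\<close> by (simp add: weight_def)
      qed (use True increment_root_1[of v f] in simp)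
    qed
  qed
  also have "\<dots> = (\<Sum>v\<in>V - Z. (f v - f (parent v))\<^sup>2) + (\<Sum>v\<in>Z. 2 * (incr f v)\<^sup>2)"
    using finite_verts root_verts
    by (simp add: sum.If_cases Int_absorb1 Diff_eq add.commute)
  also have "(\<Sum>v\<in>Z. 2 * (incr f v)\<^sup>2)
      = (\<Sum>(u, v)\<in>{(u, v). u \<in> Z \<and> v \<in> Z \<and> u \<noteq> v}. (f u - f v)\<^sup>2) / 2"
  proof (cases "card Z = 1")
    case True
    then have empty: "{(u, v). u \<in> Z \<and> v \<in> Z \<and> u \<noteq> v} = {}" by (auto simp: card_1_singleton_iff)
    show ?thesis unfolding empty using increment_root_1[OF True] by simp
  next
    case False
    then have 2: "card Z = 2" using root_weight by blast
    then obtain z w where zw: "Z = {z, w}" "z \<noteq> w" by (auto simp: card_2_iff)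
    then have "{(u, v). u \<in> Z \<and> v \<in> Z \<and> u \<noteq> v} = {(z, w), (w, z)}" by auto
    moreover have "(\<Sum>v\<in>Z. 2 * (incr f v)\<^sup>2) = 2 * (incr f z)\<^sup>2 + 2 * (incr f w)\<^sup>2"
      unfolding zw(1) using zw(2) by simp
    moreover have "incr f z = (f z - f w) / 2" "incr f w = (f w - f z) / 2"
      by (rule increment_root_2[OF 2]; use zw in simp)+
    ultimately show ?thesis using zw(2)
      by (simp add: power2_commute[of "f z" "f w"] power_divide)
  qed
  also have "(\<Sum>v\<in>V - Z. (f v - f (parent v))\<^sup>2) + \<dots> \<le> energy (arcs G) f f" by (rule energy_ge_rooted)
  finally show ?thesis .
qed

text \<open>Since f sums to zero over the boundary, replacing it by its deviation from any constant
  only increases its norm there.\<close>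

lemma eigenfunction_deviation:
  assumes "steklov_eigenfunction G l f" "l \<noteq> 0"
  shows "(\<Sum>x\<in>bd. (f x - c)\<^sup>2) = (\<Sum>x\<in>bd. (f x)\<^sup>2) + real (card bd) * c\<^sup>2"
proof -
  have "(\<Sum>x\<in>bd. (f x - c)\<^sup>2) = (\<Sum>x\<in>bd. (f x)\<^sup>2) - 2 * c * (\<Sum>x\<in>bd. f x) + real (card bd) * c\<^sup>2"
    by (simp add: power2_diff sum.distrib sum_subtractf sum_distrib_left algebra_simps)
  then show ?thesis using eigenfunction_boundary_sum[OF assms] by simp
qed

lemma eigenvalue_chain:
  assumes "steklov_eigenfunction G l f" "l \<noteq> 0"
  shows "(\<Sum>x\<in>bd. (f x - root_mean f)\<^sup>2) \<le> (\<Sum>x\<in>bd. M * path_energy f x)"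
    and "(\<Sum>x\<in>bd. M * path_energy f x) \<le> M * l * (\<Sum>x\<in>bd. (f x)\<^sup>2)"
proof -
  show "(\<Sum>x\<in>bd. (f x - root_mean f)\<^sup>2) \<le> (\<Sum>x\<in>bd. M * path_energy f x)"
    using deviation_le bd_verts by (intro sum_mono) blast
  have "(\<Sum>x\<in>bd. M * path_energy f x) \<le> M * energy (arcs G) f f"
    using sum_path_energy_le[of f] M_pos by (simp add: sum_distrib_left[symmetric])
  also have "\<dots> = M * l * (\<Sum>x\<in>bd. (f x)\<^sup>2)"
    unfolding eigenfunction_green[OF assms(1)] by (simp add: power2_eq_square)
  finally show "(\<Sum>x\<in>bd. M * path_energy f x) \<le> M * l * (\<Sum>x\<in>bd. (f x)\<^sup>2)" .
qed

lemma eigenvalue_ge: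
  assumes "steklov_eigenvalue G l" "l \<noteq> 0"
  shows "1 / M \<le> l"
proof -
  obtain f where f: "steklov_eigenfunction G l f" using assms(1) by (auto simp: steklov_eigenvalue_iff)
  let ?n = "\<Sum>x\<in>bd. (f x)\<^sup>2"
  have "?n \<le> M * l * ?n"
    using eigenvalue_chain[OF f assms(2)] eigenfunction_deviation[OF f assms(2), of "root_mean f"]
    by (smt (verit) mult_nonneg_nonneg of_nat_0_le_iff zero_le_power2)
  then have "1 \<le> M * l" using eigenfunction_boundary_norm[OF f] by simp
  then show ?thesis using M_pos by (simp add: field_simps)
qed

section \<open>The equality case\<close>

context
  fixes f assumes extremal: "steklov_eigenfunction G (1 / M) f"
begin

text \<open>For \<open>1 / M\<close> the chain of inequalities begins with the squared boundary norm
  plus \<open>card bd\<close> times the squared mean and ends with the squared boundary norm. So the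
  mean is 0 and Cauchy-Schwarz is sharp on every path.\<close>

lemma extremal_mean: "root_mean f = 0"
  and extremal_path: "l \<in> bd \<Longrightarrow> (f l - root_mean f)\<^sup>2 = M * path_energy f l"
proof -
  have l: "1 / M \<noteq> 0" "M * (1 / M) = 1" using M_pos by auto
  have le: "(\<Sum>x\<in>bd. (f x - root_mean f)\<^sup>2) \<le> (\<Sum>x\<in>bd. M * path_energy f x)"
    "(\<Sum>x\<in>bd. M * path_energy f x) \<le> (\<Sum>x\<in>bd. (f x)\<^sup>2)"
    using eigenvalue_chain[OF extremal l(1)] unfolding l(2) by simp_all
  have dev: "(\<Sum>x\<in>bd. (f x - root_mean f)\<^sup>2) = (\<Sum>x\<in>bd. (f x)\<^sup>2) + real (card bd) * (root_mean f)\<^sup>2"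
    by (rule eigenfunction_deviation[OF extremal l(1)])
  have "0 < card bd" using ex_two_boundary finite_bd by (auto simp: card_gt_0_iff)
  moreover have "real (card bd) * (root_mean f)\<^sup>2 \<le> 0" using le dev by linarith
  ultimately show mean: "root_mean f = 0" by (simp add: mult_le_0_iff)
  then have "(\<Sum>x\<in>bd. M * path_energy f x - (f x - root_mean f)\<^sup>2) = 0"
    using le dev by (simp add: sum_subtractf)
  moreover have "0 \<le> M * path_energy f x - (f x - root_mean f)\<^sup>2" if "x \<in> bd" for x
    using deviation_le[of x f] that bd_verts by auto
  ultimately have "\<forall>x\<in>bd. M * path_energy f x - (f x - root_mean f)\<^sup>2 = 0"
    using finite_bd by (simp add: sum_nonneg_eq_0_iff)
  then show "l \<in> bd \<Longrightarrow> (f l - root_mean f)\<^sup>2 = M * path_energy f l" by simp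
qed

text \<open>The equality case of Cauchy-Schwarz on the path to \<open>l\<close> makes increments
  proportional to weights, with factor \<open>f l / M\<close>. A nonzero \<open>f l\<close> moreover
  needs the full weight \<open>M\<close>, so the path goes down to level \<open>R\<close>.\<close>

lemma extremal_increment:
  assumes "l \<in> bd" "v \<in> ancestors l"
  shows "incr f v = f l / M * weight v"
    and extremal_level: "f l \<noteq> 0 \<Longrightarrow> level l = R"
proof -
  have l: "l \<in> V" using assms(1) bd_verts by blast
  have sum: "(\<Sum>v\<in>ancestors l. incr f v) = f l" using sum_increment[OF l] extremal_mean by simp
  have eq: "(\<Sum>v\<in>ancestors l. incr f v)\<^sup>2 = M * (\<Sum>v\<in>ancestors l. (incr f v)\<^sup>2 / weight v)"
    using extremal_path[OF assms(1)] sum extremal_mean by (simp add: path_energy_def)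
  have "incr f v = (\<Sum>v\<in>ancestors l. incr f v) / M * weight v"
    by (rule weighted_Cauchy_equality(1)[OF _ _ _ _ M_pos eq assms(2)])
       (simp_all add: finite_ancestors l weight_nonneg weight_eq_0D sum_weight_le)
  then show "incr f v = f l / M * weight v" unfolding sum .
  assume "f l \<noteq> 0"
  then have "(\<Sum>v\<in>ancestors l. weight v) = M"
    by (intro weighted_Cauchy_equality(2)[OF _ _ _ _ M_pos eq])
       (simp_all add: sum finite_ancestors l weight_nonneg weight_eq_0D sum_weight_le)
  then show "level l = R" by (rule sum_weight_eqD[OF l])
qed

text \<open>Below a vertex with nonzero increment all increments are the same multiple of the weights,
  and all boundary vertices have depth R. Harmonicity then counts the children.\<close>

lemma extremal_full_branch:
  assumes v: "v \<in> V" "v \<notin> Z \<or> card Z = 2" and nz: "incr f v \<noteq> 0"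
  shows "full_branch D v (R - level v)"
  unfolding full_branch_def
proof (intro allI impI ballI)
  fix k u assume k: "k \<le> R - level v" and "u \<in> descendants v k"
  then have u: "u \<in> V" "v \<in> ancestors u" "level u = level v + k" by (auto simp: descendants_def)
  have lvR: "level v \<le> R" using height_le[OF v(1)] .
  have up: "x \<notin> Z \<or> card Z = 2" if "x \<in> V" "v \<in> ancestors x" for x
    using that v ancestors_root[of x] by auto
  define t where "t = incr f v / weight v"
  have "weight v \<noteq> 0" using nz weight_eq_0D by blast
  then have "t \<noteq> 0" using nz by (simp add: t_def)
  \<comment> \<open>A leaf below \<open>x\<close> is also below \<open>v\<close>, so its factor
    \<open>f l / M\<close> governs both increments and must be \<open>t\<close>.\<close>
  have below: "incr f x = t * weight x" if x: "x \<in> V" "v \<in> ancestors x" for x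
  proof -
    obtain l where l: "l \<in> V" "x \<in> ancestors l" "children l = {}"
      using ex_boundary_descendant[OF x(1)] by blast
    then have "v \<in> ancestors l" using ancestors_trans x by blast
    then have "l \<in> bd" using boundary_upward[OF l(1) up] l by blast
    then have "incr f x = f l / M * weight x" "incr f v = f l / M * weight v"
      using extremal_increment l(2) \<open>v \<in> ancestors l\<close> by blast+
    then show ?thesis using \<open>weight v \<noteq> 0\<close> by (simp add: t_def)
  qed
  \<comment> \<open>The increment of \<open>v\<close> is a multiple of \<open>f x\<close>, so
    \<open>f x \<noteq> 0\<close> and the path has full length.\<close>
  have leaf: "level x = R" if "x \<in> bd" "v \<in> ancestors x" for x
    using extremal_increment[OF that] extremal_level[OF that] nz by auto
  show "card (children u) = (if k < R - level v then D else 0)"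
  proof (cases "k < R - level v")
    case False
    then have "level u = R" using k u lvR by simp
    then have "children u = {}"
      using level_children height_le by (metis Suc_n_not_le_n children_iff equals0I)
    then show ?thesis using False by simp
  next
    case True
    then have lu: "level u < R" using u lvR by simp
    then have "u \<notin> bd" using leaf u by fastforce
    then have lap: "graph_laplacian G f u = 0" using extremal u(1) by (simp add: steklov_eigenfunction_def)
    have child: "f c - f u = t * real D ^ (R - Suc (level u))" if c: "c \<in> children u" for c
    proof -
      have c': "c \<in> V" "c \<notin> Z" "parent c = u" using c by (auto simp: children_iff)
      then have "v \<in> ancestors c" using u by (simp add: ancestors_step)
      then show ?thesis using below[OF c'(1)] c' level_children[OF c]
        by (simp add: increment_def weight_def)
    qed
    \<comment> \<open>Harmonicity: what enters \<open>u\<close> from above leaves through its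
      children. At a root the difference across the central edge is twice the half increment, and
      \<open>2 * b = D ^ R\<close> gives the same formula as at other vertices.\<close>
    have "t * real D ^ (R - level u) = (\<Sum>c\<in>children u. f c - f u)"
    proof (cases "u \<in> Z")
      case False
      then show ?thesis
        using below[OF u(1,2)] lap laplacian_nonroot[OF u(1)] by (simp add: increment_def weight_def)
    next
      case True
      then have 2: "card Z = 2" using up u by blast
      obtain w where w: "w \<in> Z" "w \<noteq> u" using neighbours_card2[OF 2 True] by metis
      have tb: "incr f u = t * b" using below[OF u(1,2)] True by (simp add: weight_def)
      have half: "incr f u = (f u - f w) / 2" by (rule increment_root_2[OF 2 True w])
      have "(f u - f w) / 2 = t * b" by (rule trans[OF half[symmetric] tb])
      then have "f u - f w = 2 * (t * b)" by simp
      moreover have "2 * b = real D ^ R" using root_weight 2 by simp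
      ultimately have "f u - f w = t * real D ^ R" by (metis mult.left_commute)
      moreover have "level u = 0" using True u(1) level_eq_0 by simp
      ultimately show ?thesis using lap laplacian_card2[OF 2 True w] by simp
    qed
    also have "\<dots> = real (card (children u)) * (t * real D ^ (R - Suc (level u)))"
      using child by simp
    also have "real D ^ (R - level u) = real D * real D ^ (R - Suc (level u))"
      using lu by (simp flip: power_Suc add: Suc_diff_Suc)
    finally have "real D = real (card (children u))" using \<open>t \<noteq> 0\<close> D_pos by simp
    then show ?thesis using True by simp
  qed
qed

end

end

section \<open>Centres and extremal eigenfunctions\<close>

context rooted_tree
begin

lemma ancestors_linear:
  assumes "v \<in> gverts G" "u \<in> ancestors v" "u' \<in> ancestors v" "level u \<le> level u'"
  shows "u \<in> ancestors u'"
proof -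
  have "u' \<in> gverts G" using ancestors_verts assms by blast
  then obtain w where "w \<in> ancestors u'" "level w = level u"
    using ex_ancestor_level assms(4) by blast
  moreover from this have "w = u" using ancestors_level_inj ancestors_trans assms by metis
  ultimately show ?thesis by simp
qed

lemma walk_from_ancestor:
  assumes "u \<in> gverts G" "y \<in> ancestors u"
  shows "(gadj G ^^ (level u - level y)) y u"
  using assms
proof (induction rule: level_induct)
  case (root v)
  then show ?case by (simp add: ancestors_root)
next
  case (step v)
  show ?case
  proof (cases "y = v")
    case False
    then have y: "y \<in> ancestors (parent v)" using step by (simp add: ancestors_step)
    then have "level v - level y = Suc (level (parent v) - level y)"
      using level_parent[OF step.hyps] ancestors_verts[OF parent_verts[OF step.hyps]] by (metis Suc_diff_le)
    then show ?thesis using step.IH[OF y] adj_sym[OF adj_parent[OF step.hyps]] by auto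
  qed simp
qed

lemma graph_dist_ancestor:
  "u \<in> gverts G \<Longrightarrow> y \<in> ancestors u \<Longrightarrow> graph_dist G y u \<le> level u - level y"
  unfolding graph_dist_def by (rule Least_le) (rule walk_from_ancestor)

text \<open>Counting the level with opposite signs inside and outside the branch of y gives a function
  that changes by at most one along every edge.\<close>

lemma walk_across_root:
  assumes Z: "Z = {x}" and y: "level y = 1"
    and v: "v \<in> gverts G" "y \<in> ancestors v" and u: "u \<in> gverts G" "y \<notin> ancestors u"
    and walk: "(gadj G ^^ n) v u"
  shows "level v + level u \<le> n"
proof -
  define h where "h w = (if y \<in> ancestors w then int (level w) else - int (level w))" for w
  have up: "\<bar>h w - h (parent w)\<bar> \<le> 1" if w: "w \<in> gverts G" "w \<notin> Z" for w
  proof (cases "w = y")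
    case True
    then show ?thesis
      using level_parent[OF w] y not_ancestor_of_parent[OF w] self_in_ancestors by (simp add: h_def)
  next
    case False
    then show ?thesis using level_parent[OF w] by (simp add: h_def ancestors_step[OF w])
  qed
  have adj: "\<bar>h a - h c\<bar> \<le> 1" if "gadj G a c" for a c
    using that
  proof (cases rule: adj_cases)
    case 1
    then show ?thesis using Z by simp
  next
    case 2
    then show ?thesis using up[of c] adj_verts that by fastforce
  next
    case 3
    then show ?thesis using up[of a] adj_verts that by fastforce
  qed
  have "\<bar>h v - h w\<bar> \<le> int n" if "(gadj G ^^ n) v w" for n w
    using that
  proof (induction n arbitrary: w)
    case (Suc n)
    then obtain a where "(gadj G ^^ n) v a" "gadj G a w" by auto
    then show ?case using Suc.IH[of a] adj[of a w] by linarith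
  qed simp
  from this[OF walk] show ?thesis using v u by (simp add: h_def)
qed

end

lemma (in rooted_tree) level_eq_dist: "Z = {x} \<Longrightarrow> level v = graph_dist G x v"
  unfolding level_def graph_dist_def by simp

context finite_tree
begin

lemma graph_dist_walk: "u \<in> V \<Longrightarrow> v \<in> V \<Longrightarrow> (gadj G ^^ graph_dist G u v) u v"
  using rooted_tree.level_walk[OF rooted, of u v] rooted_tree.level_eq_dist[OF rooted, of u u v]
  by simp

lemma graph_dist_le_diameter:
  assumes "u \<in> V" "v \<in> V"
  shows "graph_dist G u v \<le> graph_diameter G"
proof -
  have "{graph_dist G u v | u v. u \<in> V \<and> v \<in> V} = (\<lambda>(u, v). graph_dist G u v) ` (V \<times> V)" by auto
  then have "finite {graph_dist G u v | u v. u \<in> V \<and> v \<in> V}" using finite_verts by simp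
  then show ?thesis unfolding graph_diameter_def using assms by (intro Max_ge) blast+
qed

lemma graph_dist_neighbour:
  assumes "gadj G y x" "u \<in> V"
  shows "graph_dist G y u \<le> Suc (graph_dist G x u)"
proof -
  have "x \<in> V" using tree_graph_verts[OF tree_G] assms by blast
  then have "(gadj G ^^ Suc (graph_dist G x u)) y u"
    using graph_dist_walk assms relpowp_Suc_I2 by metis
  then show ?thesis unfolding graph_dist_def by (rule Least_le)
qed

lemma dist_across_root:
  assumes "x \<in> V" and y: "rooted_tree.level G {x} y = 1"
    and v: "v \<in> V" "y \<in> rooted_tree.ancestors G {x} v"
    and u: "u \<in> V" "y \<notin> rooted_tree.ancestors G {x} u"
  shows "rooted_tree.level G {x} v + rooted_tree.level G {x} u \<le> graph_diameter G"
  using rooted_tree.walk_across_root[OF rooted[OF assms(1)] refl y v u graph_dist_walk[OF v(1) u(1)]]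
    graph_dist_le_diameter[OF v(1) u(1)] by simp

text \<open>A vertex x of least eccentricity e is a centre, unless 2 e is larger than the diameter; then
  the vertices at distance e from x all lie in the branch of one neighbour y of x.\<close>

lemma ex_center:
  assumes "graph_diameter G \<le> L" "L \<le> 2 * R + 1"
  shows "(\<exists>x\<in>V. \<forall>v\<in>V. graph_dist G x v \<le> R) \<or>
    L = 2 * R + 1 \<and> (\<exists>x y. gadj G x y \<and> (\<forall>v\<in>V. graph_dist G x v \<le> R \<or> graph_dist G y v \<le> R))"
proof -
  define e where "e = (LEAST n. \<exists>x\<in>V. \<forall>v\<in>V. graph_dist G x v \<le> n)"
  obtain x0 where "x0 \<in> V" using ex_other_vertex by blast
  then have "\<exists>n. \<exists>x\<in>V. \<forall>v\<in>V. graph_dist G x v \<le> n"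
    using graph_dist_le_diameter by blast
  then have "\<exists>x\<in>V. \<forall>v\<in>V. graph_dist G x v \<le> e" unfolding e_def by (rule LeastI_ex)
  then obtain x where x: "x \<in> V" "\<And>v. v \<in> V \<Longrightarrow> graph_dist G x v \<le> e" by blast
  have least: "\<exists>v\<in>V. n < graph_dist G y v" if "n < e" "y \<in> V" for n y
    using not_less_Least[of n "\<lambda>n. \<exists>x\<in>V. \<forall>v\<in>V. graph_dist G x v \<le> n"] that
    unfolding e_def by (meson not_le)
  show ?thesis
  proof (cases "e \<le> R")
    case True
    then show ?thesis using x by (meson order_trans)
  next
    case False
    interpret finite_rooted_tree G "{x}"
      using rooted[OF x(1)] finite_tree_axioms by (simp add: finite_rooted_tree_def)
    have lev: "level v = graph_dist G x v" for v by (rule level_eq_dist) simp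
    obtain v where v: "v \<in> V" "level v = e"
      using least[of "e - 1" x] x False lev by fastforce
    then obtain y where y: "y \<in> ancestors v" "level y = 1"
      using ex_ancestor_level[of v 1] False by auto
    then have yV: "y \<in> V" "y \<notin> {x}" using ancestors_verts[OF v(1) y(1)] level_eq_0[of y] by auto
    then have "level (parent y) = 0" using level_parent[of y] y(2) by simp
    then have "parent y = x" using level_eq_0[of "parent y"] parent_verts[OF yV] by simp
    then have yx: "gadj G y x" using adj_parent[OF yV] by simp
    have inside: "graph_dist G y u \<le> level u - 1" if "u \<in> V" "y \<in> ancestors u" for u
      using graph_dist_ancestor[OF that] y(2) by simp
    have outside: "level u + e \<le> L" if "u \<in> V" "y \<notin> ancestors u" for u
      using dist_across_root[OF x(1) y(2) v(1) y(1) that] assms(1) v(2) by simp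
    \<comment> \<open>By minimality of \<open>e\<close>, moving to \<open>y\<close> does not help:
      some \<open>u\<close> has distance at least \<open>e\<close> from \<open>y\<close>. It lies
      outside the branch of \<open>y\<close>, at level at least \<open>e - 1\<close>, so
      \<open>2 * e - 1 \<le> L\<close>; with \<open>e > R\<close> and
      \<open>L \<le> 2 * R + 1\<close> only \<open>e = R + 1\<close> and
      \<open>L = 2 * R + 1\<close> remain.\<close>
    obtain u where u: "u \<in> V" "e - 1 < graph_dist G y u" using least[of "e - 1" y] yV False by auto
    have "level u \<le> e" using x(2)[OF u(1)] lev by simp
    then have "y \<notin> ancestors u" using inside[OF u(1)] u(2) False by fastforce
    then have "level u + e \<le> L" using outside u by blast
    moreover have "e \<le> Suc (level u)" using graph_dist_neighbour[OF yx u(1)] u(2) lev by simp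
    ultimately have e: "e = Suc R" "L = 2 * R + 1" using False assms(2) by linarith+
    have "graph_dist G x u \<le> R \<or> graph_dist G y u \<le> R" if "u \<in> V" for u
      using inside[OF that] outside[OF that] x(2)[OF that] e lev[of u] by fastforce
    then show ?thesis using e yx adj_sym by blast
  qed
qed

end

section \<open>Eigenfunctions carried by full branches\<close>

context finite_rooted_tree
begin

text \<open>A deeper vertex would have an ancestor in the last generation, which has no
  children.\<close>

lemma full_branch_level:
  assumes full: "full_branch D y n" and u: "u \<in> V" "y \<in> ancestors u"
  shows "level u \<le> level y + n"
proof (rule ccontr)
  assume less: "\<not> ?thesis"
  then obtain w where w: "w \<in> ancestors u" "level w = level y + n"
    using ex_ancestor_level[OF u(1), of "level y + n"] by auto
  then have "w \<in> V" using ancestors_verts[OF u(1)] by blast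
  moreover have "y \<in> ancestors w" using ancestors_linear[OF u w(1)] w(2) by simp
  ultimately have "w \<in> descendants y n" using w by (simp add: descendants_def)
  then have "card (children w) = 0" using full unfolding full_branch_def by fastforce
  then have "children w = {}" using finite_children by simp
  moreover have "u \<noteq> w" using less w by auto
  ultimately show False using ex_child_ancestor[OF u(1) w(1)] by blast
qed

text \<open>The increments of \<open>f\<close> are \<open>s v * D ^ (R - level v)\<close>:
  \<open>D\<close> children with a \<open>D\<close>-th of the weight each balance the edge above,
  and at level \<open>R\<close> the slope is \<open>s v\<close> and the value
  \<open>s v * M\<close>, whence the ratio \<open>1 / M\<close>. The factor \<open>b\<close> makes
  the first sign condition void at the children of a single root, where \<open>b = 0\<close> and
  branches may differ in sign, but binding at the ends of a central edge.\<close>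

lemma extremal_eigenfunction:
  fixes s :: "'a \<Rightarrow> real" and D R :: nat and b :: real
  defines "f \<equiv> \<lambda>v. s v * (b + (\<Sum>j<level v. real D ^ (R - Suc j)))"
    and "M \<equiv> b + (\<Sum>j<R. real D ^ j)"
  assumes D: "1 \<le> D" and R: "0 < R" and b: "0 \<le> b"
    and sign: "\<And>v. v \<in> V \<Longrightarrow> v \<notin> Z \<Longrightarrow> s v * b = s (parent v) * b"
      "\<And>v. v \<in> V \<Longrightarrow> v \<notin> Z \<Longrightarrow> parent v \<notin> Z \<Longrightarrow> s v = s (parent v)"
    and full: "\<And>v. v \<in> V \<Longrightarrow> v \<notin> Z \<Longrightarrow> s v \<noteq> 0 \<Longrightarrow>
      level v \<le> R \<and> card (children v) = (if level v < R then D else 0)"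
    and roots: "\<And>z. z \<in> Z \<Longrightarrow> graph_laplacian G f z = 0"
      "\<And>z. z \<in> Z \<Longrightarrow> z \<in> bd \<Longrightarrow> f z = 0"
    and nonzero: "\<exists>v\<in>V - Z. s v \<noteq> 0"
  shows "steklov_eigenfunction G (1 / M) f"
proof -
  have geometric_pos: "0 < b + (\<Sum>j<n. real D ^ (R - Suc j))" if "0 < n" for n
  proof -
    have "0 < (\<Sum>j<n. real D ^ (R - Suc j))"
      using that D by (intro sum_pos) (auto simp: lessThan_empty_iff)
    then show ?thesis using b by simp
  qed
  have M: "0 < M" using geometric_pos[OF R] unfolding M_def sum_powers_reverse .
  have step: "f v - f (parent v) = s v * real D ^ (R - level v)" if v: "v \<in> V" "v \<notin> Z" for v
  proof -
    have "s (parent v) * (b + (\<Sum>j<level (parent v). real D ^ (R - Suc j)))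
        = s v * (b + (\<Sum>j<level (parent v). real D ^ (R - Suc j)))"
      using sign[OF v] level_eq_0[OF parent_verts[OF v]] by (cases "parent v \<in> Z") auto
    then show ?thesis using level_parent[OF v] by (simp add: f_def algebra_simps)
  qed
  have lap: "graph_laplacian G f v = (if v \<in> bd then 1 / M * f v else 0)" if v: "v \<in> V" "v \<notin> Z" for v
  proof -
    have child: "f c - f v = s v * real D ^ (R - Suc (level v))" if "c \<in> children v" for c
      using step[of c] sign(2)[of c] that v level_children[OF that] by (auto simp: children_iff)
    have "graph_laplacian G f v
        = s v * real D ^ (R - level v) - real (card (children v)) * (s v * real D ^ (R - Suc (level v)))"
      unfolding laplacian_nonroot[OF v] step[OF v] by (simp add: child)
    moreover have bd: "v \<in> bd \<longleftrightarrow> children v = {}" using boundary_upward v by blast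
    show ?thesis
    proof (cases "s v = 0")
      case True
      then show ?thesis using calculation by (simp add: f_def)
    next
      case False
      show ?thesis
      proof (cases "level v < R")
        case True
        then have "card (children v) = D" "children v \<noteq> {}" using full[OF v False] D by auto
        moreover have "R - level v = Suc (R - Suc (level v))" using True by simp
        ultimately show ?thesis using bd \<open>graph_laplacian G f v = _\<close> by simp
      next
        case False
        then have "level v = R" "card (children v) = 0" using full[OF v \<open>s v \<noteq> 0\<close>] by auto
        moreover from this have "children v = {}" using finite_children by simp
        moreover have "f v = s v * M" using \<open>level v = R\<close> by (simp add: f_def M_def sum_powers_reverse)
        ultimately show ?thesis using bd M \<open>graph_laplacian G f v = _\<close> by simp
      qed
    qed
  qed
  obtain v where v: "v \<in> V" "v \<notin> Z" "s v \<noteq> 0" using nonzero by blast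
  then have "0 < level v" using level_eq_0 by blast
  from geometric_pos[OF this] have "f v \<noteq> 0" using v by (simp add: f_def)
  then show ?thesis
    using lap roots v unfolding steklov_eigenfunction_def by (metis mult_zero_right)
qed

end

context finite_tree
begin

lemma rooted_at_vertex: "x \<in> V \<Longrightarrow> finite_rooted_tree G {x}"
  using rooted finite_tree_axioms by (simp add: finite_rooted_tree_def)

lemma rooted_at_edge:
  assumes "gadj G z w"
  shows "finite_rooted_tree G {z, w}"
  using rooted_tree_edge[OF tree_G assms] finite_tree_axioms by (simp add: finite_rooted_tree_def)

lemma balanced_at_vertex:
  assumes "1 \<le> D" "0 < R" "\<forall>v\<in>V. graph_degree G v \<le> D + 1"
    and "x \<in> V" "\<forall>v\<in>V. graph_dist G x v \<le> R"
  shows "balanced_tree G {x} D R 0"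
proof -
  interpret finite_rooted_tree G "{x}" using rooted_at_vertex[OF assms(4)] .
  show ?thesis by unfold_locales (use assms level_eq_dist[OF refl] in auto)
qed

lemma balanced_at_edge:
  assumes "1 \<le> D" "0 < R" "\<forall>v\<in>V. graph_degree G v \<le> D + 1"
    and "gadj G z w" "\<forall>v\<in>V. graph_dist G z v \<le> R \<or> graph_dist G w v \<le> R"
  shows "balanced_tree G {z, w} D R (real D ^ R / 2)"
proof -
  interpret finite_rooted_tree G "{z, w}" using rooted_at_edge[OF assms(4)] .
  have "level v \<le> R" if "v \<in> V" for v
  proof -
    have "level v \<le> graph_dist G z v" "level v \<le> graph_dist G w v"
      using adj_verts[OF assms(4)] that by (auto intro!: level_le[OF _ graph_dist_walk])
    then show ?thesis using assms(5) that by fastforce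
  qed
  moreover have "z \<noteq> w" using assms(4) adj_irrefl by blast
  ultimately show ?thesis by unfold_locales (use assms in auto)
qed

end

context balanced_tree
begin

lemma lambda2_ge: "1 / M \<le> steklov_lambda2 G"
  using steklov_lambda2_eigenvalue by (rule eigenvalue_ge)

text \<open>Some boundary value is nonzero, hence so is the increment at the root above it; the two
  root increments are opposite, so the other root is covered as well.\<close>

lemma extremal_root_increment:
  assumes "steklov_eigenfunction G (1 / M) f" "v \<in> Z" "card Z = 2"
  shows "incr f v \<noteq> 0"
proof -
  have "\<exists>l\<in>bd. f l \<noteq> 0"
  proof (rule ccontr)
    assume "\<not> ?thesis"
    then show False using eigenfunction_boundary_norm[OF assms(1)] by simp
  qed
  then obtain l where l: "l \<in> bd" "f l \<noteq> 0" by blast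
  then have "l \<in> V" using bd_verts by blast
  then obtain r where r: "r \<in> ancestors l" "level r = 0" using ex_ancestor_level[of l 0] by blast
  then have rZ: "r \<in> Z" using level_eq_0 ancestors_verts[OF \<open>l \<in> V\<close>] by blast
  have "b \<noteq> 0" using root_weight assms(3) D_pos by auto
  then have r0: "incr f r \<noteq> 0"
    using extremal_increment[OF assms(1) l(1) r(1)] l(2) M_pos rZ by (simp add: weight_def)
  show ?thesis
  proof (cases "v = r")
    case False
    have "incr f v = (f v - f r) / 2" "incr f r = (f r - f v) / 2"
      using False by (intro increment_root_2[OF assms(3)] assms(2) rZ; simp)+
    then show ?thesis using r0 by simp
  qed (use r0 in simp)
qed

text \<open>The vertex of level 1 above \<open>l\<close> has an increment of the sign of
  \<open>f l\<close>, so boundary vertices of opposite signs yield different branches at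
  \<open>x\<close>.\<close>

lemma extremal_branch_of_sign:
  assumes "steklov_eigenfunction G (1 / M) f" "l \<in> bd" "f l \<noteq> 0" "Z = {x}"
  shows "\<exists>y\<in>children x. sgn (incr f y) = sgn (f l) \<and> full_branch D y (R - 1)"
proof -
  have l: "l \<in> V" using assms(2) bd_verts by blast
  have "level l = R"
    using extremal_level[OF assms(1) assms(2) self_in_ancestors assms(3)] .
  then obtain y where y: "y \<in> ancestors l" "level y = 1"
    using ex_ancestor_level[OF l, of 1] R_pos by auto
  then have yV: "y \<in> V" "y \<notin> Z" using ancestors_verts[OF l] level_eq_0[of y] by auto
  then have "parent y \<in> Z"
    using level_parent[OF yV] y(2) level_eq_0[OF parent_verts[OF yV]] by simp
  then have "parent y = x" using assms(4) by blast
  then have child: "y \<in> children x" using yV children_iff[of y x] by blast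
  have incr: "incr f y = f l / M * weight y" by (rule extremal_increment[OF assms(1,2) y(1)])
  have "0 < weight y" using yV D_pos by (simp add: weight_def)
  then have "sgn (incr f y) = sgn (f l)" using M_pos unfolding incr by (simp add: sgn_mult)
  moreover from this have "incr f y \<noteq> 0" using assms(3) by (metis sgn_zero_iff)
  then have "full_branch D y (R - level y)"
    using yV by (intro extremal_full_branch[OF assms(1)]) auto
  ultimately show ?thesis using child y(2) by auto
qed

end

context finite_tree
begin

text \<open>Extremality described inside \<open>G\<close>, without reference to the regular tree.
  Two branches at \<open>x\<close> are prescribed and the others are left free.\<close>

definition two_full_branches :: "nat \<Rightarrow> nat \<Rightarrow> 'a \<Rightarrow> bool" where
  "two_full_branches D R x \<longleftrightarrow>
     (\<exists>y y'. y \<noteq> y' \<and> y \<in> rooted_tree.children G {x} x \<and> y' \<in> rooted_tree.children G {x} x \<and>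
       rooted_tree.full_branch G {x} D y (R - 1) \<and> rooted_tree.full_branch G {x} D y' (R - 1))"

definition full_at_edge :: "nat \<Rightarrow> nat \<Rightarrow> 'a \<Rightarrow> 'a \<Rightarrow> bool" where
  "full_at_edge D R z w \<longleftrightarrow>
     rooted_tree.full_branch G {z, w} D z R \<and> rooted_tree.full_branch G {z, w} D w R"

lemma eigenvalue_of_two_full_branches:
  assumes D: "1 \<le> D" and R: "0 < R" and x: "x \<in> V" and full: "two_full_branches D R x"
  shows "steklov_eigenvalue G (1 / (\<Sum>j<R. real D ^ j))"
proof -
  interpret finite_rooted_tree G "{x}" using rooted_at_vertex[OF x] .
  obtain y y' where y: "y \<noteq> y'" "y \<in> children x" "y' \<in> children x"
    "full_branch D y (R - 1)" "full_branch D y' (R - 1)"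
    using full by (auto simp: two_full_branches_def)
  have lev: "level y = 1" "level y' = 1" "level x = 0"
    using level_children[OF y(2)] level_children[OF y(3)] level_eq_0[OF x] by auto
  define s :: "'a \<Rightarrow> real" where
    "s v = (if y \<in> ancestors v then 1 else if y' \<in> ancestors v then -1 else 0)" for v
  have yx: "y \<noteq> x" "y' \<noteq> x" "parent y = x" "parent y' = x" using y by (auto simp: children_iff)
  have excl: "\<not> (y \<in> ancestors v \<and> y' \<in> ancestors v)" if "v \<in> V" for v
    using ancestors_level_inj[OF that] lev y(1) by metis
  have sign: "s v = s (parent v)" if "v \<in> V" "v \<notin> {x}" "parent v \<notin> {x}" for v
    using that yx by (auto simp: s_def ancestors_step)
  have s_child: "s c = (if c = y then 1 else if c = y' then -1 else 0)" if "c \<in> children x" for c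
  proof -
    have "ancestors c = {c, x}"
      using that ancestors_step[of c] by (auto simp: children_iff ancestors_root)
    then show ?thesis using yx by (auto simp: s_def)
  qed
  have branch: "level v \<le> R \<and> card (children v) = (if level v < R then D else 0)"
    if v: "v \<in> V" "u \<in> ancestors v" and u: "full_branch D u (R - 1)" "level u = 1" for v u
  proof -
    have "level v \<le> R" using full_branch_level[OF u(1) v] u(2) R by simp
    moreover have "v \<in> descendants u (level v - 1)"
      using ancestors_imp_descendants[OF v] u(2) by simp
    moreover have "0 < level v" using ancestors_verts[OF v] u(2) by simp
    moreover have "card (children v) = (if level v - 1 < R - 1 then D else 0)"
      using u(1) calculation unfolding full_branch_def by simp
    ultimately show ?thesis by (auto split: if_splits)
  qed
  \<comment> \<open>The leading 0 is the \<open>b\<close> of \<open>extremal_eigenfunction\<close>;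
    accordingly the function vanishes at \<open>x\<close>.\<close>
  let ?f = "\<lambda>v. s v * (0 + (\<Sum>j<level v. real D ^ (R - Suc j)))"
  have "steklov_eigenfunction G (1 / (0 + (\<Sum>j<R. real D ^ j))) ?f"
  proof (rule extremal_eigenfunction[OF D R])
    show "s v = s (parent v)" if "v \<in> V" "v \<notin> {x}" "parent v \<notin> {x}" for v
      using sign that by blast
    show "level v \<le> R \<and> card (children v) = (if level v < R then D else 0)"
      if "v \<in> V" "v \<notin> {x}" "s v \<noteq> 0" for v
    proof (cases "y \<in> ancestors v")
      case True
      then show ?thesis using branch that y lev by blast
    next
      case False
      then have "y' \<in> ancestors v" using that by (simp add: s_def split: if_splits)
      then show ?thesis using branch that y lev by blast
    qed
    have nbrs: "{u. gadj G x u} = children x" using neighbours_root(1)[of x] by simp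
    have "?f x - ?f c = - (real D ^ (R - 1)) * (if c = y then 1 else if c = y' then -1 else 0)"
      if "c \<in> children x" for c
      using level_children[OF that] s_child[OF that] lev by simp
    then have "graph_laplacian G ?f x
        = (\<Sum>c\<in>children x. - (real D ^ (R - 1)) * (if c = y then 1 else if c = y' then -1 else 0))"
      unfolding graph_laplacian_def nbrs by (rule sum.cong[OF refl])
    also have "\<dots> = (\<Sum>c\<in>{y, y'}. - (real D ^ (R - 1)) * (if c = y then 1 else if c = y' then -1 else 0))"
      using y by (intro sum.mono_neutral_right finite_children) auto
    also have "\<dots> = 0" using y(1) by simp
    finally show "graph_laplacian G ?f z = 0" if "z \<in> {x}" for z using that by simp
    show "\<exists>v\<in>V - {x}. s v \<noteq> 0"
      using s_child[OF y(2)] y(2) by (intro bexI[of _ y]) (auto simp: children_iff)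
  qed (use lev in auto)
  then show ?thesis by (auto simp: steklov_eigenvalue_iff)
qed

lemma eigenvalue_of_full_at_edge:
  assumes D: "1 \<le> D" and R: "0 < R" and zw: "gadj G z w" and full: "full_at_edge D R z w"
  shows "steklov_eigenvalue G (1 / (real D ^ R / 2 + (\<Sum>j<R. real D ^ j)))"
proof -
  interpret finite_rooted_tree G "{z, w}" using rooted_at_edge[OF zw] .
  have full: "full_branch D z R" "full_branch D w R" using full by (auto simp: full_at_edge_def)
  have V: "z \<in> V" "w \<in> V" "z \<noteq> w" using adj_verts[OF zw] zw adj_irrefl by auto
  have lev: "level z = 0" "level w = 0" using level_eq_0 V by auto
  have card2: "card {z, w} = 2" using V by simp
  define s :: "'a \<Rightarrow> real" where "s v = (if z \<in> ancestors v then 1 else -1)" for v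
  have sign: "s v = s (parent v)" if "v \<in> V" "v \<notin> {z, w}" for v
    using that by (auto simp: s_def ancestors_step)
  have s_roots: "s z = 1" "s w = -1" using V by (auto simp: s_def ancestors_root)
  have branch: "level v \<le> R \<and> card (children v) = (if level v < R then D else 0)" if v: "v \<in> V" for v
  proof -
    obtain u where u: "u \<in> ancestors v" "level u = 0" using ex_ancestor_level[OF v, of 0] by auto
    then have "u \<in> {z, w}" using level_eq_0[of u] ancestors_verts[OF v] by blast
    then have fu: "full_branch D u R" using full by blast
    have "level v \<le> R" using full_branch_level[OF fu v u(1)] u(2) by simp
    moreover have "v \<in> descendants u (level v)" using ancestors_imp_descendants[OF v u(1)] u(2) by simp
    ultimately show ?thesis using fu by (auto simp: full_branch_def)
  qed
  \<comment> \<open>The values at the roots are plus and minus \<open>D ^ R / 2\<close>: the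
    difference \<open>D ^ R\<close> across the central edge balances \<open>D\<close> children with
    increments \<open>D ^ (R - 1)\<close>.\<close>
  let ?f = "\<lambda>v. s v * (real D ^ R / 2 + (\<Sum>j<level v. real D ^ (R - Suc j)))"
  have lap: "graph_laplacian G ?f u = 0" "u \<notin> bd"
    if u: "u \<in> {z, w}" "u' \<in> {z, w}" "u' \<noteq> u" for u u'
  proof -
    have lu: "level u = 0" "level u' = 0" "s u' = - s u" using u lev s_roots by auto
    have "?f c - ?f u = s u * real D ^ (R - 1)" if "c \<in> children u" for c
      using level_children[OF that] sign[of c] that lu by (auto simp: children_iff algebra_simps)
    then have "(\<Sum>c\<in>children u. ?f c - ?f u) = real (card (children u)) * (s u * real D ^ (R - 1))"
      by simp
    moreover have ch: "card (children u) = D" using branch[of u] lu R u V by auto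
    moreover have "real D * real D ^ (R - 1) = real D ^ R" using R by (simp flip: power_Suc)
    ultimately show "graph_laplacian G ?f u = 0"
      unfolding laplacian_card2[OF card2 u] using lu by (simp add: algebra_simps)
    show "u \<notin> bd" using boundary_upward[of u] card2 ch D u V by auto
  qed
  have "steklov_eigenfunction G (1 / (real D ^ R / 2 + (\<Sum>j<R. real D ^ j))) ?f"
  proof (rule extremal_eigenfunction[OF D R])
    show "graph_laplacian G ?f u = 0" if "u \<in> {z, w}" for u
      using that lap(1)[of z w] lap(1)[of w z] V(3) by blast
    show "?f u = 0" if "u \<in> {z, w}" "u \<in> bd" for u
      using that lap(2)[of z w] lap(2)[of w z] V(3) by blast
    have "children z \<noteq> {}" using branch[OF V(1)] lev R D by auto
    then obtain c where "c \<in> children z" by blast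
    then show "\<exists>v\<in>V - {z, w}. s v \<noteq> 0" by (auto simp: children_iff s_def)
  qed (use sign branch in auto)
  then show ?thesis by (auto simp: steklov_eigenvalue_iff)
qed

lemma extremal_two_full_branches:
  assumes "balanced_tree G {x} D R 0" "steklov_eigenvalue G (1 / (\<Sum>j<R. real D ^ j))"
  shows "two_full_branches D R x"
proof -
  interpret balanced_tree G "{x}" D R 0 by fact
  obtain f where f: "steklov_eigenfunction G (1 / M) f"
    using assms(2) by (auto simp: steklov_eigenvalue_iff M_def)
  have sum0: "(\<Sum>l\<in>bd. f l) = 0" using eigenfunction_boundary_sum[OF f] M_pos by simp
  have norm: "(\<Sum>l\<in>bd. (f l)\<^sup>2) \<noteq> 0" using eigenfunction_boundary_norm[OF f] by simp
  have "\<exists>l\<in>bd. f l > 0"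
  proof (rule ccontr)
    assume "\<not> ?thesis"
    then have "\<forall>l\<in>bd. f l = 0"
      using sum0 sum_nonneg_eq_0_iff[OF finite_bd, of "\<lambda>l. - f l"] by (simp add: sum_negf not_less)
    then show False using norm by simp
  qed
  moreover have "\<exists>l\<in>bd. f l < 0"
  proof (rule ccontr)
    assume "\<not> ?thesis"
    then have "\<forall>l\<in>bd. f l = 0"
      using sum0 sum_nonneg_eq_0_iff[OF finite_bd, of f] by (simp add: not_less)
    then show False using norm by simp
  qed
  ultimately obtain l l' where l: "l \<in> bd" "f l > 0" "l' \<in> bd" "f l' < 0" by blast
  obtain y where y: "y \<in> children x" "sgn (incr f y) = 1" "full_branch D y (R - 1)"
    using extremal_branch_of_sign[OF f l(1) _ refl] l(2) by force
  obtain y' where y': "y' \<in> children x" "sgn (incr f y') = -1" "full_branch D y' (R - 1)"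
    using extremal_branch_of_sign[OF f l(3) _ refl] l(4) by force
  have "y \<noteq> y'" using y y' by auto
  then show ?thesis using y y' unfolding two_full_branches_def by blast
qed

lemma extremal_full_at_edge:
  assumes "balanced_tree G {z, w} D R (real D ^ R / 2)"
    and "steklov_eigenvalue G (1 / (real D ^ R / 2 + (\<Sum>j<R. real D ^ j)))" "gadj G z w"
  shows "full_at_edge D R z w"
proof -
  interpret balanced_tree G "{z, w}" D R "real D ^ R / 2" by fact
  obtain f where f: "steklov_eigenfunction G (1 / M) f"
    using assms(2) by (auto simp: steklov_eigenvalue_iff M_def)
  have V: "z \<in> V" "w \<in> V" "z \<noteq> w" using adj_verts[OF assms(3)] assms(3) adj_irrefl by auto
  have "full_branch D v R" if "v \<in> {z, w}" for v
  proof -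
    have "v \<in> V" "level v = 0" using that V level_eq_0 by auto
    then show ?thesis
      using extremal_full_branch[OF f, of v] extremal_root_increment[OF f that] V by simp
  qed
  then show ?thesis by (simp add: full_at_edge_def)
qed

text \<open>The centre serves for the lower bound and as the witness when equality holds.
  Conversely, full branches at any vertex produce the eigenvalue, and the lower bound makes it the
  least.\<close>

theorem lambda2_even_diameter:
  assumes "1 \<le> D" "0 < R" "\<forall>v\<in>V. graph_degree G v \<le> D + 1" "graph_diameter G \<le> 2 * R"
  shows "1 / (\<Sum>j<R. real D ^ j) \<le> steklov_lambda2 G"
    and "steklov_lambda2 G = 1 / (\<Sum>j<R. real D ^ j) \<longleftrightarrow> (\<exists>x\<in>V. two_full_branches D R x)"
proof -
  obtain x where x: "x \<in> V" "\<forall>v\<in>V. graph_dist G x v \<le> R"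
    using ex_center[OF assms(4), of R] by auto
  interpret B: balanced_tree G "{x}" D R 0 using balanced_at_vertex[OF assms(1-3) x] .
  have M: "B.M = (\<Sum>j<R. real D ^ j)" by (simp add: B.M_def)
  show ge: "1 / (\<Sum>j<R. real D ^ j) \<le> steklov_lambda2 G" using B.lambda2_ge M by simp
  show "steklov_lambda2 G = 1 / (\<Sum>j<R. real D ^ j) \<longleftrightarrow> (\<exists>x\<in>V. two_full_branches D R x)"
  proof
    assume "steklov_lambda2 G = 1 / (\<Sum>j<R. real D ^ j)"
    then have "steklov_eigenvalue G (1 / (\<Sum>j<R. real D ^ j))" using steklov_lambda2_eigenvalue by simp
    then show "\<exists>x\<in>V. two_full_branches D R x"
      using extremal_two_full_branches[OF B.balanced_tree_axioms] x(1) by blast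
  next
    assume "\<exists>x\<in>V. two_full_branches D R x"
    then have "steklov_eigenvalue G (1 / (\<Sum>j<R. real D ^ j))"
      using eigenvalue_of_two_full_branches[OF assms(1,2)] by blast
    then have "steklov_lambda2 G \<le> 1 / (\<Sum>j<R. real D ^ j)"
      using B.M_pos M by (intro steklov_lambda2_le) auto
    then show "steklov_lambda2 G = 1 / (\<Sum>j<R. real D ^ j)" using ge by simp
  qed
qed

theorem lambda2_odd_diameter:
  assumes "1 \<le> D" "0 < R" "\<forall>v\<in>V. graph_degree G v \<le> D + 1" "graph_diameter G \<le> 2 * R + 1"
  defines "m \<equiv> real D ^ R / 2 + (\<Sum>j<R. real D ^ j)"
  shows "1 / m \<le> steklov_lambda2 G"
    and "steklov_lambda2 G = 1 / m \<longleftrightarrow> (\<exists>z w. gadj G z w \<and> full_at_edge D R z w)"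
proof -
  \<comment> \<open>If one vertex reaches everything within \<open>R\<close>, any edge at it can
    serve as the central edge.\<close>
  have "\<exists>z w. gadj G z w \<and> (\<forall>v\<in>V. graph_dist G z v \<le> R \<or> graph_dist G w v \<le> R)"
    using ex_center[OF assms(4), of R] ex_neighbour by (meson order_refl)
  then obtain z w where zw: "gadj G z w" "\<forall>v\<in>V. graph_dist G z v \<le> R \<or> graph_dist G w v \<le> R"
    by blast
  interpret B: balanced_tree G "{z, w}" D R "real D ^ R / 2"
    using balanced_at_edge[OF assms(1-3) zw] .
  have M: "B.M = m" by (simp add: B.M_def m_def)
  show ge: "1 / m \<le> steklov_lambda2 G" using B.lambda2_ge M by simp
  show "steklov_lambda2 G = 1 / m \<longleftrightarrow> (\<exists>z w. gadj G z w \<and> full_at_edge D R z w)"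
  proof
    assume "steklov_lambda2 G = 1 / m"
    then have "steklov_eigenvalue G (1 / m)" using steklov_lambda2_eigenvalue by simp
    then show "\<exists>z w. gadj G z w \<and> full_at_edge D R z w"
      using extremal_full_at_edge[OF B.balanced_tree_axioms _ zw(1)] zw(1) unfolding m_def by blast
  next
    assume "\<exists>z w. gadj G z w \<and> full_at_edge D R z w"
    then have "steklov_eigenvalue G (1 / m)"
      using eigenvalue_of_full_at_edge[OF assms(1,2)] unfolding m_def by blast
    then have "steklov_lambda2 G \<le> 1 / m"
      using B.M_pos M by (intro steklov_lambda2_le) auto
    then show "steklov_lambda2 G = 1 / m" using ge by simp
  qed
qed

end

section \<open>Embeddings of the regular tree\<close>

context rooted_tree
begin

lemma card_children:
  assumes "v \<in> gverts G" "v \<notin> Z \<or> card Z = 2" "graph_degree G v = Suc n"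
  shows "finite (children v)" "card (children v) = n"
proof -
  obtain u where u: "{u. gadj G v u} = insert u (children v)" "u \<notin> children v"
    using neighbours_upward[OF assms(1,2)] .
  have "finite {u. gadj G v u}" using assms(3) unfolding graph_degree_def by (metis card.infinite nat.distinct(1))
  then show fin: "finite (children v)" unfolding u(1) by simp
  show "card (children v) = n" using assms(3) u(2) fin unfolding graph_degree_def u(1) by simp
qed

lemma vertex_in_root_branch:
  assumes "v \<in> gverts G"
  shows "\<exists>z\<in>Z. v \<in> descendants z (level v)"
proof -
  obtain z where "z \<in> ancestors v" "level z = 0" using ex_ancestor_level[OF assms, of 0] by auto
  then show ?thesis
    using ancestors_imp_descendants[OF assms] level_eq_0 ancestors_verts[OF assms] by fastforce
qed

lemma descendants_disjoint:
  assumes "v \<in> descendants a k" "v \<in> descendants a' k'" "level a = level a'"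
  shows "a = a'"
  using ancestors_level_inj[of v a a'] assms by (auto simp: descendants_def)

lemma graph_ball_eq_level:
  assumes "Z = {x}"
  shows "graph_ball G x R = {v \<in> gverts G. level v \<le> R}"
  unfolding graph_ball_def level_eq_dist[OF assms] ..

text \<open>A step upward from a vertex of the branch stays in it, except at \<open>y\<close>, where
  it would use the deleted edge; steps downward are limited by the ball. As \<open>y\<close> has
  level 1, the generations end with \<open>R - 1\<close>.\<close>

lemma branch_of_ball_verts:
  fixes R :: nat and x y :: 'a
  defines "B \<equiv> generated_subgraph G (graph_ball G x R)"
  assumes Z: "Z = {x}" and y: "y \<in> children x" and R: "0 < R"
  shows "gverts (branch B y x) = (\<Union>k\<le>R - 1. descendants y k)"
proof -
  let ?r = "gadj (delete_edge B y x)"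
  have xV: "x \<in> gverts G" "level x = 0" using Z root_verts level_eq_0 by auto
  have yV: "y \<in> gverts G" "level y = 1" "y \<notin> Z" "parent y = x"
    using y level_children[OF y] xV by (auto simp: children_iff)
  have r: "?r u v \<longleftrightarrow> gadj G u v \<and> level u \<le> R \<and> level v \<le> R \<and> {u, v} \<noteq> {y, x}" for u v
    using adj_verts[of u v]
    by (auto simp: B_def delete_edge_def generated_subgraph_def graph_ball_eq_level[OF Z])
  have B: "gverts B = {v \<in> gverts G. level v \<le> R}"
    by (auto simp: B_def generated_subgraph_def graph_ball_eq_level[OF Z])
  have into: "\<exists>k\<le>R - 1. v \<in> descendants y k" if "?r\<^sup>*\<^sup>* y v" for v
    using that
  proof induction
    case base
    show ?case using descendants_0[OF yV(1)] by auto
  next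
    case (step u v)
    then obtain k where k: "k \<le> R - 1" "u \<in> descendants y k" by blast
    have uv: "gadj G u v" "level v \<le> R" "{u, v} \<noteq> {y, x}" using step.hyps(2) r by auto
    from uv(1) show ?case
    proof (cases rule: adj_cases)
      case 1
      then show ?thesis using Z by simp
    next
      case 2
      then have "v \<in> descendants y (Suc k)" using k adj_verts[OF uv(1)] by (simp add: descendants_Suc)
      moreover from this have "level v = Suc (Suc k)" using yV by (simp add: descendants_def)
      ultimately show ?thesis using uv(2) by (intro exI[of _ "Suc k"]) auto
    next
      case 3
      show ?thesis
      proof (cases k)
        case 0
        then show ?thesis using k descendants_0[OF yV(1)] 3 uv(3) yV(4) by auto
      next
        case (Suc k')
        then show ?thesis using k 3 by (intro exI[of _ k']) (auto simp: descendants_Suc)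
      qed
    qed
  qed
  have onto: "v \<in> descendants y k \<Longrightarrow> k \<le> R - 1 \<Longrightarrow> ?r\<^sup>*\<^sup>* y v" for v k
  proof (induction k arbitrary: v)
    case 0
    then show ?case using descendants_0[OF yV(1)] by simp
  next
    case (Suc k)
    then have v: "v \<in> gverts G" "v \<notin> Z" "parent v \<in> descendants y k" by (auto simp: descendants_Suc)
    have "level v = Suc (Suc k)" using Suc.prems yV by (simp add: descendants_def)
    then have "?r (parent v) v"
      using Suc.prems adj_sym[OF adj_parent[OF v(1,2)]] level_parent[OF v(1,2)] xV yV
      by (auto simp: r doubleton_eq_iff)
    then show ?case using Suc.IH[OF v(3)] Suc.prems by simp
  qed
  have "level v \<le> R" "v \<in> gverts G" if "v \<in> descendants y k" "k \<le> R - 1" for v k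
    using that R yV by (auto simp: descendants_def)
  moreover have "gverts (delete_edge B y x) = gverts B" by (simp add: delete_edge_def)
  ultimately show ?thesis
    using into onto B by (auto simp: branch_def generated_subgraph_def) blast+
qed

lemma rooted_branch_of_ball:
  fixes R :: nat and x y :: 'a
  defines "H \<equiv> rooted_branch (generated_subgraph G (graph_ball G x R)) y x"
  assumes Z: "Z = {x}" and y: "y \<in> children x" and R: "0 < R"
  shows "gverts H = insert x (\<Union>k\<le>R - 1. descendants y k)"
    and "gadj H u v \<longleftrightarrow> gadj G u v \<and> u \<in> gverts H \<and> v \<in> gverts H"
proof -
  have xV: "x \<in> gverts G" "level x = 0" using Z root_verts level_eq_0 by auto
  have "level y = 1" using level_children[OF y] xV by simp
  then have "level v \<le> R" "v \<in> gverts G" if "v \<in> descendants y k" "k \<le> R - 1" for v k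
    using that R by (auto simp: descendants_def)
  then show "gverts H = insert x (\<Union>k\<le>R - 1. descendants y k)"
    unfolding H_def rooted_branch_def branch_of_ball_verts[OF Z y R] using xV
    by (auto simp: generated_subgraph_def graph_ball_eq_level[OF Z])
  show "gadj H u v \<longleftrightarrow> gadj G u v \<and> u \<in> gverts H \<and> v \<in> gverts H"
    unfolding H_def rooted_branch_def using adj_verts by (auto simp: generated_subgraph_def)
qed

end

text \<open>The regular tree occurs both as the source and as the target of a map, so the two trees
  are treated alike and may be infinite.\<close>

locale two_rooted_trees = H: rooted_tree H Y + G: rooted_tree G Z
  for H :: "'a sgraph" and Y and G :: "'b sgraph" and Z
begin

text \<open>\<open>A\<close> is the part of the source on which the map matters. It is closed under
  parents and contains the roots, so inductions on the level stay inside it.\<close>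

context
  fixes A :: "'a set" and \<phi> :: "'a \<Rightarrow> 'b"
  assumes A: "A \<subseteq> gverts H" and A_parent: "\<And>v. v \<in> A \<Longrightarrow> v \<notin> Y \<Longrightarrow> H.parent v \<in> A"
    and A_roots: "Y \<subseteq> A" and inj: "inj_on \<phi> A" and roots: "\<phi> ` Y = Z"
    and adj: "\<And>v. v \<in> A \<Longrightarrow> v \<notin> Y \<Longrightarrow> gadj G (\<phi> v) (\<phi> (H.parent v))"
begin

lemma embedding_root_iff: "v \<in> A \<Longrightarrow> \<phi> v \<in> Z \<longleftrightarrow> v \<in> Y"
  using inj_on_image_mem_iff[OF inj _ A_roots] roots by blast

text \<open>The image of a path leading away from the root cannot turn back, by injectivity.\<close>

lemma embedding_level_parent:
  assumes "v \<in> A"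
  shows "G.level (\<phi> v) = H.level v \<and> (v \<notin> Y \<longrightarrow> G.parent (\<phi> v) = \<phi> (H.parent v))"
proof -
  have "v \<in> gverts H" using assms A by blast
  then show ?thesis using assms
  proof (induction rule: H.level_induct)
    case (root v)
    then have "\<phi> v \<in> Z" using roots by blast
    then have "G.level (\<phi> v) = 0" using G.root_verts G.level_eq_0 by blast
    moreover have "H.level v = 0" using root H.root_verts H.level_eq_0 by blast
    ultimately show ?case using root by simp
  next
    case (step v)
    let ?p = "H.parent v"
    have p: "?p \<in> A" using A_parent step by blast
    have notZ: "\<phi> v \<notin> Z" using embedding_root_iff step by blast
    have a: "gadj G (\<phi> v) (\<phi> ?p)" using adj step by blast
    from a have "G.parent (\<phi> v) = \<phi> ?p"
    proof (cases rule: G.adj_cases)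
      case 2
      then have "?p \<notin> Y" using embedding_root_iff p by blast
      then have "\<phi> v = \<phi> (H.parent ?p)" using step.IH[OF p] 2 by simp
      then have "v = H.parent ?p" using inj A_parent[OF p \<open>?p \<notin> Y\<close>] step.prems by (meson inj_onD)
      moreover have "H.level v = Suc (H.level ?p)" "H.level ?p = Suc (H.level (H.parent ?p))"
        using H.level_parent step.hyps \<open>?p \<notin> Y\<close> p A by blast+
      ultimately show ?thesis by simp
    qed (use notZ in auto)
    then show ?case
      using step.IH[OF p] G.level_parent[OF G.adj_verts(1)[OF a] notZ] H.level_parent[OF step.hyps] by simp
  qed
qed

lemma embedding_descendants:
  assumes "a \<in> A" "v \<in> A" "v \<in> H.descendants a k"
  shows "\<phi> v \<in> G.descendants (\<phi> a) k"
  using assms(2,3)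
proof (induction k arbitrary: v)
  case 0
  have aV: "a \<in> gverts H" using A assms(1) by blast
  have "\<phi> a \<in> gverts G"
  proof (cases "a \<in> Y")
    case True
    then show ?thesis using roots G.root_verts by blast
  qed (use adj[OF assms(1)] G.adj_verts in blast)
  then show ?case using 0 H.descendants_0[OF aV] G.descendants_0 by auto
next
  case (Suc k)
  then have v: "v \<in> gverts H" "v \<notin> Y" "H.parent v \<in> H.descendants a k"
    by (auto simp: H.descendants_Suc)
  then have "\<phi> (H.parent v) \<in> G.descendants (\<phi> a) k" using Suc A_parent by blast
  then show ?case
    using embedding_level_parent[OF Suc.prems(1)] embedding_root_iff[OF Suc.prems(1)] v
      G.adj_verts(1)[OF adj[OF Suc.prems(1)]] by (simp add: G.descendants_Suc)
qed

lemma embedding_children: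
  "v \<in> A \<Longrightarrow> v \<notin> Y \<Longrightarrow> \<phi> v \<in> G.children (\<phi> (H.parent v))"
  using embedding_level_parent[of v] embedding_root_iff[of v] adj[of v] G.adj_verts(1)
  by (auto simp: G.children_iff)

text \<open>Injectivity gives an image vertex at least \<open>D\<close> children and the degree
  bound at most \<open>D\<close>, so its children are exactly the images of children, generation
  after generation.\<close>

lemma embedding_onto_branch:
  assumes a: "a \<in> A" and sub: "\<And>k. k \<le> n \<Longrightarrow> H.descendants a k \<subseteq> A"
    and card_H: "\<And>k v. k < n \<Longrightarrow> v \<in> H.descendants a k \<Longrightarrow> card (H.children v) = D"
    and card_G: "\<And>k g. g \<in> G.descendants (\<phi> a) k \<Longrightarrow> finite (G.children g) \<and> card (G.children g) \<le> D"
  shows "k \<le> n \<Longrightarrow> G.descendants (\<phi> a) k = \<phi> ` H.descendants a k"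
    and "k < n \<Longrightarrow> g \<in> G.descendants (\<phi> a) k \<Longrightarrow> card (G.children g) = D"
proof -
  have children: "G.children (\<phi> v) = \<phi> ` H.children v" "card (G.children (\<phi> v)) = D"
    if k: "k < n" and v: "v \<in> H.descendants a k" for k v
  proof -
    have ch: "H.children v \<subseteq> A" using sub[of "Suc k"] k v by (auto simp: H.descendants_Suc_children)
    have "\<phi> u \<in> G.children (\<phi> v)" if "u \<in> H.children v" for u
      using embedding_children[of u] ch that by (auto simp: H.children_iff)
    then have "\<phi> ` H.children v \<subseteq> G.children (\<phi> v)" by blast
    moreover have "card (\<phi> ` H.children v) = D"
      using card_H[OF k v] card_image[OF inj_on_subset[OF inj ch]] by simp
    moreover have "\<phi> v \<in> G.descendants (\<phi> a) k"
      using embedding_descendants[OF a _ v] sub[of k] k v by auto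
    ultimately show "G.children (\<phi> v) = \<phi> ` H.children v" "card (G.children (\<phi> v)) = D"
      using card_G[of "\<phi> v" k] card_mono[of "G.children (\<phi> v)" "\<phi> ` H.children v"]
        card_seteq[of "G.children (\<phi> v)" "\<phi> ` H.children v"] by auto
  qed
  have onto: "k \<le> n \<Longrightarrow> G.descendants (\<phi> a) k = \<phi> ` H.descendants a k" for k
  proof (induction k)
    case 0
    have "a \<in> H.descendants a 0" using H.descendants_0 A a by blast
    then have "\<phi> a \<in> gverts G"
      using embedding_descendants[OF a a] by (auto simp: G.descendants_def)
    then show ?case using H.descendants_0 G.descendants_0 A a by auto
  next
    case (Suc k)
    then show ?case
      using children(1)[of k] by (simp add: G.descendants_Suc_children H.descendants_Suc_children image_UN)
  qed
  then show "k \<le> n \<Longrightarrow> G.descendants (\<phi> a) k = \<phi> ` H.descendants a k" .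
  show "k < n \<Longrightarrow> g \<in> G.descendants (\<phi> a) k \<Longrightarrow> card (G.children g) = D"
    using onto[of k] children(2)[of k] by auto
qed

text \<open>An edge between images joins two roots or a vertex with its parent; compatibility with
  parents and injectivity pull it back.\<close>

lemma embedding_adj_iff:
  assumes parent: "\<And>v. v \<in> A \<Longrightarrow> v \<notin> Y \<Longrightarrow> G.parent (\<phi> v) = \<phi> (H.parent v)"
    and uv: "u \<in> A" "v \<in> A"
  shows "gadj H u v \<longleftrightarrow> gadj G (\<phi> u) (\<phi> v)"
proof
  assume "gadj H u v"
  then show "gadj G (\<phi> u) (\<phi> v)"
  proof (cases rule: H.adj_cases)
    case 1
    then show ?thesis using G.root_clique[of "\<phi> u" "\<phi> v"] roots inj uv by (metis imageI inj_onD)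
  next
    case 2
    then show ?thesis using adj[of v] uv G.adj_sym by blast
  next
    case 3
    then show ?thesis using adj[of u] uv by blast
  qed
next
  have up: "gadj H a b" if "a \<in> A" "b \<in> A" "\<phi> b \<notin> Z" "G.parent (\<phi> b) = \<phi> a" for a b
  proof -
    have b: "b \<notin> Y" using embedding_root_iff that by blast
    then have "H.parent b = a"
      using parent[OF that(2) b] that A_parent[OF that(2) b] inj by (metis inj_onD)
    then show ?thesis using H.adj_sym H.adj_parent[of b] A that(2) b by blast
  qed
  assume "gadj G (\<phi> u) (\<phi> v)"
  then show "gadj H u v"
  proof (cases rule: G.adj_cases)
    case 1
    then show ?thesis using embedding_root_iff uv H.root_clique[of u v] by blast
  next
    case 2
    then show ?thesis using up uv by blast
  next
    case 3
    then show ?thesis using up[of v u] uv H.adj_sym by blast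
  qed
qed

end

text \<open>A map defined up to generation \<open>n\<close> is extended by arbitrary bijections
  between the children of corresponding vertices, which exist since both have \<open>D\<close> of
  them.\<close>

lemma ex_branch_isomorphism:
  assumes a: "a \<in> gverts H" and g: "g \<in> gverts G"
    and card_H: "\<And>k v. k < n \<Longrightarrow> v \<in> H.descendants a k \<Longrightarrow> card (H.children v) = D"
    and card_G: "\<And>k v. k < n \<Longrightarrow> v \<in> G.descendants g k \<Longrightarrow> card (G.children v) = D"
    and D: "1 \<le> D"
  shows "\<exists>\<phi>. (\<forall>k\<le>n. bij_betw \<phi> (H.descendants a k) (G.descendants g k)) \<and>
    (\<forall>k<n. \<forall>v\<in>H.descendants a (Suc k). G.parent (\<phi> v) = \<phi> (H.parent v))"
  using card_H card_G
proof (induction n)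
  case 0
  have "bij_betw (\<lambda>_. g) (H.descendants a 0) (G.descendants g 0)"
    by (simp add: H.descendants_0[OF a] G.descendants_0[OF g] bij_betw_def)
  then show ?case by auto
next
  case (Suc n)
  have "\<exists>\<phi>. (\<forall>k\<le>n. bij_betw \<phi> (H.descendants a k) (G.descendants g k)) \<and>
    (\<forall>k<n. \<forall>v\<in>H.descendants a (Suc k). G.parent (\<phi> v) = \<phi> (H.parent v))"
    by (rule Suc.IH) (use Suc.prems less_SucI in blast)+
  then obtain \<phi> where \<phi>: "\<And>k. k \<le> n \<Longrightarrow> bij_betw \<phi> (H.descendants a k) (G.descendants g k)"
    "\<And>k v. k < n \<Longrightarrow> v \<in> H.descendants a (Suc k) \<Longrightarrow> G.parent (\<phi> v) = \<phi> (H.parent v)"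
    by blast
  have "\<exists>j. bij_betw j (H.children v) (G.children (\<phi> v))" if v: "v \<in> H.descendants a n" for v
  proof -
    have "\<phi> v \<in> G.descendants g n" using \<phi>(1)[of n] v by (auto simp: bij_betw_def)
    then have "card (H.children v) = D" "card (G.children (\<phi> v)) = D" using Suc.prems v by auto
    \<comment> \<open>\<open>D \<ge> 1\<close> matters: an infinite set of children would have
      \<open>card\<close> 0.\<close>
    moreover from this have "finite (H.children v)" "finite (G.children (\<phi> v))"
      using D by (auto intro: card_ge_0_finite)
    ultimately show ?thesis using finite_same_card_bij by metis
  qed
  then obtain j where j: "\<And>v. v \<in> H.descendants a n \<Longrightarrow> bij_betw (j v) (H.children v) (G.children (\<phi> v))"
    by metis
  \<comment> \<open>Generations are disjoint by their levels, so redefining the map on generation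
    \<open>Suc n\<close> leaves the earlier ones intact.\<close>
  define \<psi> where "\<psi> v = (if v \<in> H.descendants a (Suc n) then j (H.parent v) v else \<phi> v)" for v
  have old: "\<psi> v = \<phi> v" if "v \<in> H.descendants a k" "k \<le> n" for v k
    using that by (auto simp: \<psi>_def H.descendants_def)
  have new: "\<psi> v \<in> G.children (\<phi> (H.parent v))" "H.parent v \<in> H.descendants a n"
    if "v \<in> H.descendants a (Suc n)" for v
  proof -
    from that show p: "H.parent v \<in> H.descendants a n" by (simp add: H.descendants_Suc)
    have "v \<in> H.children (H.parent v)" using that by (auto simp: H.descendants_Suc H.children_iff)
    then show "\<psi> v \<in> G.children (\<phi> (H.parent v))" using j[OF p] that by (auto simp: \<psi>_def bij_betw_def)
  qed
  then have new_parent: "G.parent (\<psi> v) = \<phi> (H.parent v)" if "v \<in> H.descendants a (Suc n)" for v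
    using that by (auto simp: G.children_iff)
  have "bij_betw \<psi> (H.descendants a (Suc n)) (G.descendants g (Suc n))"
  proof (rule bij_betw_imageI)
    show "inj_on \<psi> (H.descendants a (Suc n))"
    proof (rule inj_onI)
      fix u v assume uv: "u \<in> H.descendants a (Suc n)" "v \<in> H.descendants a (Suc n)" "\<psi> u = \<psi> v"
      then have "\<phi> (H.parent u) = \<phi> (H.parent v)" using new_parent by metis
      moreover have "inj_on \<phi> (H.descendants a n)" using \<phi>(1)[of n] by (simp add: bij_betw_def)
      ultimately have p: "H.parent u = H.parent v"
        using new(2)[OF uv(1)] new(2)[OF uv(2)] by (meson inj_onD)
      have "u \<in> H.children (H.parent v)" "v \<in> H.children (H.parent v)"
        using uv p by (auto simp: H.descendants_Suc H.children_iff)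
      moreover have "j (H.parent v) u = j (H.parent v) v" using uv p by (simp add: \<psi>_def)
      moreover have "inj_on (j (H.parent v)) (H.children (H.parent v))"
        using j[OF new(2)[OF uv(2)]] by (simp add: bij_betw_def)
      ultimately show "u = v" by (meson inj_onD)
    qed
    show "\<psi> ` H.descendants a (Suc n) = G.descendants g (Suc n)"
    proof
      show "\<psi> ` H.descendants a (Suc n) \<subseteq> G.descendants g (Suc n)"
        unfolding G.descendants_Suc_children using new \<phi>(1)[of n] by (blast dest: bij_betwE)
      show "G.descendants g (Suc n) \<subseteq> \<psi> ` H.descendants a (Suc n)"
      proof
        fix w assume "w \<in> G.descendants g (Suc n)"
        then obtain v' where v': "v' \<in> G.descendants g n" "w \<in> G.children v'"
          by (auto simp: G.descendants_Suc_children)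
        have "v' \<in> \<phi> ` H.descendants a n"
          using v'(1) bij_betw_imp_surj_on[OF \<phi>(1)[OF order_refl]] by simp
        then obtain v where "v' = \<phi> v" and vn: "v \<in> H.descendants a n" by (rule imageE)
        then have v: "v \<in> H.descendants a n" "w \<in> G.children (\<phi> v)" using v'(2) by simp_all
        have "w \<in> j v ` H.children v" using v(2) bij_betw_imp_surj_on[OF j[OF vn]] by simp
        then obtain u where u: "w = j v u" "u \<in> H.children v" by (rule imageE)
        then have "u \<in> H.descendants a (Suc n)" using v by (auto simp: H.descendants_Suc_children)
        moreover have "\<psi> u = w" using u calculation by (simp add: \<psi>_def H.children_iff)
        ultimately show "w \<in> \<psi> ` H.descendants a (Suc n)" by blast
      qed
    qed
  qed
  moreover have "bij_betw \<psi> (H.descendants a k) (G.descendants g k)" if "k \<le> n" for k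
    using \<phi>(1)[OF that] old[OF _ that] bij_betw_cong by metis
  moreover have "G.parent (\<psi> v) = \<psi> (H.parent v)" if k: "k < Suc n" and v: "v \<in> H.descendants a (Suc k)" for k v
  proof -
    have p: "H.parent v \<in> H.descendants a k" using v by (simp add: H.descendants_Suc)
    show ?thesis
    proof (cases "k = n")
      case True
      then show ?thesis using new_parent v old[OF p] by simp
    next
      case False
      then show ?thesis using \<phi>(2)[of k v] v old[OF p] old[OF v] k by simp
    qed
  qed
  ultimately show ?case by (metis le_SucE)
qed

end

context rooted_tree
begin

lemma full_branch_card:
  "full_branch D y n \<Longrightarrow> k < n \<Longrightarrow> u \<in> descendants y k \<Longrightarrow> card (children u) = D"
  unfolding full_branch_def by (metis less_imp_le)

text \<open>Supplies vertices at full depth, the partners in the diameter argument for embedded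
  doubled branches.\<close>

lemma regular_descendants_nonempty:
  assumes "a \<in> gverts G" "1 \<le> D"
    and "\<And>v. v \<in> gverts G \<Longrightarrow> v \<notin> Z \<or> card Z = 2 \<Longrightarrow> card (children v) = D"
    and "a \<notin> Z \<or> card Z = 2"
  shows "descendants a k \<noteq> {}"
proof (induction k)
  case 0
  then show ?case using descendants_0[OF assms(1)] by simp
next
  case (Suc k)
  then obtain v where v: "v \<in> descendants a k" by blast
  have "v \<notin> Z \<or> card Z = 2"
  proof (cases "v \<in> Z")
    case True
    then have "v = a" using v by (simp add: descendants_def ancestors_root)
    then show ?thesis using assms(4) by simp
  qed simp
  then have "card (children v) = D" using v assms(3) by (simp add: descendants_def)
  then have "children v \<noteq> {}" using assms(2) by auto
  then show ?case using v by (auto simp: descendants_Suc_children)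
qed

end

lemma regular_tree_card_children:
  assumes "rooted_tree (regular_tree (Suc D)) Z"
    and "v \<in> gverts (regular_tree (Suc D))" "v \<notin> Z \<or> card Z = 2"
  shows "card (rooted_tree.children (regular_tree (Suc D)) Z v) = D"
  using rooted_tree.card_children(2)[OF assms] graph_degree_regular_tree[OF assms(2)] by simp

lemma doubled_graph_verts: "gverts (doubled_graph H x) = double_proj x ` (gverts H \<times> UNIV)"
  by (simp add: doubled_graph_def)

lemma doubled_graph_adj:
  "gadj (doubled_graph H x) p q \<longleftrightarrow>
    (\<exists>u v c. gadj H u v \<and> p = double_proj x (u, c) \<and> q = double_proj x (v, c))"
  by (simp add: doubled_graph_def)

section \<open>Full branches and subgraphs of the regular tree\<close>

context finite_tree
begin

lemma children_card_le:
  assumes "rooted_tree G Z" "\<forall>v\<in>V. graph_degree G v \<le> D + 1"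
    and "v \<in> V" "v \<notin> Z \<or> card Z = 2"
  shows "finite (rooted_tree.children G Z v) \<and> card (rooted_tree.children G Z v) \<le> D"
proof -
  interpret finite_rooted_tree G Z
    using assms(1) finite_tree_axioms by (simp add: finite_rooted_tree_def)
  show ?thesis using finite_children degree_upward[OF assms(3,4)] bspec[OF assms(2,3)] by simp
qed

text \<open>\<open>H\<close> is \<open>x\<close> together with a complete \<open>D\<close>-ary
  branch at \<open>y\<close>. Its two copies go to the two full branches of \<open>G\<close>, and
  both copies of \<open>x\<close> go to \<open>x0\<close>.\<close>

lemma contains_doubled_if_two_full_branches:
  assumes D: "1 \<le> D" and R: "0 < R" and x0: "x0 \<in> V" and full: "two_full_branches D R x0"
    and yx: "gadj (regular_tree (Suc D)) y x"
  defines "H \<equiv> rooted_branch (generated_subgraph (regular_tree (Suc D))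
      (graph_ball (regular_tree (Suc D)) x R)) y x"
  shows "contains_subgraph G (doubled_graph H x)"
proof -
  let ?T = "regular_tree (Suc D)"
  have xy: "x \<in> gverts ?T" "y \<in> gverts ?T" "y \<noteq> x"
    using tree_graph_verts[OF tree_graph_regular_tree yx] tree_graph_irrefl[OF tree_graph_regular_tree yx]
    by simp_all
  interpret two_rooted_trees ?T "{x}" G "{x0}"
    using rooted_tree_vertex[OF tree_graph_regular_tree xy(1)] rooted[OF x0]
    by (simp add: two_rooted_trees_def)
  have lx: "H.level x = 0" using H.level_eq_0 xy by simp
  have "y \<in> {u. gadj ?T x u}" using H.adj_sym[OF yx] by blast
  then have y_child: "y \<in> H.children x" unfolding H.neighbours_root(1)[OF singletonI] by blast
  obtain y1 y2 where y12: "y1 \<noteq> y2" "y1 \<in> G.children x0" "y2 \<in> G.children x0"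
    "G.full_branch D y1 (R - 1)" "G.full_branch D y2 (R - 1)"
    using full by (auto simp: two_full_branches_def)
  define g where "g c = (if c then y2 else y1)" for c
  have g: "g c \<in> G.children x0" "g c \<in> V" "G.level (g c) = 1" "G.full_branch D (g c) (R - 1)" for c
    using y12 G.level_children[of _ x0] G.level_eq_0[OF x0] by (auto simp: g_def G.children_iff)
  have "\<exists>\<phi>. (\<forall>k\<le>R - 1. bij_betw \<phi> (H.descendants y k) (G.descendants (g c) k)) \<and>
    (\<forall>k<R - 1. \<forall>v\<in>H.descendants y (Suc k). G.parent (\<phi> v) = \<phi> (H.parent v))" for c
  proof (rule ex_branch_isomorphism[OF xy(2) g(2) _ _ D])
    fix k assume k: "k < R - 1"
    show "card (G.children v) = D" if "v \<in> G.descendants (g c) k" for v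
      by (rule G.full_branch_card[OF g(4) k that])
    show "card (H.children v) = D" if v: "v \<in> H.descendants y k" for v
    proof (rule regular_tree_card_children[OF H.rooted_tree_axioms])
      have "H.level v = Suc k" using v H.level_children[OF y_child] lx by (simp add: H.descendants_def)
      then show "v \<notin> {x} \<or> card {x} = 2" using lx by auto
      show "v \<in> gverts ?T" using v by (simp add: H.descendants_def)
    qed
  qed
  then obtain \<phi> where \<phi>: "\<And>c k. k \<le> R - 1 \<Longrightarrow> bij_betw (\<phi> c) (H.descendants y k) (G.descendants (g c) k)"
    "\<And>c k v. k < R - 1 \<Longrightarrow> v \<in> H.descendants y (Suc k) \<Longrightarrow> G.parent (\<phi> c v) = \<phi> c (H.parent v)"
    by metis
  define \<psi> where "\<psi> c u = (if u = x then x0 else \<phi> c u)" for c u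
  define A where "A = insert x (\<Union>k\<le>R - 1. H.descendants y k)"
  have H_verts: "gverts H = A"
    unfolding H_def A_def by (rule H.rooted_branch_of_ball(1)[OF refl y_child R])
  have H_adj: "gadj H u v \<Longrightarrow> gadj ?T u v \<and> u \<in> A \<and> v \<in> A" for u v
    using H.rooted_branch_of_ball(2)[OF refl y_child R, of u v] H_verts unfolding H_def by simp
  have desc: "v \<noteq> x" "H.level v = Suc k" if "v \<in> H.descendants y k" for v k
    using that lx H.level_children[OF y_child] by (auto simp: H.descendants_def)
  have image: "\<psi> c v \<in> G.descendants (g c) k" if "v \<in> H.descendants y k" "k \<le> R - 1" for c v k
    using \<phi>(1)[OF that(2), of c] that(1) desc(1)[OF that(1)] by (auto simp: \<psi>_def bij_betw_def)
  have image_ne: "\<psi> c v \<noteq> x0" if "v \<in> H.descendants y k" "k \<le> R - 1" for c v k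
    using image[OF that, of c] g(3)[of c] G.level_eq_0[OF x0] by (auto simp: G.descendants_def)
  have up: "gadj G (\<psi> c v) (\<psi> c (H.parent v))" if v: "v \<in> A" "v \<noteq> x" for c v
  proof -
    obtain k where k: "v \<in> H.descendants y k" "k \<le> R - 1" using v by (auto simp: A_def)
    have "\<psi> c v \<in> V" "\<psi> c v \<notin> {x0}" using image[OF k] image_ne[OF k] by (auto simp: G.descendants_def)
    then have adj: "gadj G (\<psi> c v) (G.parent (\<psi> c v))" by (rule G.adj_parent)
    have "G.parent (\<psi> c v) = \<psi> c (H.parent v)"
    proof (cases k)
      case 0
      then have "v = y" using k H.descendants_0[OF xy(2)] by simp
      moreover have "\<psi> c y = g c"
        using image[of y 0 c] H.descendants_0[OF xy(2)] G.descendants_0[OF g(2)] by simp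
      ultimately show ?thesis using g(1)[of c] y_child by (simp add: G.children_iff H.children_iff \<psi>_def)
    next
      case (Suc k')
      then have "H.parent v \<in> H.descendants y k'" using k by (simp add: H.descendants_Suc)
      then have "H.parent v \<noteq> x" using desc by blast
      then show ?thesis using \<phi>(2)[of k' v c] k Suc v by (simp add: \<psi>_def)
    qed
    then show ?thesis using adj by simp
  qed
  have adj: "gadj G (\<psi> c u) (\<psi> c v)" if "gadj H u v" for c u v
  proof -
    have uv: "gadj ?T u v" "u \<in> A" "v \<in> A" using H_adj[OF that] by auto
    from uv(1) show ?thesis
      by (cases rule: H.adj_cases) (use up uv G.adj_sym in auto)
  qed
  \<comment> \<open>The ancestor of level 1 of an image tells the copy, and the level of the image
    tells the generation.\<close>
  have sep: "u = v \<and> c = d" if uv: "u \<in> A" "v \<in> A" "u \<noteq> x" "v \<noteq> x" "\<psi> c u = \<psi> d v" for u v c d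
  proof -
    obtain k l where kl: "u \<in> H.descendants y k" "k \<le> R - 1" "v \<in> H.descendants y l" "l \<le> R - 1"
      using uv by (auto simp: A_def)
    have im: "\<psi> c u \<in> G.descendants (g c) k" "\<psi> c u \<in> G.descendants (g d) l"
      using image[OF kl(1,2), of c] image[OF kl(3,4), of d] uv(5) by auto
    then have "g c = g d" using G.descendants_disjoint g(3) by metis
    then have "c = d" using y12(1) by (auto simp: g_def split: if_splits)
    moreover have "k = l" using im g(3) by (auto simp: G.descendants_def)
    moreover have "inj_on (\<phi> c) (H.descendants y k)" using \<phi>(1)[OF kl(2)] by (simp add: bij_betw_def)
    ultimately show ?thesis using uv kl by (auto simp: \<psi>_def dest: inj_onD)
  qed
  \<comment> \<open>As \<open>\<psi> c x = x0\<close> for both values of \<open>c\<close>, this is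
    compatible with the identification made by \<open>double_proj\<close>.\<close>
  define \<Phi> where "\<Phi> p = \<psi> (snd p) (fst p)" for p
  have proj: "\<Phi> (double_proj x (u, c)) = \<psi> c u" for u c by (simp add: \<Phi>_def double_proj_def \<psi>_def)
  have ne: "\<psi> c v \<noteq> x0" if "v \<in> A" "v \<noteq> x" for c v using that image_ne by (auto simp: A_def)
  show ?thesis
    unfolding contains_subgraph_def
  proof (intro exI[of _ \<Phi>] conjI ballI impI)
    show "inj_on \<Phi> (gverts (doubled_graph H x))"
    proof (rule inj_onI)
      fix p q assume "p \<in> gverts (doubled_graph H x)" "q \<in> gverts (doubled_graph H x)" "\<Phi> p = \<Phi> q"
      then obtain u c v d where uv: "u \<in> A" "v \<in> A" "p = double_proj x (u, c)" "q = double_proj x (v, d)"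
        "\<psi> c u = \<psi> d v"
        using proj by (auto simp: doubled_graph_verts H_verts)
      show "p = q"
      proof (cases "u = x \<or> v = x")
        case True
        then have "u = x \<and> v = x" using ne uv by (metis \<psi>_def)
        then show ?thesis using uv by (simp add: double_proj_def)
      next
        case False
        then show ?thesis using sep[of u v c d] uv by simp
      qed
    qed
    have "\<psi> c v \<in> V" if v: "v \<in> A" for c v
    proof (cases "v = x")
      case False
      then obtain k where "v \<in> H.descendants y k" "k \<le> R - 1" using v by (auto simp: A_def)
      from image[OF this, of c] show ?thesis by (simp add: G.descendants_def)
    qed (use x0 in \<open>simp add: \<psi>_def\<close>)
    then show "\<Phi> ` gverts (doubled_graph H x) \<subseteq> V"
      using proj by (auto simp: doubled_graph_verts H_verts)
    show "gadj G (\<Phi> p) (\<Phi> q)" if "gadj (doubled_graph H x) p q" for p q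
      using that adj proj by (auto simp: doubled_graph_adj)
  qed
qed

text \<open>The embedded copies provide at least \<open>D\<close> children before the last
  generation, the degree bound at most \<open>D\<close>. That nothing hangs below the last
  generation follows from the diameter bound, played against the other copy.\<close>

lemma two_full_branches_if_contains_doubled:
  assumes D: "1 \<le> D" and R: "0 < R" and deg: "\<forall>v\<in>V. graph_degree G v \<le> D + 1"
    and diam: "graph_diameter G \<le> 2 * R"
    and yx: "gadj (regular_tree (Suc D)) y x"
  defines "H \<equiv> rooted_branch (generated_subgraph (regular_tree (Suc D))
      (graph_ball (regular_tree (Suc D)) x R)) y x"
  assumes contains: "contains_subgraph G (doubled_graph H x)"
  shows "\<exists>x0\<in>V. two_full_branches D R x0"
proof -
  let ?T = "regular_tree (Suc D)"
  have xy: "x \<in> gverts ?T" "y \<in> gverts ?T" "y \<noteq> x"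
    using tree_graph_verts[OF tree_graph_regular_tree yx] tree_graph_irrefl[OF tree_graph_regular_tree yx]
    by simp_all
  obtain \<Phi> where \<Phi>: "inj_on \<Phi> (gverts (doubled_graph H x))" "\<Phi> ` gverts (doubled_graph H x) \<subseteq> V"
    "\<And>p q. p \<in> gverts (doubled_graph H x) \<Longrightarrow> q \<in> gverts (doubled_graph H x) \<Longrightarrow>
      gadj (doubled_graph H x) p q \<Longrightarrow> gadj G (\<Phi> p) (\<Phi> q)"
    using contains by (auto simp: contains_subgraph_def)
  define \<psi> where "\<psi> c u = \<Phi> (double_proj x (u, c))" for c u
  define x0 where "x0 = \<psi> False x"
  have \<psi>_x: "\<psi> c x = x0" for c by (simp add: x0_def \<psi>_def double_proj_def)
  interpret T: rooted_tree ?T "{x}" by (rule rooted_tree_vertex[OF tree_graph_regular_tree xy(1)])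
  have lx: "T.level x = 0" using T.level_eq_0 xy by simp
  have "y \<in> {u. gadj ?T x u}" using T.adj_sym[OF yx] by blast
  then have y_child: "y \<in> T.children x" unfolding T.neighbours_root(1)[OF singletonI] by blast
  define A where "A = insert x (\<Union>k\<le>R - 1. T.descendants y k)"
  have H_verts: "gverts H = A"
    unfolding H_def A_def by (rule T.rooted_branch_of_ball(1)[OF refl y_child R])
  have H_adj: "gadj H u v \<longleftrightarrow> gadj ?T u v \<and> u \<in> A \<and> v \<in> A" for u v
    using T.rooted_branch_of_ball(2)[OF refl y_child R, of u v] H_verts unfolding H_def by simp
  have dv: "double_proj x (u, c) \<in> gverts (doubled_graph H x)" if "u \<in> A" for u c
    using that by (auto simp: doubled_graph_verts H_verts)
  have x0: "x0 \<in> V" using dv[of x] \<Phi>(2) by (auto simp: x0_def \<psi>_def A_def)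
  have inj: "inj_on (\<psi> c) A" for c
  proof (rule inj_onI)
    fix u v assume "u \<in> A" "v \<in> A" "\<psi> c u = \<psi> c v"
    then have "double_proj x (u, c) = double_proj x (v, c)"
      using \<Phi>(1) dv unfolding \<psi>_def by (meson inj_onD)
    then show "u = v" by (auto simp: double_proj_def split: if_splits)
  qed
  have A: "A \<subseteq> gverts ?T" using xy by (auto simp: A_def T.descendants_def)
  have yT: "y \<notin> {x}" "T.parent y = x" using y_child by (auto simp: T.children_iff)
  have A_parent: "T.parent v \<in> A" if v: "v \<in> A" "v \<notin> {x}" for v
  proof -
    obtain k where k: "k \<le> R - 1" "v \<in> T.descendants y k" using v by (auto simp: A_def)
    show ?thesis
    proof (cases k)
      case 0
      then show ?thesis using k T.descendants_0[OF xy(2)] yT by (simp add: A_def)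
    next
      case (Suc k')
      then have "T.parent v \<in> T.descendants y k'" "k' \<le> R - 1" using k by (auto simp: T.descendants_Suc)
      then show ?thesis by (auto simp: A_def)
    qed
  qed
  have adj: "gadj G (\<psi> c v) (\<psi> c (T.parent v))" if v: "v \<in> A" "v \<notin> {x}" for c v
  proof -
    have "gadj H v (T.parent v)" using H_adj v A_parent[OF v] T.adj_parent[of v] A by auto
    then have "gadj (doubled_graph H x) (double_proj x (v, c)) (double_proj x (T.parent v, c))"
      by (auto simp: doubled_graph_adj)
    then show ?thesis using \<Phi>(3) dv v A_parent[OF v] by (simp add: \<psi>_def)
  qed
  interpret two_rooted_trees ?T "{x}" G "{x0}"
    using T.rooted_tree_axioms rooted[OF x0] by (simp add: two_rooted_trees_def)
  have roots: "\<psi> c ` {x} = {x0}" for c by (simp add: \<psi>_x)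
  have xA: "{x} \<subseteq> A" by (simp add: A_def)
  note emb = A A_parent xA inj roots adj
  have yA: "y \<in> A" using T.descendants_0[OF xy(2)] by (auto simp: A_def)
  have y_children: "\<psi> c y \<in> G.children x0" for c
    using embedding_children[of A "\<psi> c", OF emb yA yT(1)] yT(2) \<psi>_x by simp
  have lx0: "G.level x0 = 0" using G.level_eq_0 x0 by simp
  have ly: "G.level (\<psi> c y) = 1" for c using G.level_children[OF y_children] lx0 by simp
  have below: "g \<in> V" "g \<notin> {x0}" if "g \<in> G.descendants (\<psi> c y) k" for g c k
    using that ly lx0 by (auto simp: G.descendants_def)
  have cardT: "card (T.children v) = D" if "v \<in> T.descendants y k" for v k
  proof (rule regular_tree_card_children[OF T.rooted_tree_axioms])
    have "T.level v = Suc k" using that T.level_children[OF y_child] lx by (simp add: T.descendants_def)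
    then show "v \<notin> {x} \<or> card {x} = 2" using lx by auto
    show "v \<in> gverts ?T" using that by (simp add: T.descendants_def)
  qed
  have onto: "k \<le> R - 1 \<Longrightarrow> G.descendants (\<psi> c y) k = \<psi> c ` T.descendants y k"
    "k < R - 1 \<Longrightarrow> g \<in> G.descendants (\<psi> c y) k \<Longrightarrow> card (G.children g) = D" for c k g
  proof -
    have sub: "T.descendants y k \<subseteq> A" if "k \<le> R - 1" for k using that by (auto simp: A_def)
    have cardG: "finite (G.children g) \<and> card (G.children g) \<le> D"
      if "g \<in> G.descendants (\<psi> c y) k" for k g
      using children_card_le[OF rooted[OF x0] deg] below[OF that] by blast
    show "k \<le> R - 1 \<Longrightarrow> G.descendants (\<psi> c y) k = \<psi> c ` T.descendants y k"
      by (rule embedding_onto_branch(1)[of A "\<psi> c", OF emb yA sub cardT cardG])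
    show "k < R - 1 \<Longrightarrow> g \<in> G.descendants (\<psi> c y) k \<Longrightarrow> card (G.children g) = D"
      by (rule embedding_onto_branch(2)[of A "\<psi> c", OF emb yA sub cardT cardG])
  qed
  have y_ne: "\<psi> False y \<noteq> \<psi> True y"
  proof
    assume "\<psi> False y = \<psi> True y"
    then have "double_proj x (y, False) = double_proj x (y, True)"
      using \<Phi>(1) dv[OF yA] unfolding \<psi>_def by (meson inj_onD)
    then show False using xy(3) by (simp add: double_proj_def)
  qed
  have last: "G.children g = {}" if g: "g \<in> G.descendants (\<psi> c y) (R - 1)" for c g
  proof (rule ccontr)
    assume "G.children g \<noteq> {}"
    then obtain g' where g': "g' \<in> G.children g" by blast
    \<comment> \<open>The opposite branch has a vertex of level \<open>R\<close>; its distance to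
      \<open>g'\<close>, of level \<open>R + 1\<close>, would be at least
      \<open>2 * R + 1\<close>.\<close>
    have "T.descendants y (R - 1) \<noteq> {}"
      by (rule T.regular_descendants_nonempty[OF xy(2) D])
         (use regular_tree_card_children[OF T.rooted_tree_axioms] xy in auto)
    then obtain u where u: "u \<in> G.descendants (\<psi> (\<not> c) y) (R - 1)"
      using onto(1)[of "R - 1" "\<not> c"] by auto
    have g'd: "g' \<in> G.descendants (\<psi> c y) (Suc (R - 1))"
      using g g' by (auto simp: G.descendants_Suc_children)
    have "\<psi> c y \<noteq> \<psi> (\<not> c) y" using y_ne by (cases c) auto
    then have "\<psi> c y \<notin> G.ancestors u"
      using u G.ancestors_level_inj[of u "\<psi> c y" "\<psi> (\<not> c) y"] ly by (auto simp: G.descendants_def)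
    then have "G.level g' + G.level u \<le> graph_diameter G"
      using dist_across_root[OF x0 ly[of c], of g' u] g'd u by (auto simp: G.descendants_def)
    moreover have "G.level g' = Suc R" "G.level u = R"
      using g'd u ly R by (auto simp: G.descendants_def)
    ultimately show False using diam by simp
  qed
  have "G.full_branch D (\<psi> c y) (R - 1)" for c
    unfolding G.full_branch_def
  proof (intro allI impI ballI)
    fix k u assume k: "k \<le> R - 1" and u: "u \<in> G.descendants (\<psi> c y) k"
    show "card (G.children u) = (if k < R - 1 then D else 0)"
    proof (cases "k < R - 1")
      case False
      then have "k = R - 1" using k by simp
      then show ?thesis using last u by simp
    qed (use onto(2)[OF _ u] in simp)
  qed
  then have "two_full_branches D R x0"
    unfolding two_full_branches_def using y_ne y_children by blast
  then show ?thesis using x0 by blast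
qed

text \<open>Rooted at an edge, the level is the smaller of the distances to the two ends.\<close>

lemma ball_union_verts:
  assumes "tree_graph T" "gadj T z w"
  shows "gverts (generated_subgraph T (graph_ball T z R \<union> graph_ball T w R))
    = {v \<in> gverts T. rooted_tree.level T {z, w} v \<le> R}"
proof -
  interpret T: rooted_tree T "{z, w}" by (rule rooted_tree_edge[OF assms])
  have Z: "z \<in> gverts T" "w \<in> gverts T" using T.adj_verts[OF assms(2)] by auto
  have walk: "(gadj T ^^ graph_dist T u v) u v" if "u \<in> gverts T" "v \<in> gverts T" for u v
  proof -
    interpret S: rooted_tree T "{u}" by (rule rooted_tree_vertex[OF assms(1) that(1)])
    show ?thesis using S.level_walk[OF that(2)] S.level_eq_dist[OF refl, of v] by simp
  qed
  have "T.level v \<le> R \<longleftrightarrow> graph_dist T z v \<le> R \<or> graph_dist T w v \<le> R" if v: "v \<in> gverts T" for v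
  proof
    assume le: "T.level v \<le> R"
    obtain r where "r \<in> {z, w}" "(gadj T ^^ T.level v) r v" using T.level_walk[OF v] by blast
    moreover from this have "graph_dist T r v \<le> T.level v" unfolding graph_dist_def by (intro Least_le)
    ultimately show "graph_dist T z v \<le> R \<or> graph_dist T w v \<le> R" using le by auto
  next
    have "T.level v \<le> graph_dist T z v" "T.level v \<le> graph_dist T w v"
      by (rule T.level_le[OF _ walk]; use Z v in simp)+
    then show "graph_dist T z v \<le> R \<or> graph_dist T w v \<le> R \<Longrightarrow> T.level v \<le> R" by auto
  qed
  then show ?thesis by (auto simp: generated_subgraph_def graph_ball_def)
qed

lemma isomorphic_if_full_at_edge:
  assumes D: "1 \<le> D" and R: "0 < R" and zw0: "gadj G z0 w0" and full: "full_at_edge D R z0 w0"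
    and zw: "gadj (regular_tree (Suc D)) z w"
  shows "isomorphic_graphs G (generated_subgraph (regular_tree (Suc D))
    (graph_ball (regular_tree (Suc D)) z R \<union> graph_ball (regular_tree (Suc D)) w R))"
    (is "isomorphic_graphs G ?F")
proof -
  let ?T = "regular_tree (Suc D)"
  interpret G: finite_rooted_tree G "{z0, w0}" by (rule rooted_at_edge[OF zw0])
  interpret T: rooted_tree ?T "{z, w}" by (rule rooted_tree_edge[OF tree_graph_regular_tree zw])
  interpret iso: two_rooted_trees G "{z0, w0}" ?T "{z, w}"
    using G.rooted_tree_axioms T.rooted_tree_axioms by (simp add: two_rooted_trees_def)
  have V: "z0 \<in> V" "w0 \<in> V" "z0 \<noteq> w0" using G.adj_verts[OF zw0] zw0 G.adj_irrefl by auto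
  have VT: "z \<in> gverts ?T" "w \<in> gverts ?T" "z \<noteq> w" using T.adj_verts[OF zw] zw T.adj_irrefl by auto
  have lev: "G.level z0 = 0" "G.level w0 = 0" "T.level z = 0" "T.level w = 0"
    using G.level_eq_0 T.level_eq_0 V VT by auto
  define t where "t r = (if r = z0 then z else w)" for r
  have t: "t r \<in> gverts ?T" "T.level (t r) = 0" for r using VT lev by (auto simp: t_def)
  have fullr: "G.full_branch D r R" if "r \<in> {z0, w0}" for r
    using that full by (auto simp: full_at_edge_def)
  have "\<exists>\<phi>. (\<forall>k\<le>R. bij_betw \<phi> (G.descendants r k) (T.descendants (t r) k)) \<and>
    (\<forall>k<R. \<forall>v\<in>G.descendants r (Suc k). T.parent (\<phi> v) = \<phi> (G.parent v))" if r: "r \<in> {z0, w0}" for r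
  proof (rule iso.ex_branch_isomorphism[OF _ t(1) _ _ D])
    show "r \<in> V" using r V by auto
    fix k assume k: "k < R"
    show "card (G.children v) = D" if "v \<in> G.descendants r k" for v
      by (rule G.full_branch_card[OF fullr[OF r] k that])
    show "card (T.children v) = D" if "v \<in> T.descendants (t r) k" for v
      using that VT by (intro regular_tree_card_children[OF T.rooted_tree_axioms]) (auto simp: T.descendants_def)
  qed
  then obtain \<phi> where \<phi>:
    "\<And>r k. r \<in> {z0, w0} \<Longrightarrow> k \<le> R \<Longrightarrow> bij_betw (\<phi> r) (G.descendants r k) (T.descendants (t r) k)"
    "\<And>r k v. r \<in> {z0, w0} \<Longrightarrow> k < R \<Longrightarrow> v \<in> G.descendants r (Suc k) \<Longrightarrow> T.parent (\<phi> r v) = \<phi> r (G.parent v)"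
    by metis
  \<comment> \<open>Every vertex lies below exactly one root, so the isomorphisms of the two
    branches can be glued.\<close>
  define \<psi> where "\<psi> v = (if z0 \<in> G.ancestors v then \<phi> z0 v else \<phi> w0 v)" for v
  have height: "G.level v \<le> R" if v: "v \<in> V" for v
  proof -
    obtain r where r: "r \<in> {z0, w0}" "v \<in> G.descendants r (G.level v)"
      using G.vertex_in_root_branch[OF v] by blast
    then have "r \<in> G.ancestors v" "G.level r = 0" using lev by (auto simp: G.descendants_def)
    then show ?thesis using G.full_branch_level[OF fullr[OF r(1)] v] by simp
  qed
  have \<psi>: "\<psi> v = \<phi> r v" if "r \<in> {z0, w0}" "v \<in> G.descendants r k" for r v k
  proof (cases "r = z0")
    case True
    then show ?thesis using that by (simp add: \<psi>_def G.descendants_def)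
  next
    case False
    then have "z0 \<notin> G.ancestors v"
      using that lev V G.ancestors_level_inj[of v z0 w0] by (auto simp: G.descendants_def)
    then show ?thesis using that False by (auto simp: \<psi>_def)
  qed
  have image: "\<psi> v \<in> T.descendants (t r) k" if "r \<in> {z0, w0}" "v \<in> G.descendants r k" "k \<le> R" for r v k
    using \<phi>(1)[OF that(1,3)] that(2) \<psi>[OF that(1,2)] by (auto simp: bij_betw_def)
  have bij: "bij_betw \<psi> V {v \<in> gverts ?T. T.level v \<le> R}"
  proof (rule bij_betw_imageI)
    show inj: "inj_on \<psi> V"
    proof (rule inj_onI)
      fix u v assume uv: "u \<in> V" "v \<in> V" "\<psi> u = \<psi> v"
      obtain r s where rs: "r \<in> {z0, w0}" "u \<in> G.descendants r (G.level u)"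
        "s \<in> {z0, w0}" "v \<in> G.descendants s (G.level v)"
        using G.vertex_in_root_branch uv by metis
      have im: "\<psi> u \<in> T.descendants (t r) (G.level u)" "\<psi> u \<in> T.descendants (t s) (G.level v)"
        using image[OF rs(1,2) height[OF uv(1)]] image[OF rs(3,4) height[OF uv(2)]] uv(3) by auto
      then have "t r = t s" using T.descendants_disjoint t(2) by metis
      then have "r = s" using rs V(3) VT(3) by (auto simp: t_def split: if_splits)
      have "G.level u = G.level v" using im t(2) by (simp add: T.descendants_def)
      moreover have "\<phi> r u = \<phi> r v" using \<psi> rs uv(3) \<open>r = s\<close> by metis
      moreover have "inj_on (\<phi> r) (G.descendants r (G.level u))"
        using \<phi>(1)[OF rs(1) height[OF uv(1)]] by (simp add: bij_betw_def)
      ultimately show "u = v" using rs \<open>r = s\<close> by (metis inj_onD)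
    qed
    show "\<psi> ` V = {v \<in> gverts ?T. T.level v \<le> R}"
    proof (intro equalityI subsetI)
      fix g assume "g \<in> \<psi> ` V"
      then obtain v where v: "v \<in> V" "g = \<psi> v" by blast
      then obtain r where r: "r \<in> {z0, w0}" "v \<in> G.descendants r (G.level v)"
        using G.vertex_in_root_branch by metis
      then show "g \<in> {v \<in> gverts ?T. T.level v \<le> R}"
        using image[OF r height[OF v(1)]] v t(2) height[OF v(1)] by (simp add: T.descendants_def)
    next
      fix g assume g: "g \<in> {v \<in> gverts ?T. T.level v \<le> R}"
      then obtain r' where r': "r' \<in> {z, w}" "g \<in> T.descendants r' (T.level g)"
        using T.vertex_in_root_branch by blast
      have "t z0 = z" "t w0 = w" using V(3) by (simp_all add: t_def)
      then obtain r where r: "r \<in> {z0, w0}" "t r = r'" using r'(1) by blast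
      have "g \<in> \<phi> r ` G.descendants r (T.level g)"
        using bij_betw_imp_surj_on[OF \<phi>(1)[OF r(1), of "T.level g"]] r'(2) r(2) g by simp
      then obtain v where v: "g = \<phi> r v" "v \<in> G.descendants r (T.level g)" by (rule imageE)
      then have "g = \<psi> v" "v \<in> V" using \<psi>[OF r(1) v(2)] by (simp_all add: G.descendants_def)
      then show "g \<in> \<psi> ` V" by blast
    qed
  qed
  have parent: "T.parent (\<psi> v) = \<psi> (G.parent v)" if v: "v \<in> V" "v \<notin> {z0, w0}" for v
  proof -
    obtain r where r: "r \<in> {z0, w0}" "v \<in> G.descendants r (G.level v)"
      using G.vertex_in_root_branch[OF v(1)] by blast
    then have d: "v \<in> G.descendants r (Suc (G.level (G.parent v)))"
      "G.parent v \<in> G.descendants r (G.level (G.parent v))"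
      using G.level_parent[OF v] by (auto simp: G.descendants_Suc)
    moreover have "G.level (G.parent v) < R" using height[OF v(1)] G.level_parent[OF v] by simp
    ultimately show ?thesis using \<phi>(2)[OF r(1), of _ v] \<psi>[OF r(1)] by metis
  qed
  have "z0 \<in> G.descendants z0 0" "w0 \<in> G.descendants w0 0" using G.descendants_0 V by auto
  then have "\<psi> z0 \<in> T.descendants z 0" "\<psi> w0 \<in> T.descendants w 0"
    using image[of z0 z0 0] image[of w0 w0 0] V by (auto simp: t_def)
  then have roots: "\<psi> z0 = z" "\<psi> w0 = w" using T.descendants_0 VT by auto
  have root_im: "\<psi> ` {z0, w0} = {z, w}" using roots by simp
  have inj: "inj_on \<psi> V" using bij by (simp add: bij_betw_def)
  have adj: "gadj ?T (\<psi> v) (\<psi> (G.parent v))" if v: "v \<in> V" "v \<notin> {z0, w0}" for v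
  proof -
    have "\<psi> v \<in> gverts ?T" using bij v by (auto simp: bij_betw_def)
    moreover have "\<psi> v \<notin> {z, w}" using v inj roots V by (auto dest: inj_onD)
    ultimately show ?thesis using T.adj_parent parent[OF v] by metis
  qed
  have iff: "gadj G u v \<longleftrightarrow> gadj ?T (\<psi> u) (\<psi> v)" if "u \<in> V" "v \<in> V" for u v
    by (rule iso.embedding_adj_iff[of V \<psi>, OF order_refl _ _ inj root_im adj parent])
       (use G.parent_verts V that in auto)
  have F: "gverts ?F = {v \<in> gverts ?T. T.level v \<le> R}"
    by (rule ball_union_verts[OF tree_graph_regular_tree zw])
  have F_adj: "gadj ?F u v \<longleftrightarrow> gadj ?T u v" if "u \<in> gverts ?F" "v \<in> gverts ?F" for u v
    using that by (auto simp: generated_subgraph_def)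
  show ?thesis
    unfolding isomorphic_graphs_def
  proof (intro exI[of _ \<psi>] conjI ballI)
    show bijF: "bij_betw \<psi> V (gverts ?F)" using bij unfolding F .
    fix u v assume uv: "u \<in> V" "v \<in> V"
    then have "\<psi> u \<in> gverts ?F" "\<psi> v \<in> gverts ?F" using bijF by (simp_all add: bij_betw_apply)
    then show "gadj G u v = gadj ?F (\<psi> u) (\<psi> v)" unfolding iff[OF uv] by (rule F_adj[symmetric])
  qed
qed

text \<open>The inverse isomorphism is an embedding with image all of \<open>V\<close>. Surjectivity
  bounds the levels in \<open>G\<close> by \<open>R\<close>, which makes the last generation
  childless.\<close>

lemma full_at_edge_if_isomorphic:
  assumes D: "1 \<le> D" and R: "0 < R" and deg: "\<forall>v\<in>V. graph_degree G v \<le> D + 1"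
    and zw: "gadj (regular_tree (Suc D)) z w"
    and iso: "isomorphic_graphs G (generated_subgraph (regular_tree (Suc D))
      (graph_ball (regular_tree (Suc D)) z R \<union> graph_ball (regular_tree (Suc D)) w R))"
      (is "isomorphic_graphs G ?F")
  shows "\<exists>z0 w0. gadj G z0 w0 \<and> full_at_edge D R z0 w0"
proof -
  let ?T = "regular_tree (Suc D)"
  interpret T: rooted_tree ?T "{z, w}" by (rule rooted_tree_edge[OF tree_graph_regular_tree zw])
  have VT: "z \<in> gverts ?T" "w \<in> gverts ?T" "z \<noteq> w" using T.adj_verts[OF zw] zw T.adj_irrefl by auto
  have lev: "T.level z = 0" "T.level w = 0" using T.level_eq_0 VT by auto
  obtain \<phi> where \<phi>: "bij_betw \<phi> V (gverts ?F)"
    "\<And>u v. u \<in> V \<Longrightarrow> v \<in> V \<Longrightarrow> gadj G u v \<longleftrightarrow> gadj ?F (\<phi> u) (\<phi> v)"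
    using iso by (auto simp: isomorphic_graphs_def)
  define A where "A = {v \<in> gverts ?T. T.level v \<le> R}"
  have F: "gverts ?F = A" unfolding A_def by (rule ball_union_verts[OF tree_graph_regular_tree zw])
  define \<psi> where "\<psi> = inv_into V \<phi>"
  have bij: "bij_betw \<psi> A V" using bij_betw_inv_into[OF \<phi>(1)] F by (simp add: \<psi>_def)
  then have inj: "inj_on \<psi> A" and \<psi>V: "\<psi> v \<in> V" if "v \<in> A" for v
    using that by (auto simp: bij_betw_def)
  have inj: "inj_on \<psi> A" using bij by (simp add: bij_betw_def)
  have adj: "gadj G (\<psi> u) (\<psi> v)" if uv: "u \<in> A" "v \<in> A" "gadj ?T u v" for u v
  proof -
    have "\<phi> (\<psi> u) = u" "\<phi> (\<psi> v) = v"
      using bij_betw_inv_into_right[OF \<phi>(1)] uv F by (simp_all add: \<psi>_def)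
    moreover have "gadj ?F u v" using uv F by (auto simp: generated_subgraph_def)
    ultimately show ?thesis using \<phi>(2)[OF \<psi>V[OF uv(1)] \<psi>V[OF uv(2)]] by simp
  qed
  define z0 w0 where "z0 = \<psi> z" and "w0 = \<psi> w"
  have zwA: "z \<in> A" "w \<in> A" using VT lev by (auto simp: A_def)
  have zw0: "gadj G z0 w0" unfolding z0_def w0_def by (rule adj[OF zwA zw])
  interpret G: finite_rooted_tree G "{z0, w0}" by (rule rooted_at_edge[OF zw0])
  interpret two_rooted_trees ?T "{z, w}" G "{z0, w0}"
    using G.rooted_tree_axioms T.rooted_tree_axioms by (simp add: two_rooted_trees_def)
  have V0: "z0 \<in> V" "w0 \<in> V" "z0 \<noteq> w0" using G.adj_verts[OF zw0] zw0 G.adj_irrefl by auto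
  have A: "A \<subseteq> gverts ?T" "{z, w} \<subseteq> A" using zwA by (auto simp: A_def)
  have A_parent: "T.parent v \<in> A" if "v \<in> A" "v \<notin> {z, w}" for v
    using that T.parent_verts[of v] T.level_parent[of v] by (simp add: A_def)
  have adj': "gadj G (\<psi> v) (\<psi> (T.parent v))" if "v \<in> A" "v \<notin> {z, w}" for v
    using adj[OF that(1) A_parent[OF that]] T.adj_parent[of v] that by (simp add: A_def)
  have roots: "\<psi> ` {z, w} = {z0, w0}" by (simp add: z0_def w0_def)
  note emb = A(1) A_parent A(2) inj roots adj'
  have height: "G.level g \<le> R" if "g \<in> V" for g
  proof -
    have "g \<in> \<psi> ` A" using bij_betw_imp_surj_on[OF bij] that by simp
    then obtain v where "g = \<psi> v" "v \<in> A" by (rule imageE)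
    then show ?thesis using embedding_level_parent[of A \<psi>, OF emb, of v] by (simp add: A_def)
  qed
  have full: "G.full_branch D (\<psi> r) R" if r: "r \<in> {z, w}" for r
  proof -
    have rA: "r \<in> A" "T.level r = 0" using r zwA lev by auto
    have sub: "T.descendants r k \<subseteq> A" if "k \<le> R" for k
      using that rA by (auto simp: A_def T.descendants_def)
    have cardT: "card (T.children v) = D" if "v \<in> T.descendants r k" for k v
      using that VT by (intro regular_tree_card_children[OF T.rooted_tree_axioms]) (auto simp: T.descendants_def)
    have cardG: "finite (G.children g) \<and> card (G.children g) \<le> D"
      if "g \<in> G.descendants (\<psi> r) k" for k g
      using children_card_le[OF G.rooted_tree_axioms deg, of g] that V0 by (simp add: G.descendants_def)
    have "card (G.children u) = (if k < R then D else 0)"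
      if k: "k \<le> R" and u: "u \<in> G.descendants (\<psi> r) k" for k u
    proof (cases "k < R")
      case True
      then show ?thesis using embedding_onto_branch(2)[of A \<psi>, OF emb rA(1) sub cardT cardG True u] by simp
    next
      case False
      have "\<psi> r \<in> {z0, w0}" "\<psi> r \<in> V" using r V0 by (auto simp: z0_def w0_def)
      then have "G.level (\<psi> r) = 0" by (metis G.level_eq_0)
      then have "G.level u = R" using u k False by (simp add: G.descendants_def)
      then have "G.children u = {}"
        using G.level_children[of _ u] height G.children_iff[of _ u] by fastforce
      then show ?thesis using False by simp
    qed
    then show ?thesis by (auto simp: G.full_branch_def)
  qed
  then have "full_at_edge D R z0 w0"
    unfolding full_at_edge_def z0_def w0_def by simp
  then show ?thesis using zw0 by blast
qed

end

theorem theorem5p3: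
  fixes G :: "'a sgraph" and D L R :: nat
  assumes "1 \<le> D"
    and "tree_graph G" and "finite (gverts G)" and "2 \<le> card (gverts G)"
    and "graph_diameter G \<le> L"
    and "\<forall>v\<in>gverts G. graph_degree G v \<le> D + 1"
    and "0 < R"
  shows
    "(L = 2 * R \<longrightarrow>
        steklov_lambda2 G \<ge> 1 / (\<Sum>i=0..R-1. real D ^ i) \<and>
        (2 \<le> D \<longrightarrow> 1 / (\<Sum>i=0..R-1. real D ^ i) = (real D - 1) / (real D ^ R - 1)) \<and>
        (\<forall>y x. gadj (regular_tree (D + 1)) y x \<longrightarrow>
          (steklov_lambda2 G = 1 / (\<Sum>i=0..R-1. real D ^ i) \<longleftrightarrow>
           contains_subgraph G
             (doubled_graph
               (rooted_branch
                 (generated_subgraph (regular_tree (D + 1)) (graph_ball (regular_tree (D + 1)) x R))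
                 y x)
               x))))
     \<and>
     (L = 2 * R + 1 \<longrightarrow>
        steklov_lambda2 G \<ge> 2 / (2 * (\<Sum>i=0..R-1. real D ^ i) + real D ^ R) \<and>
        (2 \<le> D \<longrightarrow>
          2 / (2 * (\<Sum>i=0..R-1. real D ^ i) + real D ^ R)
            = 2 * (real D - 1) / (real D ^ (R + 1) + real D ^ R - 2)) \<and>
        (\<forall>z w. gadj (regular_tree (D + 1)) z w \<longrightarrow>
          (steklov_lambda2 G = 2 / (2 * (\<Sum>i=0..R-1. real D ^ i) + real D ^ R) \<longleftrightarrow>
           isomorphic_graphs G
             (generated_subgraph (regular_tree (D + 1))
               (graph_ball (regular_tree (D + 1)) z R \<union> graph_ball (regular_tree (D + 1)) w R)))))"
proof -
  interpret finite_tree G by unfold_locales (use assms in auto)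
  have sum: "(\<Sum>i=0..R-1. real D ^ i) = (\<Sum>j<R. real D ^ j)"
    using assms(7) by (intro sum.cong) auto
  have geometric: "(\<Sum>j<R. real D ^ j) = (real D ^ R - 1) / (real D - 1)" if "2 \<le> D"
    using that by (simp add: geometric_sum)
  \<comment> \<open>Brings the odd bound to the form \<open>1 / (b + ...)\<close> with
    \<open>b = D ^ R / 2\<close>, in which it was proved.\<close>
  have half: "2 / (2 * s + t) = 1 / (t / 2 + s)" for s t :: real
    using divide_divide_eq_right[of 1 "2 * s + t" 2] by (simp add: add_divide_distrib add.commute)
  have closed: "2 / (2 * (\<Sum>j<R. real D ^ j) + real D ^ R)
      = 2 * (real D - 1) / (real D ^ (R + 1) + real D ^ R - 2)" if "2 \<le> D"
  proof -
    have "2 * (\<Sum>j<R. real D ^ j) + real D ^ R = (real D ^ (R + 1) + real D ^ R - 2) / (real D - 1)"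
      unfolding geometric[OF that] using that by (simp add: field_simps)
    then show ?thesis by simp
  qed
  have even: "1 / (\<Sum>j<R. real D ^ j) \<le> steklov_lambda2 G"
    "steklov_lambda2 G = 1 / (\<Sum>j<R. real D ^ j) \<longleftrightarrow>
      contains_subgraph G (doubled_graph (rooted_branch
        (generated_subgraph (regular_tree (D + 1)) (graph_ball (regular_tree (D + 1)) x R)) y x) x)"
    if L: "L = 2 * R" and yx: "gadj (regular_tree (D + 1)) y x" for y x
  proof -
    have diam: "graph_diameter G \<le> 2 * R" using assms(5) L by simp
    show "1 / (\<Sum>j<R. real D ^ j) \<le> steklov_lambda2 G"
      by (rule lambda2_even_diameter(1)[OF assms(1,7,6) diam])
    show "steklov_lambda2 G = 1 / (\<Sum>j<R. real D ^ j) \<longleftrightarrow>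
      contains_subgraph G (doubled_graph (rooted_branch
        (generated_subgraph (regular_tree (D + 1)) (graph_ball (regular_tree (D + 1)) x R)) y x) x)"
      unfolding lambda2_even_diameter(2)[OF assms(1,7,6) diam]
      using contains_doubled_if_two_full_branches[OF assms(1,7), unfolded Suc_eq_plus1, OF _ _ yx]
        two_full_branches_if_contains_doubled[OF assms(1,7,6) diam, unfolded Suc_eq_plus1, OF yx] by blast
  qed
  have odd: "2 / (2 * (\<Sum>j<R. real D ^ j) + real D ^ R) \<le> steklov_lambda2 G"
    "steklov_lambda2 G = 2 / (2 * (\<Sum>j<R. real D ^ j) + real D ^ R) \<longleftrightarrow>
      isomorphic_graphs G (generated_subgraph (regular_tree (D + 1))
        (graph_ball (regular_tree (D + 1)) z R \<union> graph_ball (regular_tree (D + 1)) w R))"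
    if L: "L = 2 * R + 1" and zw: "gadj (regular_tree (D + 1)) z w" for z w
  proof -
    have diam: "graph_diameter G \<le> 2 * R + 1" using assms(5) L by simp
    show "2 / (2 * (\<Sum>j<R. real D ^ j) + real D ^ R) \<le> steklov_lambda2 G"
      unfolding half by (rule lambda2_odd_diameter(1)[OF assms(1,7,6) diam])
    show "steklov_lambda2 G = 2 / (2 * (\<Sum>j<R. real D ^ j) + real D ^ R) \<longleftrightarrow>
      isomorphic_graphs G (generated_subgraph (regular_tree (D + 1))
        (graph_ball (regular_tree (D + 1)) z R \<union> graph_ball (regular_tree (D + 1)) w R))"
      unfolding half lambda2_odd_diameter(2)[OF assms(1,7,6) diam]
      using isomorphic_if_full_at_edge[OF assms(1,7), unfolded Suc_eq_plus1, OF _ _ zw]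
        full_at_edge_if_isomorphic[OF assms(1,7,6), unfolded Suc_eq_plus1, OF zw] by blast
  qed
  \<comment> \<open>\<open>even\<close> and \<open>odd\<close> state the lower bounds under the
    assumption of an edge of the regular tree; this one makes them available.\<close>
  have "[0] \<in> gverts (regular_tree (D + 1))" "gadj (regular_tree (D + 1)) [] [0]"
    by (auto simp: gadj_regular_tree gverts_regular_tree)
  then show ?thesis
    unfolding sum using even odd closed geometric by (simp; blast)
qed

end
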